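(* Let $f$ be a function defined by a non-deterministic register transducer $T$. Then $f$ is continuous if and only if $f$ is computable.
   Context: Fix finite alphabets $\Sigma,\Gamma$, a countably infinite set $\mathcal{D}$ of data values with an effective representation (e.g. $\mathcal{D}=\mathbb{N}$) and a distinguished $d_0\in\mathcal{D}$. A test over a finite register set $R$ is a Boolean combination of $\top,\bot,r^{=},r^{\neq}$ ($r\in R$); for $\tau:R\to\mathcal{D}$ and $d\in\mathcal{D}$, $\tau,d\models r^{=}$ iff $\tau(r)=d$, $\tau,d\models r^{\neq}$ iff $\tau(r)\neq d$. A non-deterministic register transducer (NRT) is $T=(Q,R,i_0,F,\Delta)$ with finite states $Q$, initial $i_0$, accepting $F\subseteq Q$, finite register set $R$, and finite $\Delta\subseteq Q\times\Sigma\times\mathrm{Tests}_R\times2^R\times(\Gamma\times R)^*\times Q$. From configuration $(q,\tau)$, reading $(\sigma,d)$, a transition $(q,\sigma,\phi,\mathrm{asgn},o,q')$ with $\tau,d\models\phi$ leads to $(q',\tau')$ with $\tau'(r)=d$ if $r\in\mathrm{asgn}$ and $\tau'(r)=\tau(r)$ otherwise, outputting $(\gamma_1,\tau'(r_1))\cdots(\gamma_m,\tau'(r_m))$ where $o=(\gamma_1,r_1)\cdots(\gamma_m,r_m)$. An accepting run starts in $i_0$ with all registers equal to $d_0$ and visits $F$ infinitely often; standing assumption: accepting runs produce infinite outputs. $T$ defines $f$ if the set of (input, output) pairs of accepting runs is the graph of the partial function $f:(\Sigma\times\mathcal{D})^\omega\to(\Gamma\times\mathcal{D})^\omega$. Continuity: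 $f$ is continuous at $x\in\mathrm{dom}(f)$ if for all $i\geq0$ there is $j\geq0$ such that for all $y\in\mathrm{dom}(f)$, $|x\wedge y|\geq j$ implies $|f(x)\wedge f(y)|\geq i$ (where $\wedge$ is longest common prefix); $f$ is continuous if it is continuous at every $x\in\mathrm{dom}(f)$. Computability: consider deterministic Turing machines $M$ with a read-only one-way input tape holding an infinite data word, a two-way working tape, and a write-only one-way output tape; $M(x,k)$ denotes the content written on the output tape after $M$ has read the first $k$ cells of the input $x$. $f$ is computable if there is such an $M$ such that for all $x\in\mathrm{dom}(f)$ the sequence $(M(x,k))_{k\geq0}$ converges to $f(x)$, where a sequence $(w_n)$ of words converges to an infinite word $w$ if $|w_n\wedge w|\to\infty$ (equivalently, for the distance $d(u,v)=2^{-|u\wedge v|}$ for $u\neq v$, $d(w_n,w)\to0$). *)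

theory Defs
  imports
    Complex_Main
    "HOL-Library.Stream"
    "HOL-Library.Sublist"
    "HOL-Library.Extended_Nat"
begin

section \<open>Words, continuity and convergence\<close>

definition lcp_len :: "'a stream \<Rightarrow> 'a stream \<Rightarrow> enat" where
  "lcp_len x y = Sup {enat n | n. stake n x = stake n y}"

definition lcp_len_fin :: "'a list \<Rightarrow> 'a stream \<Rightarrow> nat" where
  "lcp_len_fin u y = length (longest_common_prefix u (stake (length u) y))"

definition word_converges :: "(nat \<Rightarrow> 'a list) \<Rightarrow> 'a stream \<Rightarrow> bool" where
  "word_converges w y \<longleftrightarrow> filterlim (\<lambda>n. lcp_len_fin (w n) y) at_top sequentially"

definition word_continuous_at :: "('a stream \<rightharpoonup> 'b stream) \<Rightarrow> 'a stream \<Rightarrow> bool" where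
  "word_continuous_at f x \<longleftrightarrow>
     (\<forall>i. \<exists>j. \<forall>y\<in>dom f. lcp_len x y \<ge> enat j \<longrightarrow>
        lcp_len (the (f x)) (the (f y)) \<ge> enat i)"

definition word_continuous :: "('a stream \<rightharpoonup> 'b stream) \<Rightarrow> bool" where
  "word_continuous f \<longleftrightarrow> (\<forall>x\<in>dom f. word_continuous_at f x)"


section \<open>Non-deterministic register transducers\<close>

text \<open>The finite alphabets are finite types; data words are streams over
  \<^typ>\<open>'s \<times> 'd\<close>.  The sets of states and of registers are explicit finite sets.
  A register valuation is a total function on the type of registers, but only its values on
  the register set of the transducer are ever tested or output.\<close>

datatype 'r reg_test =
    TTop
  | TBot
  | TEq 'r
  | TNeq 'r
  | TNot "'r reg_test"
  | TAnd "'r reg_test" "'r reg_test"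
  | TOr "'r reg_test" "'r reg_test"

fun sat_test :: "('r \<Rightarrow> 'd) \<Rightarrow> 'd \<Rightarrow> 'r reg_test \<Rightarrow> bool" where
  "sat_test \<tau> d TTop \<longleftrightarrow> True"
| "sat_test \<tau> d TBot \<longleftrightarrow> False"
| "sat_test \<tau> d (TEq r) \<longleftrightarrow> \<tau> r = d"
| "sat_test \<tau> d (TNeq r) \<longleftrightarrow> \<tau> r \<noteq> d"
| "sat_test \<tau> d (TNot \<phi>) \<longleftrightarrow> \<not> sat_test \<tau> d \<phi>"
| "sat_test \<tau> d (TAnd \<phi> \<psi>) \<longleftrightarrow> sat_test \<tau> d \<phi> \<and> sat_test \<tau> d \<psi>"
| "sat_test \<tau> d (TOr \<phi> \<psi>) \<longleftrightarrow> sat_test \<tau> d \<phi> \<or> sat_test \<tau> d \<psi>"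

type_synonym ('q, 'r, 's, 'g) nrt_trans =
  "'q \<times> 's \<times> 'r reg_test \<times> 'r set \<times> ('g \<times> 'r) list \<times> 'q"

record ('q, 'r, 's, 'g) nrt =
  nrt_states :: "'q set"
  nrt_regs :: "'r set"
  nrt_init :: 'q
  nrt_final :: "'q set"
  nrt_delta :: "('q, 'r, 's, 'g) nrt_trans set"

definition wf_nrt :: "('q, 'r, 's, 'g) nrt \<Rightarrow> bool" where
  "wf_nrt T \<longleftrightarrow>
     finite (nrt_states T) \<and> finite (nrt_regs T) \<and> finite (nrt_delta T) \<and>
     nrt_init T \<in> nrt_states T \<and> nrt_final T \<subseteq> nrt_states T \<and>
     (\<forall>(q, \<sigma>, \<phi>, asgn, out, q') \<in> nrt_delta T.
        q \<in> nrt_states T \<and> q' \<in> nrt_states T \<and>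
        set_reg_test \<phi> \<subseteq> nrt_regs T \<and> asgn \<subseteq> nrt_regs T \<and>
        snd ` set out \<subseteq> nrt_regs T)"

type_synonym ('q, 'r, 'd) nrt_conf = "'q \<times> ('r \<Rightarrow> 'd)"

definition reg_update :: "('r \<Rightarrow> 'd) \<Rightarrow> 'r set \<Rightarrow> 'd \<Rightarrow> ('r \<Rightarrow> 'd)" where
  "reg_update \<tau> asgn d = (\<lambda>r. if r \<in> asgn then d else \<tau> r)"

definition nrt_step ::
  "('q, 'r, 's, 'g) nrt \<Rightarrow> ('q, 'r, 'd) nrt_conf \<Rightarrow> 's \<times> 'd \<Rightarrow> ('g \<times> 'd) list \<Rightarrow>
   ('q, 'r, 'd) nrt_conf \<Rightarrow> bool" where
  "nrt_step T c a w c' \<longleftrightarrow>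
     (\<exists>\<phi> asgn out.
        (fst c, fst a, \<phi>, asgn, out, fst c') \<in> nrt_delta T \<and>
        sat_test (snd c) (snd a) \<phi> \<and>
        snd c' = reg_update (snd c) asgn (snd a) \<and>
        w = map (\<lambda>(\<gamma>, r). (\<gamma>, snd c' r)) out)"

definition accepting_run ::
  "('q, 'r, 's, 'g) nrt \<Rightarrow> 'd \<Rightarrow> ('s \<times> 'd) stream \<Rightarrow>
   (nat \<Rightarrow> ('q, 'r, 'd) nrt_conf) \<Rightarrow> (nat \<Rightarrow> ('g \<times> 'd) list) \<Rightarrow> bool" where
  "accepting_run T d0 x c w \<longleftrightarrow>
     c 0 = (nrt_init T, \<lambda>_. d0) \<and>
     (\<forall>i. nrt_step T (c i) (x !! i) (w i) (c (Suc i))) \<and>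
     (\<exists>\<^sub>\<infinity>i. fst (c i) \<in> nrt_final T)"

definition out_upto :: "(nat \<Rightarrow> 'a list) \<Rightarrow> nat \<Rightarrow> 'a list" where
  "out_upto w n = concat (map w [0..<n])"

text \<open>The standing assumption that every accepting run produces an infinite output.\<close>

definition infinite_outputs :: "('q, 'r, 's, 'g) nrt \<Rightarrow> 'd \<Rightarrow> bool" where
  "infinite_outputs T d0 \<longleftrightarrow>
     (\<forall>x c w. accepting_run T d0 x c w \<longrightarrow> (\<forall>m. \<exists>n. length (out_upto w n) \<ge> m))"

definition nrt_rel ::
  "('q, 'r, 's, 'g) nrt \<Rightarrow> 'd \<Rightarrow> (('s \<times> 'd) stream \<times> ('g \<times> 'd) stream) set" where
  "nrt_rel T d0 = {(x, y). \<exists>c w. accepting_run T d0 x c w \<and> word_converges (out_upto w) y}"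

definition nrt_defines ::
  "('q, 'r, 's, 'g) nrt \<Rightarrow> 'd \<Rightarrow> (('s \<times> 'd) stream \<rightharpoonup> ('g \<times> 'd) stream) \<Rightarrow> bool" where
  "nrt_defines T d0 f \<longleftrightarrow> nrt_rel T d0 = {(x, y). f x = Some y}"


section \<open>Deterministic Turing machines\<close>

text \<open>On the tapes, a letter \<open>(a, d)\<close> of a data word is written as the label \<open>a\<close>, followed by
  the binary code of \<open>d\<close> and an end marker.\<close>

datatype 'a tape_sym = Label 'a | Bit bool | End_Marker

datatype head_move = Move_Left | Stay | Move_Right

text \<open>States and working symbols are natural numbers drawn from finite sets, which loses no
  generality.  From a state, the scanned input symbol and the scanned working symbol, the
  transition function gives the new state, the symbol written on the working tape, the move of
  the working head, whether the input head advances by one cell, and the symbol (if any)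
  appended to the output tape.  The value \<^term>\<open>None\<close> means that the machine halts.\<close>

record ('a, 'b) tm =
  tm_states :: "nat set"
  tm_syms :: "nat set"
  tm_init :: nat
  tm_blank :: nat
  tm_delta :: "nat \<Rightarrow> 'a tape_sym \<Rightarrow> nat \<Rightarrow>
    (nat \<times> nat \<times> head_move \<times> bool \<times> 'b tape_sym option) option"

definition wf_tm :: "('a, 'b) tm \<Rightarrow> bool" where
  "wf_tm M \<longleftrightarrow>
     finite (tm_states M) \<and> finite (tm_syms M) \<and>
     tm_init M \<in> tm_states M \<and> tm_blank M \<in> tm_syms M \<and>
     (\<forall>q \<in> tm_states M. \<forall>a. \<forall>b \<in> tm_syms M. \<forall>q' b' mv adv out.
        tm_delta M q a b = Some (q', b', mv, adv, out) \<longrightarrow>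
          q' \<in> tm_states M \<and> b' \<in> tm_syms M)"

record 'b tm_conf =
  c_state :: nat
  c_inpos :: nat
  c_work :: "int \<Rightarrow> nat"
  c_workpos :: int
  c_out :: "'b tape_sym list"

fun move_head :: "head_move \<Rightarrow> int \<Rightarrow> int" where
  "move_head Move_Left p = p - 1"
| "move_head Stay p = p"
| "move_head Move_Right p = p + 1"

definition tm_step ::
  "('a, 'b) tm \<Rightarrow> 'a tape_sym stream \<Rightarrow> 'b tm_conf \<Rightarrow> 'b tm_conf option" where
  "tm_step M inp c =
     (case tm_delta M (c_state c) (inp !! c_inpos c) (c_work c (c_workpos c)) of
        None \<Rightarrow> None
      | Some (q', b', mv, adv, out) \<Rightarrow>
          Some \<lparr> c_state = q',
                 c_inpos = (if adv then Suc (c_inpos c) else c_inpos c),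
                 c_work = (c_work c)(c_workpos c := b'),
                 c_workpos = move_head mv (c_workpos c),
                 c_out = c_out c @ (case out of None \<Rightarrow> [] | Some s \<Rightarrow> [s]) \<rparr>)"

definition tm_start :: "('a, 'b) tm \<Rightarrow> 'b tm_conf" where
  "tm_start M =
     \<lparr> c_state = tm_init M, c_inpos = 0, c_work = (\<lambda>_. tm_blank M), c_workpos = 0, c_out = [] \<rparr>"

text \<open>The configuration after \<open>n\<close> steps; a halted machine keeps its last configuration.\<close>

primrec tm_run :: "('a, 'b) tm \<Rightarrow> 'a tape_sym stream \<Rightarrow> nat \<Rightarrow> 'b tm_conf" where
  "tm_run M inp 0 = tm_start M"
| "tm_run M inp (Suc n) =
     (case tm_step M inp (tm_run M inp n) of None \<Rightarrow> tm_run M inp n | Some c \<Rightarrow> c)"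


section \<open>Effective representations and computability\<close>

definition tm_decidable :: "bool list set \<Rightarrow> bool" where
  "tm_decidable L \<longleftrightarrow>
     (\<exists>M :: (unit, unit) tm. wf_tm M \<and>
        (\<forall>v. \<exists>n. let inp = map Bit v @- sconst End_Marker in
           tm_step M inp (tm_run M inp n) = None \<and>
           c_out (tm_run M inp n) = [Bit (v \<in> L)]))"

text \<open>Data values are represented by distinct binary words, and it is decidable whether a
  binary word represents a data value.\<close>

definition effective_rep :: "('d \<Rightarrow> bool list) \<Rightarrow> bool" where
  "effective_rep rep \<longleftrightarrow> inj rep \<and> tm_decidable (range rep)"

definition enc_letter :: "('d \<Rightarrow> bool list) \<Rightarrow> 'a \<times> 'd \<Rightarrow> 'a tape_sym list" where
  "enc_letter rep l = Label (fst l) # map Bit (rep (snd l)) @ [End_Marker]"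

definition enc_word :: "('d \<Rightarrow> bool list) \<Rightarrow> ('a \<times> 'd) list \<Rightarrow> 'a tape_sym list" where
  "enc_word rep u = concat (map (enc_letter rep) u)"

definition enc_stream :: "('d \<Rightarrow> bool list) \<Rightarrow> ('a \<times> 'd) stream \<Rightarrow> 'a tape_sym stream" where
  "enc_stream rep x = flat (smap (enc_letter rep) x)"

text \<open>After \<open>n\<close> steps on input \<open>x\<close>, the machine has read the first \<open>k\<close> letters of \<open>x\<close> if its
  input head has moved past their codes.  At the first such moment it has scanned nothing
  beyond these letters.\<close>

definition tm_has_read ::
  "('d \<Rightarrow> bool list) \<Rightarrow> ('a, 'b) tm \<Rightarrow> ('a \<times> 'd) stream \<Rightarrow> nat \<Rightarrow> nat \<Rightarrow> bool" where
  "tm_has_read rep M x k n \<longleftrightarrow>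
     c_inpos (tm_run M (enc_stream rep x) n) \<ge> length (enc_word rep (stake k x))"

definition tm_output ::
  "('d \<Rightarrow> bool list) \<Rightarrow> ('a, 'b) tm \<Rightarrow> ('a \<times> 'd) stream \<Rightarrow> nat \<Rightarrow> 'b tape_sym list" where
  "tm_output rep M x k = c_out (tm_run M (enc_stream rep x) (LEAST n. tm_has_read rep M x k n))"

text \<open>Convergence of the output is stated on the output tape itself.  Since the coding of
  letters is prefix-free, this amounts to convergence of the data words that are completely
  written on the tape.\<close>

definition word_computable ::
  "('d \<Rightarrow> bool list) \<Rightarrow> (('s \<times> 'd) stream \<rightharpoonup> ('g \<times> 'd) stream) \<Rightarrow> bool" where
  "word_computable rep f \<longleftrightarrow>
     (\<exists>M :: ('s, 'g) tm. wf_tm M \<and>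
        (\<forall>x\<in>dom f.
           (\<forall>k. \<exists>n. tm_has_read rep M x k n) \<and>
           word_converges (tm_output rep M x) (enc_stream rep (the (f x)))))"

end

theory Submission
  imports Defs "HOL-Library.Countable" "HOL-Library.Nat_Bijection"
begin

text \<open>A machine has written its output after \<open>k\<close> letters without having seen more than these
  letters, which gives continuity.

  Conversely, keep all runs of the transducer on the input read so far, each with its complete
  output, and emit the \<open>i\<close>-th output letter as soon as every accepting continuation of every run
  has the same letter at position \<open>i\<close>.  Continuity at the input guarantees that this happens for
  every \<open>i\<close>.  Whether a configuration has an accepting continuation with a letter different from
  \<open>(\<gamma>, d)\<close> at the \<open>n\<close>-th output position depends only on the state, on \<open>\<gamma>\<close>, on the equalities
  between the registers and \<open>d\<close>, and on \<open>n\<close>; as a function of \<open>n\<close> it is ultimately periodic,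
  because transitions have bounded output.  So a finite table, whose existence need not be
  effective, decides the test.  The Turing machine keeps the counters of a counter program in
  unary on parallel tracks of its working tape; the programs compute the functions generated from
  pairing by composition and iteration, which suffice for the algorithm.\<close>


section \<open>Counter programs\<close>

text \<open>A finite prefix of the input never shows which of its runs will be accepting, so a
  letter may be emitted only if it is right for every input in \<open>dom f\<close> that extends the
  prefix. Such a moment comes because an accepting continuation of any run on a long prefix of
  \<open>x\<close> is a run on an input in \<open>dom f\<close> close to \<open>x\<close>, whose
  output by continuity agrees with that of \<open>x\<close> at the position in question. Letters of
  runs without accepting continuation must be ignored; \<open>alive\<close> and
  \<open>may_differ\<close> express this. Both are invariant under injective renamings of data
  values, and a finite partial injection extends to all values; hence equality patterns suffice. The
  letter to be tested is taken from a run that has already written position \<open>i\<close>, since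
  the data values cannot all be tried. Timing matters as well: the output is measured when the input
  head passes a letter. The machine therefore works symbol by symbol, emits at most one symbol for
  each, and keeps the rest in a queue.\<close>

datatype com = Inc nat | Dec nat | Seq com com | Cond nat com com | While nat com

instance com :: countable
  by countable_datatype

inductive exec :: "com \<Rightarrow> (nat \<Rightarrow> nat) \<Rightarrow> (nat \<Rightarrow> nat) \<Rightarrow> bool" where
  exec_Inc: "exec (Inc v) s (s(v := Suc (s v)))"
| exec_Dec: "exec (Dec v) s (s(v := s v - 1))"
| exec_Seq: "exec c1 s s' \<Longrightarrow> exec c2 s' s'' \<Longrightarrow> exec (Seq c1 c2) s s''"
| exec_Cond_pos: "s v > 0 \<Longrightarrow> exec c1 s s' \<Longrightarrow> exec (Cond v c1 c2) s s'"
| exec_Cond_zero: "s v = 0 \<Longrightarrow> exec c2 s s' \<Longrightarrow> exec (Cond v c1 c2) s s'"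
| exec_While_zero: "s v = 0 \<Longrightarrow> exec (While v c) s s"
| exec_While_pos: "s v > 0 \<Longrightarrow> exec c s s' \<Longrightarrow> exec (While v c) s' s'' \<Longrightarrow> exec (While v c) s s''"

text \<open>A Hoare triple for total correctness. Some terminating execution is enough, as the
  machine simulates whichever execution is given.\<close>

definition total :: "((nat \<Rightarrow> nat) \<Rightarrow> bool) \<Rightarrow> com \<Rightarrow> ((nat \<Rightarrow> nat) \<Rightarrow> bool) \<Rightarrow> bool" where
  "total P c Q \<longleftrightarrow> (\<forall>s. P s \<longrightarrow> (\<exists>s'. exec c s s' \<and> Q s'))"

lemma total_Dec: "(\<And>s. P s \<Longrightarrow> Q (s(v := s v - 1))) \<Longrightarrow> total P (Dec v) Q"
  unfolding total_def by (metis exec_Dec)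

lemma total_Seq: "total P c1 R \<Longrightarrow> total R c2 Q \<Longrightarrow> total P (Seq c1 c2) Q"
  unfolding total_def by (metis exec_Seq)

lemma total_Cond:
  "total (\<lambda>s. P s \<and> s v > 0) c1 Q \<Longrightarrow> total (\<lambda>s. P s \<and> s v = 0) c2 Q \<Longrightarrow> total P (Cond v c1 c2) Q"
  unfolding total_def by (metis exec_Cond_pos exec_Cond_zero gr0I)

lemma total_While:
  fixes m :: "(nat \<Rightarrow> nat) \<Rightarrow> nat"
  assumes body: "\<And>k. total (\<lambda>s. P s \<and> s v > 0 \<and> m s = k) c (\<lambda>s. P s \<and> m s < k)"
  shows "total P (While v c) (\<lambda>s. P s \<and> s v = 0)"
proof -
  have "\<exists>s'. exec (While v c) s s' \<and> P s' \<and> s' v = 0" if "P s" for s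
    using that
  proof (induction "m s" arbitrary: s rule: less_induct)
    case less
    show ?case
    proof (cases "s v = 0")
      case True
      then show ?thesis using less.prems exec_While_zero by blast
    next
      case False
      then obtain s1 where s1: "exec c s s1" "P s1" "m s1 < m s"
        using body[of "m s"] less.prems unfolding total_def by auto
      with less.hyps[of s1] obtain s2 where "exec (While v c) s1 s2" "P s2" "s2 v = 0" by blast
      then show ?thesis using exec_While_pos False s1 by blast
    qed
  qed
  then show ?thesis unfolding total_def by blast
qed

text \<open>Finite support keeps the set stored in each tape cell finite, so that
  \<open>set_encode\<close> can be inverted on it.\<close>

lemma exec_finite_support:
  "exec c s s' \<Longrightarrow> finite {v. s v \<noteq> 0} \<Longrightarrow> finite {v. s' v \<noteq> 0}"
proof (induction rule: exec.induct)
  case (exec_Inc v s)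
  then show ?case by (rule_tac finite_subset[of _ "insert v {v. s v \<noteq> 0}"]) auto
next
  case (exec_Dec v s)
  then show ?case by (rule_tac finite_subset[of _ "insert v {v. s v \<noteq> 0}"]) auto
qed auto


section \<open>Simulation of counter programs by a Turing machine\<close>

text \<open>The states carry the stack of commands still to be run. \<open>Ret\<close> walks back to
  cell \<open>0\<close>. \<open>Del v\<close> erases the last unary mark of \<open>v\<close>, which
  is recognised only from the unmarked cell behind it.\<close>

datatype ctl = Start | Ready | Run "com list" | Ret "com list" | Del nat "com list"

instance ctl :: countable
  by countable_datatype

fun vars :: "com \<Rightarrow> nat set" where
  "vars (Inc v) = {v}"
| "vars (Dec v) = {v}"
| "vars (Seq c1 c2) = vars c1 \<union> vars c2"
| "vars (Cond v c1 c2) = {v} \<union> vars c1 \<union> vars c2"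
| "vars (While v c) = {v} \<union> vars c"

lemma finite_vars: "finite (vars c)"
  by (induction c) auto

text \<open>The stacks that can occur while \<open>c\<close> runs on top of \<open>K\<close>. They
  are finitely many because the body of a loop runs on top of the same loop again, so iterating adds
  nothing.\<close>

fun conts :: "com \<Rightarrow> com list \<Rightarrow> com list set" where
  "conts (Inc v) K = {Inc v # K, K}"
| "conts (Dec v) K = {Dec v # K, K}"
| "conts (Seq c1 c2) K = {Seq c1 c2 # K} \<union> conts c1 (c2 # K) \<union> conts c2 K"
| "conts (Cond v c1 c2) K = {Cond v c1 c2 # K} \<union> conts c1 K \<union> conts c2 K"
| "conts (While v c) K = {While v c # K, K} \<union> conts c (While v c # K)"

fun succs :: "com list \<Rightarrow> com list set" where
  "succs [] = {}"
| "succs (Inc v # K) = {K}"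
| "succs (Dec v # K) = {K}"
| "succs (Seq c1 c2 # K) = {c1 # c2 # K}"
| "succs (Cond v c1 c2 # K) = {c1 # K, c2 # K}"
| "succs (While v c # K) = {K, c # While v c # K}"

lemma finite_conts: "finite (conts c K)"
  by (induction c arbitrary: K) auto

lemma conts_self: "c # K \<in> conts c K" "K \<in> conts c K"
  by (induction c arbitrary: K) auto

text \<open>\<open>K\<close> is excepted because what follows it is no longer part of
  \<open>c\<close>. For \<open>K = []\<close> the exception is harmless, as
  \<open>succs [] = {}\<close>.\<close>

lemma conts_closed: "L \<in> conts c K \<Longrightarrow> L = K \<or> succs L \<subseteq> conts c K"
proof (induction c arbitrary: K L)
  case (Seq c1 c2)
  from Seq.prems consider "L = Seq c1 c2 # K" | "L \<in> conts c1 (c2 # K)" | "L \<in> conts c2 K" by auto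
  then show ?case
  proof cases
    case 1
    then show ?thesis by (simp add: conts_self)
  next
    case 2
    from Seq.IH(1)[OF this] show ?thesis
    proof
      assume "L = c2 # K"
      then show ?thesis using Seq.IH(2)[of L K] conts_self(1)[of c2 K] by auto
    qed auto
  next
    case 3
    from Seq.IH(2)[OF this] show ?thesis by auto
  qed
next
  case (Cond v c1 c2)
  from Cond.prems consider "L = Cond v c1 c2 # K" | "L \<in> conts c1 K" | "L \<in> conts c2 K" by auto
  then show ?case
  proof cases
    case 1
    then show ?thesis by (simp add: conts_self)
  next
    case 2
    from Cond.IH(1)[OF this] show ?thesis by auto
  next
    case 3
    from Cond.IH(2)[OF this] show ?thesis by auto
  qed
next
  case (While v c)
  from While.prems consider "L = While v c # K" | "L = K" | "L \<in> conts c (While v c # K)" by auto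
  then show ?case
  proof cases
    case 1
    then show ?thesis by (simp add: conts_self)
  next
    case 3
    from While.IH[OF this] show ?thesis by (auto simp: conts_self)
  qed auto
qed auto

text \<open>A store \<open>s\<close> is kept on the cells \<open>0, 1, \<dots>\<close> of the working tape in unary: cell \<open>p\<close> holds
  the set of all \<open>v\<close> with \<open>p < s v\<close> (shifted by one), and the element \<open>0\<close> marks cell \<open>0\<close>.\<close>

definition cell :: "(nat \<Rightarrow> nat) \<Rightarrow> int \<Rightarrow> nat set" where
  "cell s p = (if p < 0 then {} else {w. case w of 0 \<Rightarrow> p = 0 | Suc v \<Rightarrow> nat p < s v})"

definition tape :: "(nat \<Rightarrow> nat) \<Rightarrow> int \<Rightarrow> nat" where
  "tape s p = set_encode (cell s p)"

lemma cell_iff [simp]: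
  "0 \<in> cell s p \<longleftrightarrow> p = 0" "Suc v \<in> cell s (int k) \<longleftrightarrow> k < s v" "Suc v \<in> cell s 0 \<longleftrightarrow> 0 < s v"
  by (auto simp: cell_def)

lemma finite_cell:
  assumes "finite {v. s v \<noteq> 0}"
  shows "finite (cell s p)"
proof -
  have "cell s p \<subseteq> insert 0 (Suc ` {v. s v \<noteq> 0})"
  proof
    fix w assume "w \<in> cell s p"
    then show "w \<in> insert 0 (Suc ` {v. s v \<noteq> 0})"
      by (cases w) (auto simp: cell_def split: if_splits)
  qed
  then show ?thesis using assms finite_subset by blast
qed

lemma set_decode_tape: "finite {v. s v \<noteq> 0} \<Longrightarrow> set_decode (tape s p) = cell s p"
  by (simp add: tape_def finite_cell)

text \<open>Incrementing \<open>v\<close> changes the first cell without its mark, decrementing the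
  last cell with it; one write suffices in both cases.\<close>

lemma tape_Inc: "tape (s(v := Suc (s v))) = (tape s)(int (s v) := set_encode (insert (Suc v) (cell s (int (s v)))))"
proof
  fix p
  show "tape (s(v := Suc (s v))) p = ((tape s)(int (s v) := set_encode (insert (Suc v) (cell s (int (s v)))))) p"
    by (auto simp: tape_def cell_def split: nat.splits intro!: arg_cong[where f = set_encode])
qed

lemma tape_Dec:
  assumes "s v = Suc k"
  shows "tape (s(v := k)) = (tape s)(int k := set_encode (cell s (int k) - {Suc v}))"
proof
  fix p
  show "tape (s(v := k)) p = ((tape s)(int k := set_encode (cell s (int k) - {Suc v}))) p"
    using assms by (auto simp: tape_def cell_def split: nat.splits intro!: arg_cong[where f = set_encode])
qed

text \<open>The machine runs \<open>init\<close> once and \<open>prog a\<close> for each input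
  symbol \<open>a\<close>. After each of these it may emit one symbol, chosen by the set of nonzero
  counters, which is all that cell \<open>0\<close> shows.\<close>

locale stream_machine =
  fixes init :: com and prog :: "'a tape_sym \<Rightarrow> com" and emit :: "nat set \<Rightarrow> 'b tape_sym option"
  assumes finite_syms: "finite (UNIV :: 'a tape_sym set)"
begin

text \<open>Every command starts and ends with the head on cell \<open>0\<close>, where the mark of
  \<open>v\<close> is present iff the counter is positive; tests and emission rely on this.
  \<open>Start\<close> marks the cell so that \<open>Ret\<close> can find it. The input head moves
  past a symbol before the program for this symbol runs.\<close>

fun delta :: "ctl \<Rightarrow> 'a tape_sym \<Rightarrow> nat set \<Rightarrow> ctl \<times> nat set \<times> head_move \<times> bool \<times> 'b tape_sym option" where
  "delta Start a B = (Run [init], insert 0 B, Stay, False, None)"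
| "delta Ready a B = (Run [prog a], B, Stay, True, None)"
| "delta (Run []) a B = (Ready, B, Stay, False, emit {v. Suc v \<in> B})"
| "delta (Run (Inc v # K)) a B =
    (if Suc v \<in> B then (Run (Inc v # K), B, Move_Right, False, None)
     else (Ret K, insert (Suc v) B, Stay, False, None))"
| "delta (Run (Dec v # K)) a B =
    (if Suc v \<in> B then (Run (Dec v # K), B, Move_Right, False, None)
     else if 0 \<in> B then (Run K, B, Stay, False, None)
     else (Del v K, B, Move_Left, False, None))"
| "delta (Run (Seq c1 c2 # K)) a B = (Run (c1 # c2 # K), B, Stay, False, None)"
| "delta (Run (Cond v c1 c2 # K)) a B =
    (Run ((if Suc v \<in> B then c1 else c2) # K), B, Stay, False, None)"
| "delta (Run (While v c # K)) a B =
    (Run (if Suc v \<in> B then c # While v c # K else K), B, Stay, False, None)"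
| "delta (Ret K) a B =
    (if 0 \<in> B then (Run K, B, Stay, False, None) else (Ret K, B, Move_Left, False, None))"
| "delta (Del v K) a B = (Ret K, B - {Suc v}, Stay, False, None)"

definition KS :: "com list set" where
  "KS = conts init [] \<union> (\<Union>a. conts (prog a) [])"

definition VS :: "nat set" where
  "VS = (\<Union>K\<in>KS. \<Union>c\<in>set K. vars c)"

definition machine :: "('a, 'b) tm" where
  "machine = \<lparr> tm_states = to_nat ` ({Start, Ready} \<union> Run ` KS \<union> Ret ` KS \<union> case_prod Del ` (VS \<times> KS)),
     tm_syms = set_encode ` Pow (insert 0 (Suc ` VS)), tm_init = to_nat Start, tm_blank = 0,
     tm_delta = (\<lambda>q a b. case delta (from_nat q) a (set_decode b) of
        (q', B, mv, adv, out) \<Rightarrow> Some (to_nat q', set_encode B, mv, adv, out)) \<rparr>"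

lemma finite_KS: "finite KS"
  unfolding KS_def using finite_syms by (auto simp: finite_conts)

lemma finite_VS: "finite VS"
  unfolding VS_def using finite_KS by (auto simp: finite_vars)

lemma KS_closed:
  assumes "K \<in> KS"
  shows "succs K \<subseteq> KS"
proof -
  have "succs K \<subseteq> conts c []" if "K \<in> conts c []" for c
    using conts_closed[OF that] by auto
  then show ?thesis using assms unfolding KS_def by blast
qed

lemma VS_I: "c # K \<in> KS \<Longrightarrow> v \<in> vars c \<Longrightarrow> v \<in> VS"
  unfolding VS_def by force

lemma delta_closed:
  defines "C \<equiv> {Start, Ready} \<union> Run ` KS \<union> Ret ` KS \<union> case_prod Del ` (VS \<times> KS)"
  assumes "q \<in> C" "B \<subseteq> insert 0 (Suc ` VS)" "delta q a B = (q', B', mv, adv, out)"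
  shows "q' \<in> C \<and> B' \<subseteq> insert 0 (Suc ` VS)"
proof -
  from assms(2) consider "q = Start" | "q = Ready" | K where "q = Run K" "K \<in> KS"
    | K where "q = Ret K" "K \<in> KS" | v K where "q = Del v K" "K \<in> KS" by (auto simp: C_def)
  then show ?thesis
  proof cases
    case 1
    have "[init] \<in> KS" by (simp add: KS_def conts_self)
    then show ?thesis using 1 assms(3,4) by (auto simp: C_def)
  next
    case 2
    have "[prog a] \<in> KS" using conts_self(1)[of "prog a" "[]"] by (auto simp: KS_def)
    then show ?thesis using 2 assms(3,4) by (auto simp: C_def)
  next
    case 3
    show ?thesis
    proof (cases K)
      case Nil
      then show ?thesis using 3 assms(3,4) by (auto simp: C_def)
    next
      case (Cons c L)
      then have "succs (c # L) \<subseteq> KS" "vars c \<subseteq> VS" "c # L \<in> KS"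
        using KS_closed[of K] 3 VS_I by auto
      then show ?thesis
        by (cases c) (use Cons 3 assms(3,4) in \<open>auto simp: C_def split: if_splits\<close>)
    qed
  qed (use assms(3,4) in \<open>auto simp: C_def split: if_splits\<close>)
qed

lemma wf_machine: "wf_tm machine"
proof -
  have fin: "B \<subseteq> insert 0 (Suc ` VS) \<Longrightarrow> finite B" for B
    using finite_VS finite_subset by blast
  have "q' \<in> tm_states machine \<and> b' \<in> tm_syms machine"
    if q: "q \<in> tm_states machine" and b: "b \<in> tm_syms machine"
      and step: "tm_delta machine q a b = Some (q', b', mv, adv, out)" for q a b q' b' mv adv out
  proof -
    obtain p B where p: "q = to_nat p" "b = set_encode B" "B \<subseteq> insert 0 (Suc ` VS)"
      "p \<in> {Start, Ready} \<union> Run ` KS \<union> Ret ` KS \<union> case_prod Del ` (VS \<times> KS)"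
      using q b by (auto simp: machine_def)
    obtain p' B' mv' adv' out' where d: "delta p a B = (p', B', mv', adv', out')"
      by (metis prod_cases5)
    with step p fin have "q' = to_nat p'" "b' = set_encode B'" by (auto simp: machine_def)
    then show ?thesis using delta_closed[OF p(4,3) d] by (auto simp: machine_def)
  qed
  moreover have "tm_blank machine \<in> tm_syms machine"
    unfolding machine_def by (simp add: image_iff) (metis empty_subsetI set_encode_empty Pow_iff)
  moreover have "finite (tm_states machine)" "finite (tm_syms machine)" "tm_init machine \<in> tm_states machine"
    using finite_KS finite_VS by (simp_all add: machine_def)
  ultimately show ?thesis
    unfolding wf_tm_def by blast
qed

definition conf :: "ctl \<Rightarrow> (nat \<Rightarrow> nat) \<Rightarrow> int \<Rightarrow> nat \<Rightarrow> 'b tape_sym list \<Rightarrow> 'b tm_conf" where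
  "conf q s p i out = \<lparr> c_state = to_nat q, c_inpos = i, c_work = tape s, c_workpos = p, c_out = out \<rparr>"

abbreviation reach :: "'a tape_sym stream \<Rightarrow> 'b tm_conf \<Rightarrow> 'b tm_conf \<Rightarrow> bool" where
  "reach inp \<equiv> (\<lambda>c c'. tm_step machine inp c = Some c')\<^sup>*\<^sup>*"

lemma step_conf:
  assumes "finite {v. s v \<noteq> 0}" "delta q (inp !! i) (cell s p) = (q', B, mv, adv, e)"
    "tape s' = (tape s)(p := set_encode B)"
  shows "tm_step machine inp (conf q s p i out) = Some (conf q' s' (move_head mv p)
    (if adv then Suc i else i) (out @ (case e of None \<Rightarrow> [] | Some y \<Rightarrow> [y])))"
  using assms(2,3)
  by (simp add: tm_step_def conf_def machine_def set_decode_tape[OF assms(1)])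

lemma step_conf_same:
  assumes "finite {v. s v \<noteq> 0}" "delta q (inp !! i) (cell s p) = (q', cell s p, mv, adv, e)"
  shows "tm_step machine inp (conf q s p i out) = Some (conf q' s (move_head mv p)
    (if adv then Suc i else i) (out @ (case e of None \<Rightarrow> [] | Some y \<Rightarrow> [y])))"
  by (rule step_conf[OF assms]) (auto simp: tape_def)

lemma reach_Ret:
  assumes "finite {v. s v \<noteq> 0}"
  shows "reach inp (conf (Ret K) s (int k) i out) (conf (Run K) s 0 i out)"
proof (induction k)
  case 0
  show ?case using step_conf_same[OF assms, of "Ret K" inp i 0 "Run K" Stay False None out] by auto
next
  case (Suc k)
  have "tm_step machine inp (conf (Ret K) s (int (Suc k)) i out) = Some (conf (Ret K) s (int k) i out)"
    using step_conf_same[OF assms, of "Ret K" inp i "int (Suc k)" "Ret K" Move_Left False None out] by auto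
  then show ?case using Suc by (meson converse_rtranclp_into_rtranclp)
qed

lemma reach_scan:
  assumes "finite {v. s v \<noteq> 0}" "c = Inc v \<or> c = Dec v" "k \<le> s v"
  shows "reach inp (conf (Run (c # K)) s 0 i out) (conf (Run (c # K)) s (int k) i out)"
  using assms(3)
proof (induction k)
  case (Suc k)
  have "delta (Run (c # K)) (inp !! i) (cell s (int k)) = (Run (c # K), cell s (int k), Move_Right, False, None)"
    using assms(2) Suc.prems by auto
  from step_conf_same[OF assms(1) this, of out]
  have "tm_step machine inp (conf (Run (c # K)) s (int k) i out)
    = Some (conf (Run (c # K)) s (int (Suc k)) i out)" by (simp add: add.commute)
  with Suc show ?case by (meson Suc_leD rtranclp.rtrancl_into_rtrancl)
qed auto

lemma reach_exec:
  assumes "exec c s s'" "finite {v. s v \<noteq> 0}"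
  shows "reach inp (conf (Run (c # K)) s 0 i out) (conf (Run K) s' 0 i out)"
  using assms
proof (induction arbitrary: K rule: exec.induct)
  case (exec_Inc v s)
  let ?s' = "s(v := Suc (s v))"
  have fin': "finite {w. ?s' w \<noteq> 0}"
    using exec_finite_support[OF exec.exec_Inc exec_Inc] .
  have "reach inp (conf (Run (Inc v # K)) s 0 i out) (conf (Run (Inc v # K)) s (int (s v)) i out)"
    by (rule reach_scan[OF exec_Inc]) auto
  moreover have "tm_step machine inp (conf (Run (Inc v # K)) s (int (s v)) i out)
      = Some (conf (Ret K) ?s' (int (s v)) i out)"
    using step_conf[OF exec_Inc, of "Run (Inc v # K)" inp i "int (s v)" "Ret K"
      "insert (Suc v) (cell s (int (s v)))" Stay False None ?s' out] tape_Inc[of s v] by simp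
  ultimately show ?case using reach_Ret[OF fin', of inp K "s v" i out] by (meson converse_rtranclp_into_rtranclp rtranclp_trans)
next
  case (exec_Dec v s)
  have scan: "reach inp (conf (Run (Dec v # K)) s 0 i out) (conf (Run (Dec v # K)) s (int (s v)) i out)"
    by (rule reach_scan[OF exec_Dec]) auto
  show ?case
  proof (cases "s v")
    case 0
    then have "tm_step machine inp (conf (Run (Dec v # K)) s 0 i out) = Some (conf (Run K) s 0 i out)"
      using step_conf_same[OF exec_Dec, of "Run (Dec v # K)" inp i 0 "Run K" Stay False None out] by simp
    moreover have "s(v := s v - 1) = s" using 0 by auto
    ultimately show ?thesis by auto
  next
    case (Suc k)
    let ?s' = "s(v := k)"
    have fin': "finite {w. ?s' w \<noteq> 0}"
      using exec_finite_support[OF exec.exec_Dec exec_Dec] Suc by (metis diff_Suc_1)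
    have "tm_step machine inp (conf (Run (Dec v # K)) s (int (s v)) i out)
        = Some (conf (Del v K) s (int k) i out)"
      using step_conf_same[OF exec_Dec, of "Run (Dec v # K)" inp i "int (s v)" "Del v K" Move_Left False None out] Suc
        cell_iff(1)[of s "int (Suc k)"] cell_iff(2)[of v s "Suc k"]
      by simp
    moreover have "tm_step machine inp (conf (Del v K) s (int k) i out)
        = Some (conf (Ret K) ?s' (int k) i out)"
      using step_conf[OF exec_Dec, of "Del v K" inp i "int k" "Ret K"
        "cell s (int k) - {Suc v}" Stay False None ?s' out] tape_Dec[of s v, OF Suc] by simp
    ultimately have "reach inp (conf (Run (Dec v # K)) s 0 i out) (conf (Run K) ?s' 0 i out)"
      using reach_Ret[OF fin', of inp K k i out] scan
      by (meson converse_rtranclp_into_rtranclp rtranclp_trans)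
    then show ?thesis by (simp only: Suc diff_Suc_1)
  qed
next
  case (exec_Seq c1 s s' c2 s'')
  have "tm_step machine inp (conf (Run (Seq c1 c2 # K)) s 0 i out) = Some (conf (Run (c1 # c2 # K)) s 0 i out)"
    using step_conf_same[OF exec_Seq.prems, of "Run (Seq c1 c2 # K)" inp i 0 "Run (c1 # c2 # K)" Stay False None out]
    by simp
  moreover have "finite {w. s' w \<noteq> 0}"
    using exec_finite_support exec_Seq by blast
  ultimately show ?case using exec_Seq by (meson converse_rtranclp_into_rtranclp rtranclp_trans)
next
  case (exec_Cond_pos s v c1 s' c2)
  then have "tm_step machine inp (conf (Run (Cond v c1 c2 # K)) s 0 i out) = Some (conf (Run (c1 # K)) s 0 i out)"
    using step_conf_same[of s "Run (Cond v c1 c2 # K)" inp i 0 "Run (c1 # K)" Stay False None out] by simp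
  then show ?case using exec_Cond_pos by (meson converse_rtranclp_into_rtranclp)
next
  case (exec_Cond_zero s v c2 s' c1)
  then have "tm_step machine inp (conf (Run (Cond v c1 c2 # K)) s 0 i out) = Some (conf (Run (c2 # K)) s 0 i out)"
    using step_conf_same[of s "Run (Cond v c1 c2 # K)" inp i 0 "Run (c2 # K)" Stay False None out] by simp
  then show ?case using exec_Cond_zero by (meson converse_rtranclp_into_rtranclp)
next
  case (exec_While_zero s v c)
  then have "tm_step machine inp (conf (Run (While v c # K)) s 0 i out) = Some (conf (Run K) s 0 i out)"
    using step_conf_same[of s "Run (While v c # K)" inp i 0 "Run K" Stay False None out] by simp
  then show ?case by auto
next
  case (exec_While_pos s v c s' s'')
  then have "tm_step machine inp (conf (Run (While v c # K)) s 0 i out)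
      = Some (conf (Run (c # While v c # K)) s 0 i out)"
    using step_conf_same[of s "Run (While v c # K)" inp i 0 "Run (c # While v c # K)" Stay False None out] by simp
  moreover have "finite {w. s' w \<noteq> 0}"
    using exec_finite_support exec_While_pos by blast
  ultimately show ?case using exec_While_pos by (meson converse_rtranclp_into_rtranclp rtranclp_trans)
qed

lemma tm_run_reach:
  assumes "reach inp c c'" "tm_run machine inp n = c"
  shows "\<exists>n'. tm_run machine inp n' = c'"
  using assms
proof (induction rule: rtranclp_induct)
  case (step c1 c2)
  then obtain n' where "tm_run machine inp n' = c1" by blast
  then have "tm_run machine inp (Suc n') = c2" using step by simp
  then show ?case by blast
qed blast

text \<open>The store \<open>S 0\<close> is left by \<open>init\<close>, for which nothing is
  emitted; so the symbols start with \<open>S 1\<close>.\<close>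

primrec output_upto :: "(nat \<Rightarrow> nat \<Rightarrow> nat) \<Rightarrow> nat \<Rightarrow> 'b tape_sym list" where
  "output_upto S 0 = []"
| "output_upto S (Suc k) = output_upto S k @
     (case emit {v. S (Suc k) v > 0} of None \<Rightarrow> [] | Some y \<Rightarrow> [y])"

lemma tm_run_stores:
  assumes init: "exec init (\<lambda>_. 0) (S 0)" "emit {v. S 0 v > 0} = None"
    and prog: "\<And>k. exec (prog (inp !! k)) (S k) (S (Suc k))"
  shows "\<exists>n. tm_run machine inp n = conf Ready (S k) 0 k (output_upto S k)"
proof -
  have fin: "finite {v. S k v \<noteq> 0}" for k
  proof (induction k)
    case 0
    show ?case using exec_finite_support[OF init(1)] by simp
  next
    case (Suc k)
    then show ?case using exec_finite_support[OF prog] by blast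
  qed
  have emit_step: "tm_step machine inp (conf (Run []) (S k) 0 i out)
    = Some (conf Ready (S k) 0 i (out @ (case emit {v. S k v > 0} of None \<Rightarrow> [] | Some y \<Rightarrow> [y])))" for k i out
    using step_conf_same[OF fin[of k], of "Run []" inp i 0 Ready Stay False "emit {v. S k v > 0}" out] by simp
  show ?thesis
  proof (induction k)
    case 0
    have start: "tm_run machine inp 0 =
      \<lparr> c_state = to_nat Start, c_inpos = 0, c_work = (\<lambda>_. 0), c_workpos = 0, c_out = [] \<rparr>"
      by (simp add: tm_start_def machine_def)
    \<comment> \<open>\<open>Start\<close> writes the set \<open>{0}\<close> into cell
      \<open>0\<close>; its code is \<open>2 ^ 0 = 1\<close>.\<close>
    have blank: "(\<lambda>_::int. 0::nat)(0 := 1) = tape (\<lambda>_. 0)"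
    proof
      fix p :: int
      have "cell (\<lambda>_. 0) p = (if p = 0 then {0} else {})"
        by (auto simp: cell_def split: nat.splits)
      then show "((\<lambda>_::int. 0::nat)(0 := 1)) p = tape (\<lambda>_. 0) p" by (simp add: tape_def)
    qed
    have "tm_run machine inp 1 = conf (Run [init]) (\<lambda>_. 0) 0 0 []"
      unfolding One_nat_def tm_run.simps(2) start
      by (simp add: tm_step_def conf_def machine_def blank[symmetric])
    moreover have "reach inp (conf (Run [init]) (\<lambda>_. 0) 0 0 []) (conf Ready (S 0) 0 0 [])"
    proof (rule rtranclp.rtrancl_into_rtrancl)
      show "reach inp (conf (Run [init]) (\<lambda>_. 0) 0 0 []) (conf (Run []) (S 0) 0 0 [])"
        by (rule reach_exec[OF init(1)]) simp
      show "tm_step machine inp (conf (Run []) (S 0) 0 0 []) = Some (conf Ready (S 0) 0 0 [])"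
        using emit_step[of 0 0 "[]"] init(2) by simp
    qed
    ultimately show ?case unfolding output_upto.simps by (rule tm_run_reach[rotated])
  next
    case (Suc k)
    then obtain n where n: "tm_run machine inp n = conf Ready (S k) 0 k (output_upto S k)" by blast
    have "tm_step machine inp (conf Ready (S k) 0 k (output_upto S k))
      = Some (conf (Run [prog (inp !! k)]) (S k) 0 (Suc k) (output_upto S k))"
      using step_conf_same[OF fin[of k], of Ready inp k 0 "Run [prog (inp !! k)]" Stay True None "output_upto S k"] by simp
    moreover have "reach inp (conf (Run [prog (inp !! k)]) (S k) 0 (Suc k) (output_upto S k))
        (conf (Run []) (S (Suc k)) 0 (Suc k) (output_upto S k))"
      by (rule reach_exec[OF prog fin])
    moreover have "tm_step machine inp (conf (Run []) (S (Suc k)) 0 (Suc k) (output_upto S k))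
        = Some (conf Ready (S (Suc k)) 0 (Suc k) (output_upto S (Suc k)))"
      using emit_step[of "Suc k" "Suc k" "output_upto S k"] by simp
    ultimately have "reach inp (conf Ready (S k) 0 k (output_upto S k))
        (conf Ready (S (Suc k)) 0 (Suc k) (output_upto S (Suc k)))"
      by (meson converse_rtranclp_into_rtranclp rtranclp.rtrancl_into_rtrancl)
    then show ?case by (rule tm_run_reach) (rule n)
  qed
qed

end


section \<open>Functions computed by counter programs\<close>

definition clear :: "nat \<Rightarrow> com" where
  "clear v = While v (Dec v)"

definition add1 :: "nat \<Rightarrow> nat \<Rightarrow> com" where
  "add1 v a = While v (Seq (Dec v) (Inc a))"

definition add2 :: "nat \<Rightarrow> nat \<Rightarrow> nat \<Rightarrow> com" where
  "add2 v a b = While v (Seq (Dec v) (Seq (Inc a) (Inc b)))"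

definition copy :: "nat \<Rightarrow> nat \<Rightarrow> nat \<Rightarrow> com" where
  "copy v a t = Seq (clear a) (Seq (clear t) (Seq (add2 v a t) (add1 t v)))"

lemma exec_clear: "exec (clear v) s (s(v := 0))"
proof (induction "s v" arbitrary: s)
  case 0
  then have "s(v := 0) = s" by auto
  with exec_While_zero[of s v] show ?case unfolding clear_def by (metis 0)
next
  case (Suc k)
  from Suc.hyps(1)[of "s(v := s v - 1)"] Suc.hyps(2)
  have "exec (clear v) (s(v := s v - 1)) (s(v := 0))" by (metis diff_Suc_1 fun_upd_same fun_upd_upd)
  with exec_While_pos[OF _ exec_Dec] Suc.hyps(2) show ?case unfolding clear_def by (metis zero_less_Suc)
qed

lemma exec_add1:
  assumes "v \<noteq> a"
  shows "exec (add1 v a) s (s(v := 0, a := s a + s v))"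
proof (induction "s v" arbitrary: s)
  case 0
  then have "s(v := 0, a := s a + s v) = s" by auto
  with exec_While_zero[of s v] show ?case unfolding add1_def by (metis 0)
next
  case (Suc k)
  let ?s = "s(v := s v - 1, a := Suc (s a))"
  have "exec (Seq (Dec v) (Inc a)) s ?s"
    using exec_Seq[OF exec_Dec[of v s] exec_Inc[of a]] assms by simp
  moreover have "exec (add1 v a) ?s (?s(v := 0, a := ?s a + ?s v))"
    using Suc.hyps assms by (intro Suc.hyps(1)) auto
  moreover have "?s(v := 0, a := ?s a + ?s v) = s(v := 0, a := s a + s v)"
    using Suc.hyps(2) assms by auto
  ultimately show ?case
    unfolding add1_def using exec_While_pos Suc.hyps(2) by (metis zero_less_Suc)
qed

lemma exec_add2:
  assumes "v \<noteq> a" "v \<noteq> b" "a \<noteq> b"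
  shows "exec (add2 v a b) s (s(v := 0, a := s a + s v, b := s b + s v))"
proof (induction "s v" arbitrary: s)
  case 0
  then have "s(v := 0, a := s a + s v, b := s b + s v) = s" by auto
  with exec_While_zero[of s v] show ?case unfolding add2_def by (metis 0)
next
  case (Suc k)
  let ?s = "s(v := s v - 1, a := Suc (s a), b := Suc (s b))"
  have "exec (Seq (Dec v) (Seq (Inc a) (Inc b))) s ?s"
    using exec_Seq[OF exec_Dec[of v s] exec_Seq[OF exec_Inc[of a] exec_Inc[of b]]] assms by simp
  moreover have "exec (add2 v a b) ?s (?s(v := 0, a := ?s a + ?s v, b := ?s b + ?s v))"
    using Suc.hyps assms by (intro Suc.hyps(1)) auto
  moreover have "?s(v := 0, a := ?s a + ?s v, b := ?s b + ?s v) = s(v := 0, a := s a + s v, b := s b + s v)"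
    using Suc.hyps(2) assms by auto
  ultimately show ?case
    unfolding add2_def using exec_While_pos Suc.hyps(2) by (metis zero_less_Suc)
qed

lemma exec_copy:
  assumes "v \<noteq> a" "v \<noteq> t" "a \<noteq> t"
  shows "exec (copy v a t) s (s(a := s v, t := 0))"
proof -
  let ?s1 = "s(a := 0, t := 0)"
  let ?s2 = "?s1(v := 0, a := ?s1 a + ?s1 v, t := ?s1 t + ?s1 v)"
  have "exec (copy v a t) s (?s2(t := 0, v := ?s2 v + ?s2 t))"
    unfolding copy_def using assms
    by (intro exec_Seq[OF exec_clear exec_Seq[OF exec_clear exec_Seq[OF exec_add2 exec_add1]]]) auto
  moreover have "?s2(t := 0, v := ?s2 v + ?s2 t) = s(a := s v, t := 0)"
    using assms by (auto simp: fun_eq_iff)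
  ultimately show ?thesis by simp
qed

text \<open>Decoding walks through the Cantor enumeration of pairs.\<close>

definition unpair :: "nat \<Rightarrow> com" where
  "unpair n = Seq (clear (n + 1)) (Seq (clear (n + 2)) (While n (Seq (Dec n)
     (Cond (n + 2) (Seq (Dec (n + 2)) (Inc (n + 1))) (Seq (add1 (n + 1) (n + 2)) (Inc (n + 2)))))))"

lemma exec_unpair:
  "\<exists>s'. exec (unpair n) s s' \<and> s' n = 0 \<and> s' (n + 1) = fst (prod_decode (s n)) \<and>
     s' (n + 2) = snd (prod_decode (s n)) \<and> (\<forall>m<n. s' m = s m)"
proof -
  let ?body = "Seq (Dec n)
     (Cond (n + 2) (Seq (Dec (n + 2)) (Inc (n + 1))) (Seq (add1 (n + 1) (n + 2)) (Inc (n + 2))))"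
  \<comment> \<open>Counter \<open>n\<close> runs down while the pair behind it runs up the
    enumeration, from \<open>(a, b + 1)\<close> to \<open>(a + 1, b)\<close> and from
    \<open>(a, 0)\<close> to \<open>(0, a + 1)\<close>. So the sum of \<open>n\<close> and the index
    of the pair is constant.\<close>
  let ?I = "\<lambda>s'. s' n + prod_encode (s' (n + 1), s' (n + 2)) = s n \<and> (\<forall>m<n. s' m = s m)"
  have "total ?I (While n ?body) (\<lambda>s'. ?I s' \<and> s' n = 0)"
  proof (rule total_While[where m = "\<lambda>s. s n"])
    fix k
    let ?J = "\<lambda>s'. Suc (s' n + prod_encode (s' (n + 1), s' (n + 2))) = s n \<and> (\<forall>m<n. s' m = s m) \<and> s' n < k"
    show "total (\<lambda>s. ?I s \<and> s n > 0 \<and> s n = k) ?body (\<lambda>s. ?I s \<and> s n < k)"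
    proof (rule total_Seq[where R = ?J])
      show "total (\<lambda>s. ?I s \<and> s n > 0 \<and> s n = k) (Dec n) ?J"
        by (rule total_Dec) auto
      show "total ?J (Cond (n + 2) (Seq (Dec (n + 2)) (Inc (n + 1))) (Seq (add1 (n + 1) (n + 2)) (Inc (n + 2))))
          (\<lambda>s. ?I s \<and> s n < k)"
      proof (rule total_Cond)
        show "total (\<lambda>s. ?J s \<and> 0 < s (n + 2)) (Seq (Dec (n + 2)) (Inc (n + 1))) (\<lambda>s. ?I s \<and> s n < k)"
          unfolding total_def
        proof (intro allI impI)
          fix u assume J: "?J u \<and> 0 < u (n + 2)"
          then obtain b where b: "u (n + 2) = Suc b" using gr0_implies_Suc by blast
          have "exec (Seq (Dec (n + 2)) (Inc (n + 1))) u (u(n + 2 := b, n + 1 := Suc (u (n + 1))))"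
            using exec_Seq[OF exec_Dec[of "n + 2" u] exec_Inc[of "n + 1"]] b by simp
          then show "\<exists>s'. exec (Seq (Dec (n + 2)) (Inc (n + 1))) u s' \<and> (?I s' \<and> s' n < k)"
            using J b by (intro exI conjI) (assumption, auto simp: prod_encode_def)
        qed
        show "total (\<lambda>s. ?J s \<and> s (n + 2) = 0) (Seq (add1 (n + 1) (n + 2)) (Inc (n + 2))) (\<lambda>s. ?I s \<and> s n < k)"
          unfolding total_def
        proof (intro allI impI)
          fix u assume J: "?J u \<and> u (n + 2) = 0"
          have "exec (Seq (add1 (n + 1) (n + 2)) (Inc (n + 2))) u (u(n + 1 := 0, n + 2 := Suc (u (n + 1))))"
            using exec_Seq[OF exec_add1[of "n + 1" "n + 2" u] exec_Inc[of "n + 2"]] J by simp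
          then show "\<exists>s'. exec (Seq (add1 (n + 1) (n + 2)) (Inc (n + 2))) u s' \<and> (?I s' \<and> s' n < k)"
            using J by (intro exI conjI) (assumption, auto simp: prod_encode_def)
        qed
      qed
    qed
  qed
  moreover have "?I (s(n + 1 := 0, n + 2 := 0))" by (simp add: prod_encode_def)
  ultimately obtain s' where s': "exec (While n ?body) (s(n + 1 := 0, n + 2 := 0)) s'" "?I s'" "s' n = 0"
    unfolding total_def by blast
  then have "prod_decode (s n) = (s' (n + 1), s' (n + 2))" by (metis add_0 prod_encode_inverse)
  moreover have "exec (unpair n) s s'"
    unfolding unpair_def by (intro exec_Seq[OF exec_clear exec_Seq[OF exec_clear]] s'(1))
  ultimately show ?thesis using s' by auto
qed

text \<open>Uses \<open>prod_encode (a, b) = a + triangle (a + b)\<close>.\<close>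

definition pair :: "nat \<Rightarrow> com" where
  "pair n = Seq (clear n) (Seq (clear (n + 3)) (Seq (add2 (n + 1) n (n + 2))
     (While (n + 2) (Seq (add2 (n + 2) n (n + 3)) (Seq (Dec (n + 3)) (add1 (n + 3) (n + 2)))))))"

lemma exec_pair:
  "\<exists>s'. exec (pair n) s s' \<and> s' n = prod_encode (s (n + 1), s (n + 2)) \<and> (\<forall>m<n. s' m = s m)"
proof -
  let ?body = "Seq (add2 (n + 2) n (n + 3)) (Seq (Dec (n + 3)) (add1 (n + 3) (n + 2)))"
  \<comment> \<open>Each round adds the counter \<open>n + 2\<close> to \<open>n\<close> and then
    lowers it by one; what remains to be added is its triangle number.\<close>
  let ?I = "\<lambda>s'. s' n + triangle (s' (n + 2)) = prod_encode (s (n + 1), s (n + 2)) \<and> s' (n + 3) = 0 \<and>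
    (\<forall>m<n. s' m = s m)"
  have "total ?I (While (n + 2) ?body) (\<lambda>s'. ?I s' \<and> s' (n + 2) = 0)"
  proof (rule total_While[where m = "\<lambda>s. s (n + 2)"])
    fix k
    show "total (\<lambda>s. ?I s \<and> s (n + 2) > 0 \<and> s (n + 2) = k) ?body (\<lambda>s. ?I s \<and> s (n + 2) < k)"
      unfolding total_def
    proof (intro allI impI)
      fix u assume I: "?I u \<and> u (n + 2) > 0 \<and> u (n + 2) = k"
      then obtain b where b: "u (n + 2) = Suc b" using gr0_implies_Suc by blast
      let ?u1 = "u(n + 2 := 0, n := u n + u (n + 2), n + 3 := u (n + 3) + u (n + 2))"
      let ?u2 = "?u1(n + 3 := ?u1 (n + 3) - 1)"
      have "exec ?body u (?u2(n + 3 := 0, n + 2 := ?u2 (n + 2) + ?u2 (n + 3)))"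
        by (intro exec_Seq[OF exec_add2 exec_Seq[OF exec_Dec exec_add1]]) auto
      then show "\<exists>s'. exec ?body u s' \<and> (?I s' \<and> s' (n + 2) < k)"
        using I b by (intro exI conjI) (assumption, auto)
    qed
  qed
  moreover have "?I (s(n := 0, n + 3 := 0, n + 1 := 0, n := s (n + 1), n + 2 := s (n + 2) + s (n + 1)))"
    by (simp add: prod_encode_def add.commute)
  ultimately obtain s' where s':
    "exec (While (n + 2) ?body) (s(n := 0, n + 3 := 0, n + 1 := 0, n := s (n + 1), n + 2 := s (n + 2) + s (n + 1))) s'"
    "?I s'" "s' (n + 2) = 0"
    unfolding total_def by blast
  have "exec (add2 (n + 1) n (n + 2)) (s(n := 0, n + 3 := 0))
    (s(n := 0, n + 3 := 0, n + 1 := 0, n := s (n + 1), n + 2 := s (n + 2) + s (n + 1)))"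
    using exec_add2[of "n + 1" n "n + 2" "s(n := 0, n + 3 := 0)"] by simp
  then have "exec (pair n) s s'"
    unfolding pair_def
    using exec_Seq[OF exec_clear[of n s] exec_Seq[OF exec_clear[of "n + 3"] exec_Seq[OF _ s'(1)]]] by blast
  then show ?thesis using s' by auto
qed

text \<open>The register \<open>n\<close> is input and output; the registers below \<open>n\<close> are preserved, those above
  may hold arbitrary values before and after.\<close>

definition implements :: "nat \<Rightarrow> com \<Rightarrow> (nat \<Rightarrow> nat) \<Rightarrow> bool" where
  "implements n c f \<longleftrightarrow> (\<forall>s. \<exists>s'. exec c s s' \<and> s' n = f (s n) \<and> (\<forall>m<n. s' m = s m))"

text \<open>The primitive recursive functions in one argument: pairs replace argument lists, and
  iteration replaces recursion.\<close>

inductive prim :: "(nat \<Rightarrow> nat) \<Rightarrow> bool" where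
  prim_zero: "prim (\<lambda>_. 0)"
| prim_Suc: "prim Suc"
| prim_fst: "prim (\<lambda>x. fst (prod_decode x))"
| prim_snd: "prim (\<lambda>x. snd (prod_decode x))"
| prim_comp: "prim f \<Longrightarrow> prim g \<Longrightarrow> prim (\<lambda>x. f (g x))"
| prim_pair: "prim f \<Longrightarrow> prim g \<Longrightarrow> prim (\<lambda>x. prod_encode (f x, g x))"
| prim_iter: "prim f \<Longrightarrow> prim (\<lambda>x. (f ^^ fst (prod_decode x)) (snd (prod_decode x)))"

lemma implements_prim: "prim f \<Longrightarrow> \<exists>c. implements n c f"
proof (induction arbitrary: n rule: prim.induct)
  case prim_zero
  have "implements n (clear n) (\<lambda>_. 0)"
    unfolding implements_def
  proof
    fix s
    show "\<exists>s'. exec (clear n) s s' \<and> s' n = 0 \<and> (\<forall>m<n. s' m = s m)"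
      by (intro exI conjI, rule exec_clear) auto
  qed
  then show ?case by blast
next
  case prim_Suc
  have "implements n (Inc n) Suc"
    unfolding implements_def
  proof
    fix s
    show "\<exists>s'. exec (Inc n) s s' \<and> s' n = Suc (s n) \<and> (\<forall>m<n. s' m = s m)"
      by (intro exI conjI, rule exec_Inc) auto
  qed
  then show ?case by blast
next
  case prim_fst
  have "implements n (Seq (unpair n) (add1 (n + 1) n)) (\<lambda>x. fst (prod_decode x))"
    unfolding implements_def
  proof
    fix s
    obtain s' where s': "exec (unpair n) s s'" "s' n = 0" "s' (n + 1) = fst (prod_decode (s n))" "\<forall>m<n. s' m = s m"
      using exec_unpair by blast
    show "\<exists>s'. exec (Seq (unpair n) (add1 (n + 1) n)) s s' \<and> s' n = fst (prod_decode (s n)) \<and> (\<forall>m<n. s' m = s m)"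
      by (intro exI conjI, rule exec_Seq[OF s'(1) exec_add1]) (use s' in auto)
  qed
  then show ?case by blast
next
  case prim_snd
  have "implements n (Seq (unpair n) (add1 (n + 2) n)) (\<lambda>x. snd (prod_decode x))"
    unfolding implements_def
  proof
    fix s
    obtain s' where s': "exec (unpair n) s s'" "s' n = 0" "s' (n + 2) = snd (prod_decode (s n))" "\<forall>m<n. s' m = s m"
      using exec_unpair by blast
    show "\<exists>s'. exec (Seq (unpair n) (add1 (n + 2) n)) s s' \<and> s' n = snd (prod_decode (s n)) \<and> (\<forall>m<n. s' m = s m)"
      by (intro exI conjI, rule exec_Seq[OF s'(1) exec_add1]) (use s' in auto)
  qed
  then show ?case by blast
next
  case (prim_comp f g)
  then obtain c d where "implements n c f" "implements n d g" by blast
  then have "implements n (Seq d c) (\<lambda>x. f (g x))"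
    unfolding implements_def by (metis exec_Seq)
  then show ?case by blast
next
  case (prim_pair f g)
  then obtain c d where c: "implements (n + 1) c f" and d: "implements (n + 2) d g" by blast
  \<comment> \<open>A command preserves only the counters below its own. With \<open>f\<close> at
    \<open>n + 1\<close> and \<open>g\<close> at \<open>n + 2\<close> the input survives
    \<open>f\<close>, and the result of \<open>f\<close> survives \<open>g\<close>.\<close>
  let ?c = "Seq (copy n (n + 1) (n + 2)) (Seq c (Seq (copy n (n + 2) (n + 3)) (Seq d (pair n))))"
  have "implements n ?c (\<lambda>x. prod_encode (f x, g x))"
    unfolding implements_def
  proof
    fix s :: "nat \<Rightarrow> nat"
    let ?s1 = "s(n + 1 := s n, n + 2 := 0)"
    obtain s2 where s2: "exec c ?s1 s2" "s2 (n + 1) = f (s n)" "\<forall>m<n + 1. s2 m = ?s1 m"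
      using c[unfolded implements_def, THEN spec, of ?s1] by auto
    let ?s3 = "s2(n + 2 := s2 n, n + 3 := 0)"
    obtain s4 where s4: "exec d ?s3 s4" "s4 (n + 2) = g (?s3 (n + 2))" "\<forall>m<n + 2. s4 m = ?s3 m"
      using d unfolding implements_def by blast
    obtain s5 where s5: "exec (pair n) s4 s5" "s5 n = prod_encode (s4 (n + 1), s4 (n + 2))" "\<forall>m<n. s5 m = s4 m"
      using exec_pair by blast
    have "exec ?c s s5"
      by (intro exec_Seq[OF exec_copy exec_Seq[OF s2(1) exec_Seq[OF exec_copy exec_Seq[OF s4(1) s5(1)]]]]) auto
    then show "\<exists>s'. exec ?c s s' \<and> s' n = prod_encode (f (s n), g (s n)) \<and> (\<forall>m<n. s' m = s m)"
      using s2(2,3) s4(2,3) s5(2,3) by auto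
  qed
  then show ?case by blast
next
  case (prim_iter f)
  then obtain c where c: "implements (n + 2) c f" by blast
  \<comment> \<open>The body is compiled at \<open>n + 2\<close>, above the loop counter, which it
    has to preserve.\<close>
  let ?loop = "While (n + 1) (Seq (Dec (n + 1)) c)"
  have loop: "\<exists>s'. exec ?loop s s' \<and> s' (n + 2) = (f ^^ s (n + 1)) (s (n + 2)) \<and> (\<forall>m\<le>n. s' m = s m)" for s
  proof (induction "s (n + 1)" arbitrary: s)
    case 0
    then show ?case by (intro exI[of _ s] conjI exec_While_zero) auto
  next
    case (Suc k)
    obtain s1 where s1: "exec c (s(n + 1 := s (n + 1) - 1)) s1" "s1 (n + 2) = f (s (n + 2))"
      "\<forall>m<n + 2. s1 m = (s(n + 1 := s (n + 1) - 1)) m"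
      using c[unfolded implements_def, THEN spec, of "s(n + 1 := s (n + 1) - 1)"] by auto
    then have "s1 (n + 1) = k" using Suc.hyps(2) by simp
    with Suc.hyps(1)[of s1] obtain s2 where s2: "exec ?loop s1 s2" "s2 (n + 2) = (f ^^ k) (s1 (n + 2))"
      "\<forall>m\<le>n. s2 m = s1 m" by auto
    have "exec ?loop s s2"
      using exec_While_pos[OF _ exec_Seq[OF exec_Dec s1(1)] s2(1)] Suc.hyps(2) by simp
    moreover have "s2 (n + 2) = (f ^^ Suc k) (s (n + 2))"
      using s2(2) s1(2) by (simp add: funpow_swap1)
    ultimately show ?case using s1(3) s2(3) Suc.hyps(2) by (intro exI[of _ s2]) auto
  qed
  let ?c = "Seq (unpair n) (Seq ?loop (add1 (n + 2) n))"
  have "implements n ?c (\<lambda>x. (f ^^ fst (prod_decode x)) (snd (prod_decode x)))"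
    unfolding implements_def
  proof
    fix s
    obtain s1 where s1: "exec (unpair n) s s1" "s1 n = 0" "s1 (n + 1) = fst (prod_decode (s n))"
      "s1 (n + 2) = snd (prod_decode (s n))" "\<forall>m<n. s1 m = s m"
      using exec_unpair by blast
    obtain s2 where s2: "exec ?loop s1 s2" "s2 (n + 2) = (f ^^ s1 (n + 1)) (s1 (n + 2))" "\<forall>m\<le>n. s2 m = s1 m"
      using loop by blast
    have "exec ?c s (s2(n + 2 := 0, n := s2 n + s2 (n + 2)))"
      by (intro exec_Seq[OF s1(1) exec_Seq[OF s2(1) exec_add1]]) simp
    then show "\<exists>s'. exec ?c s s' \<and> s' n = (f ^^ fst (prod_decode (s n))) (snd (prod_decode (s n))) \<and>
        (\<forall>m<n. s' m = s m)"
      using s1 s2 by (intro exI conjI) (assumption, auto)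
  qed
  then show ?case by blast
qed

text \<open>Several functions of counter \<open>0\<close> are evaluated side by side. This provides
  one flag per output symbol, from which the finite control reads what to emit.\<close>

lemma exec_prims:
  assumes "\<And>g. g \<in> set gs \<Longrightarrow> prim g" "n > 0"
  shows "\<exists>c. \<forall>s. \<exists>s'. exec c s s' \<and> (\<forall>m<n. s' m = s m) \<and> (\<forall>j<length gs. s' (n + j) = (gs ! j) (s 0))"
  using assms
proof (induction gs arbitrary: n)
  case Nil
  \<comment> \<open>There is no empty program; clearing counter \<open>n\<close> takes its
    place.\<close>
  then show ?case using exec_clear[of n] by (intro exI[of _ "clear n"] allI) (rule exI, auto)
next
  case (Cons g gs)
  obtain c where c: "implements n c g" using implements_prim Cons.prems by fastforce
  obtain d where d: "\<forall>s. \<exists>s'. exec d s s' \<and> (\<forall>m<n + 1. s' m = s m) \<and>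
      (\<forall>j<length gs. s' (n + 1 + j) = (gs ! j) (s 0))"
    using Cons.IH[of "n + 1"] Cons.prems by auto
  let ?c = "Seq (copy 0 n (n + 1)) (Seq c d)"
  have "\<exists>s'. exec ?c s s' \<and> (\<forall>m<n. s' m = s m) \<and> (\<forall>j<length (g # gs). s' (n + j) = ((g # gs) ! j) (s 0))" for s
  proof -
    let ?s1 = "s(n := s 0, n + 1 := 0)"
    obtain s2 where s2: "exec c ?s1 s2" "s2 n = g (?s1 n)" "\<forall>m<n. s2 m = ?s1 m"
      using c unfolding implements_def by blast
    obtain s3 where s3: "exec d s2 s3" "\<forall>m<n + 1. s3 m = s2 m" "\<forall>j<length gs. s3 (n + 1 + j) = (gs ! j) (s2 0)"
      using d by blast
    have "exec ?c s s3"
      using Cons.prems(2) by (intro exec_Seq[OF exec_copy exec_Seq[OF s2(1) s3(1)]]) auto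
    moreover have "s3 (n + j) = ((g # gs) ! j) (s 0)" if "j < length (g # gs)" for j
      using that s2(2,3) s3(2,3) Cons.prems(2) by (cases j) auto
    ultimately show ?thesis using s2(3) s3(2) by (intro exI[of _ s3]) auto
  qed
  then show ?case by blast
qed


section \<open>Computable functions on encoded types\<close>

class coding =
  fixes encode :: "'a \<Rightarrow> nat"
  assumes inj_encode: "encode x = encode y \<Longrightarrow> x = y"
begin

lemma encode_eq_iff: "encode x = encode y \<longleftrightarrow> x = y"
  using inj_encode by auto

end

instantiation nat :: coding
begin
definition encode_nat :: "nat \<Rightarrow> nat" where "encode_nat n = n"
instance by standard (simp add: encode_nat_def)
end

instantiation bool :: coding
begin
definition encode_bool :: "bool \<Rightarrow> nat" where "encode_bool b = of_bool b"
instance by standard (simp add: encode_bool_def of_bool_eq_iff)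
end

instantiation prod :: (coding, coding) coding
begin
definition encode_prod :: "'a \<times> 'b \<Rightarrow> nat" where
  "encode_prod p = prod_encode (encode (fst p), encode (snd p))"
instance by standard (auto simp: encode_prod_def encode_eq_iff prod_eq_iff)
end

instantiation list :: (coding) coding
begin
definition encode_list :: "'a list \<Rightarrow> nat" where
  "encode_list xs = list_encode (map encode xs)"
instance by standard
  (simp add: encode_list_def list_encode_eq inj_map_eq_map[OF injI[OF inj_encode]])
end

lemma encode_Nil: "encode [] = 0"
  by (simp add: encode_list_def)

lemma encode_Cons: "encode (x # xs) = Suc (prod_encode (encode x, encode xs))"
  by (simp add: encode_list_def)

lemma length_le_encode: "length xs \<le> encode xs"
proof (induction xs)
  case (Cons x xs)
  then show ?case
    using le_prod_encode_2[of "encode xs" "encode x"] by (simp add: encode_Cons)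
qed (simp add: encode_Nil)

text \<open>Primitive recursive on codes. The values of \<open>g\<close> on numbers that code
  nothing are arbitrary.\<close>

definition computable :: "('a::coding \<Rightarrow> 'b::coding) \<Rightarrow> bool" where
  "computable f \<longleftrightarrow> (\<exists>g. prim g \<and> (\<forall>x. encode (f x) = g (encode x)))"

lemma prim_id: "prim (\<lambda>x. x)"
  using prim_pair[OF prim_fst prim_snd] by simp

lemma prim_const: "prim (\<lambda>_. n)"
proof (induction n)
  case (Suc n)
  then show ?case using prim_comp[OF prim_Suc] by blast
qed (rule prim_zero)

lemma computableI: "prim g \<Longrightarrow> (\<And>x. encode (f x) = g (encode x)) \<Longrightarrow> computable f"
  unfolding computable_def by blast

lemma computable_comp: "computable f \<Longrightarrow> computable g \<Longrightarrow> computable (\<lambda>x. f (g x))"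
  unfolding computable_def by (metis prim_comp)

named_theorems computable_intros

section \<open>Closure properties: pairs, iteration, branching, arithmetic\<close>

lemma computable_id [computable_intros]: "computable (\<lambda>x. x)"
  by (rule computableI[OF prim_id]) simp

lemma computable_const [computable_intros]: "computable (\<lambda>_. c)"
  by (rule computableI[OF prim_const]) simp

lemma computable_encode [computable_intros]: "computable a \<Longrightarrow> computable (\<lambda>x. encode (a x))"
  by (rule computable_comp[OF computableI[OF prim_id]]) (simp_all add: encode_nat_def)

lemma computable_Pair [computable_intros]:
  assumes "computable f" "computable g"
  shows "computable (\<lambda>x. (f x, g x))"
proof -
  obtain f' g' where "prim f'" "\<forall>x. encode (f x) = f' (encode x)" "prim g'" "\<forall>x. encode (g x) = g' (encode x)"
    using assms unfolding computable_def by blast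
  then show ?thesis by (intro computableI[OF prim_pair[of f' g']]) (auto simp: encode_prod_def)
qed

lemma computable_fst [computable_intros]: "computable a \<Longrightarrow> computable (\<lambda>x. fst (a x))"
  by (rule computable_comp[OF computableI[OF prim_fst]]) (simp_all add: encode_prod_def)

lemma computable_snd [computable_intros]: "computable a \<Longrightarrow> computable (\<lambda>x. snd (a x))"
  by (rule computable_comp[OF computableI[OF prim_snd]]) (simp_all add: encode_prod_def)

lemma computable_Suc [computable_intros]: "computable a \<Longrightarrow> computable (\<lambda>x. Suc (a x))"
  by (rule computable_comp[OF computableI[OF prim_Suc]]) (simp_all add: encode_nat_def)

lemma computable_of_bool [computable_intros]: "computable a \<Longrightarrow> computable (\<lambda>x. of_bool (a x) :: nat)"
  by (rule computable_comp[OF computableI[OF prim_id]]) (simp_all add: encode_nat_def encode_bool_def)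

lemma computable_funpow [computable_intros]:
  fixes f :: "'a::coding \<Rightarrow> 'b::coding \<Rightarrow> 'b"
  assumes f: "computable (\<lambda>p. f (fst p) (snd p))" and n: "computable n" and a: "computable a"
  shows "computable (\<lambda>x. (f x ^^ n x) (a x))"
proof -
  \<comment> \<open>The parameter is carried along in a pair, since \<open>prim_iter\<close>
    iterates a single fixed function.\<close>
  let ?F = "\<lambda>p. (fst p, f (fst p) (snd p))"
  have "computable ?F" by (intro computable_intros f)
  then obtain G where G: "prim G" "\<forall>p. encode (?F p) = G (encode p)"
    unfolding computable_def by blast
  have iter: "(?F ^^ k) (x, y) = (x, (f x ^^ k) y)" for k x y by (induction k) auto
  have "encode ((?F ^^ k) p) = (G ^^ k) (encode p)" for k p by (induction k) (auto simp: G(2))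
  then have "computable (\<lambda>p. (?F ^^ fst p) (snd p))"
    by (intro computableI[OF prim_iter[OF G(1)]]) (simp add: encode_prod_def encode_nat_def)
  then have "computable (\<lambda>x. (?F ^^ fst (n x, (x, a x))) (snd (n x, (x, a x))))"
    by (rule computable_comp) (intro computable_intros n a)
  then have "computable (\<lambda>x. snd ((?F ^^ n x) (x, a x)))"
    unfolding fst_conv snd_conv by (rule computable_snd)
  then show ?thesis by (simp add: iter)
qed

text \<open>Branching is iteration: the constant function with value \<open>a x\<close> is applied
  to \<open>b x\<close> once or not at all.\<close>

lemma computable_if [computable_intros]:
  assumes p: "computable p" and a: "computable a" and b: "computable b"
  shows "computable (\<lambda>x. if p x then a x else b x)"
proof -
  have "computable (\<lambda>x. ((\<lambda>_. a x) ^^ of_bool (p x)) (b x))"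
    by (intro computable_intros p b computable_comp[OF a])
  moreover have "((\<lambda>_. a x) ^^ of_bool (p x)) (b x) = (if p x then a x else b x)" for x
    by (cases "p x") auto
  ultimately show ?thesis by simp
qed

text \<open>Counting up in a pair whose first component lags one step behind gives the
  predecessor.\<close>

lemma computable_pred:
  assumes "computable a"
  shows "computable (\<lambda>x. a x - (1::nat))"
proof -
  have "((\<lambda>p :: nat \<times> nat. (snd p, Suc (snd p))) ^^ n) (0, 0) = (n - 1, n)" for n :: nat by (induction n) auto
  then have "a x - 1 = fst (((\<lambda>p :: nat \<times> nat. (snd p, Suc (snd p))) ^^ a x) (0, 0))" for x by simp
  then show ?thesis by (simp only:) (intro computable_intros assms)
qed

lemma computable_diff [computable_intros]:
  fixes a b :: "'a::coding \<Rightarrow> nat"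
  assumes "computable a" "computable b"
  shows "computable (\<lambda>x. a x - b x)"
proof -
  have "((\<lambda>m. m - 1) ^^ n) m = m - n" for m n :: nat by (induction n) auto
  then have "a x - b x = ((\<lambda>m. m - 1) ^^ b x) (a x)" for x by simp
  then show ?thesis by (simp only:) (intro computable_intros computable_pred assms)
qed

lemma computable_add [computable_intros]:
  fixes a b :: "'a::coding \<Rightarrow> nat"
  assumes "computable a" "computable b"
  shows "computable (\<lambda>x. a x + b x)"
proof -
  have "(Suc ^^ n) m = m + n" for m n by (induction n) auto
  then have "a x + b x = ((\<lambda>m. Suc m) ^^ b x) (a x)" for x by simp
  then show ?thesis by (simp only:) (intro computable_intros assms)
qed

text \<open>Two codes are equal iff both truncated differences vanish, and \<open>1 - n\<close>
  tests for zero. Injectivity of \<open>encode\<close> carries this over to the values.\<close>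

lemma computable_eq [computable_intros]:
  assumes "computable a" "computable b"
  shows "computable (\<lambda>x. a x = b x)"
proof -
  have "computable (\<lambda>n. (1::nat) - n)" by (intro computable_intros)
  then obtain g where g: "prim g" "\<And>n. g n = 1 - n"
    unfolding computable_def encode_nat_def by metis
  then have is_zero: "computable (\<lambda>n::nat. n = 0)"
    by (intro computableI[OF g(1)]) (auto simp: encode_bool_def encode_nat_def g(2))
  have "a x = b x \<longleftrightarrow> (encode (a x) - encode (b x)) + (encode (b x) - encode (a x)) = 0" for x
    using encode_eq_iff[of "a x" "b x"] by auto
  then show ?thesis by (simp only:) (intro computable_comp[OF is_zero] computable_intros assms)
qed

lemma computable_Not [computable_intros]:
  assumes "computable p"
  shows "computable (\<lambda>x. \<not> p x)"
proof -
  have "\<not> p x \<longleftrightarrow> (if p x then False else True)" for x by simp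
  then show ?thesis by (simp only:) (intro computable_intros assms)
qed

lemma computable_conj [computable_intros]:
  assumes "computable p" "computable q"
  shows "computable (\<lambda>x. p x \<and> q x)"
proof -
  have "p x \<and> q x \<longleftrightarrow> (if p x then q x else False)" for x by simp
  then show ?thesis by (simp only:) (intro computable_intros assms)
qed

lemma computable_disj [computable_intros]:
  assumes "computable p" "computable q"
  shows "computable (\<lambda>x. p x \<or> q x)"
proof -
  have "p x \<or> q x \<longleftrightarrow> (if p x then True else q x)" for x by simp
  then show ?thesis by (simp only:) (intro computable_intros assms)
qed

lemma computable_imp [computable_intros]:
  assumes "computable p" "computable q"
  shows "computable (\<lambda>x. p x \<longrightarrow> q x)"
proof -
  have "(p x \<longrightarrow> q x) \<longleftrightarrow> (if p x then q x else True)" for x by simp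
  then show ?thesis by (simp only:) (intro computable_intros assms)
qed

lemma computable_less [computable_intros]:
  fixes a b :: "'a::coding \<Rightarrow> nat"
  assumes "computable a" "computable b"
  shows "computable (\<lambda>x. a x < b x)"
proof -
  have "a x < b x \<longleftrightarrow> b x - a x \<noteq> 0" for x by auto
  then show ?thesis by (simp only:) (intro computable_intros assms)
qed

section \<open>Closure properties: lists\<close>

lemma computable_Cons [computable_intros]:
  assumes "computable a" "computable l"
  shows "computable (\<lambda>x. a x # l x)"
proof -
  have "computable (\<lambda>p. fst p # snd p :: 'b list)"
    by (rule computableI[OF prim_Suc]) (simp add: encode_Cons encode_prod_def)
  from computable_comp[OF this computable_Pair[OF assms]] show ?thesis by simp
qed

lemma computable_tl [computable_intros]:
  assumes "computable l"
  shows "computable (\<lambda>x. tl (l x))"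
proof -
  have "computable (\<lambda>n. n - (1::nat))" by (intro computable_intros)
  then obtain g where g: "prim g" "\<And>n. g n = n - 1"
    unfolding computable_def encode_nat_def by metis
  \<comment> \<open>The code of \<open>[]\<close> is \<open>0\<close>, and decoding must yield
    \<open>0\<close> again, because \<open>tl [] = []\<close>.\<close>
  have "prod_decode 0 = (0, 0)" using prod_encode_inverse[of "(0, 0)"] by (simp add: prod_encode_def)
  then have "encode (tl xs) = snd (prod_decode (g (encode xs)))" for xs :: "'b list"
    by (cases xs) (auto simp: encode_Cons encode_Nil g(2))
  then have "computable (\<lambda>xs. tl xs :: 'b list)"
    by (rule computableI[OF prim_comp[OF prim_snd g(1)]])
  from computable_comp[OF this assms] show ?thesis .
qed

lemma computable_hd [computable_intros]:
  assumes "computable l"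
  shows "computable (\<lambda>x. hd (l x))"
proof -
  have "computable (\<lambda>n. n - (1::nat))" by (intro computable_intros)
  then obtain g where g: "prim g" "\<And>n. g n = n - 1"
    unfolding computable_def encode_nat_def by metis
  \<comment> \<open>\<open>hd []\<close> is some fixed value, so its code can be a constant of the
    program.\<close>
  let ?d = "encode (hd [] :: 'b)"
  have fst: "computable (\<lambda>n. fst (prod_decode (g n)))"
    by (rule computableI[OF prim_comp[OF prim_fst g(1)]]) (simp add: encode_nat_def)
  have "computable (\<lambda>n::nat. if n = 0 then ?d else fst (prod_decode (g n)))"
    by (intro computable_intros fst)
  then obtain h where h: "prim h" "\<And>n. h n = (if n = 0 then ?d else fst (prod_decode (g n)))"
    unfolding computable_def encode_nat_def by metis
  have "encode (hd xs) = h (encode xs)" for xs :: "'b list"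
    by (cases xs) (auto simp: encode_Cons encode_Nil h(2) g(2))
  then have "computable (\<lambda>xs. hd xs :: 'b)"
    by (rule computableI[OF h(1)])
  from computable_comp[OF this assms] show ?thesis .
qed

lemma computable_foldl [computable_intros]:
  fixes f :: "'a::coding \<Rightarrow> 'b::coding \<Rightarrow> 'c::coding \<Rightarrow> 'b"
  assumes f: "computable (\<lambda>p. f (fst p) (fst (snd p)) (snd (snd p)))"
    and a: "computable a" and l: "computable l"
  shows "computable (\<lambda>x. foldl (f x) (a x) (l x))"
proof -
  \<comment> \<open>A round consumes one element and does nothing on the empty list. Hence any bound
    on the length may serve as the number of rounds, and the code of the list is one.\<close>
  let ?F = "\<lambda>x p. if snd p = [] then p else (f x (fst p) (hd (snd p)), tl (snd p))"
  have iter: "fst ((?F x ^^ n) (y, xs)) = foldl (f x) y xs" if "length xs \<le> n" for x y xs n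
    using that
  proof (induction n arbitrary: y xs)
    case (Suc n)
    then show ?case
    proof (cases xs)
      case Nil
      have "(?F x ^^ m) (y, []) = (y, [])" for m by (induction m) auto
      then show ?thesis by (simp only: Nil foldl_Nil fst_conv)
    next
      case (Cons z zs)
      then show ?thesis using Suc.IH[of zs "f x y z"] Suc.prems
        by (simp only: funpow_Suc_right o_apply) simp
    qed
  qed simp
  have "computable (\<lambda>p. f (fst p) (fst (snd p)) (hd (snd (snd p))))"
    using computable_comp[OF f, of "\<lambda>p. (fst p, fst (snd p), hd (snd (snd p)))"]
    by (simp add: computable_intros)
  then have "computable (\<lambda>x. fst ((?F x ^^ encode (l x)) (a x, l x)))"
    by (intro computable_intros a l)
  then show ?thesis by (simp only: iter[OF length_le_encode])
qed

lemma computable_rev [computable_intros]: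
  assumes "computable l"
  shows "computable (\<lambda>x. rev (l x))"
proof -
  have "foldl (\<lambda>ys y. y # ys) zs xs = rev xs @ zs" for xs zs :: "'b list" by (induction xs arbitrary: zs) auto
  then have "rev xs = foldl (\<lambda>ys y. y # ys) [] xs" for xs :: "'b list" by simp
  then show ?thesis by (simp only:) (intro computable_intros assms)
qed

lemma computable_append [computable_intros]:
  assumes "computable k" "computable l"
  shows "computable (\<lambda>x. k x @ l x)"
proof -
  have "foldl (\<lambda>ys y. y # ys) zs xs = rev xs @ zs" for xs zs :: "'b list" by (induction xs arbitrary: zs) auto
  then have "k x @ l x = foldl (\<lambda>ys y. y # ys) (l x) (rev (k x))" for x by simp
  then show ?thesis by (simp only:) (intro computable_intros assms)
qed

lemma computable_concat_map [computable_intros]: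
  fixes f :: "'a::coding \<Rightarrow> 'b::coding \<Rightarrow> 'c::coding list"
  assumes f: "computable (\<lambda>p. f (fst p) (snd p))" and l: "computable l"
  shows "computable (\<lambda>x. concat (map (f x) (l x)))"
proof -
  have "foldl (\<lambda>ys y. ys @ g y) zs xs = zs @ concat (map g xs)" for g :: "'b \<Rightarrow> 'c list" and zs xs
    by (induction xs arbitrary: zs) auto
  then have "concat (map (f x) (l x)) = foldl (\<lambda>ys y. ys @ f x y) [] (l x)" for x by simp
  moreover have "computable (\<lambda>p. f (fst p) (snd (snd p)))"
    using computable_comp[OF f, of "\<lambda>p. (fst p, snd (snd p))"] by (simp add: computable_intros)
  ultimately show ?thesis by (simp only:) (intro computable_intros l)
qed

lemma computable_map [computable_intros]:
  assumes f: "computable (\<lambda>p. f (fst p) (snd p))" and l: "computable l"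
  shows "computable (\<lambda>x. map (f x) (l x))"
proof -
  have "map (f x) (l x) = concat (map (\<lambda>y. [f x y]) (l x))" for x by simp
  then show ?thesis by (simp only:) (intro computable_intros f l)
qed

lemma computable_filter [computable_intros]:
  assumes f: "computable (\<lambda>p. f (fst p) (snd p))" and l: "computable l"
  shows "computable (\<lambda>x. filter (f x) (l x))"
proof -
  have "filter g xs = concat (map (\<lambda>y. if g y then [y] else []) xs)" for g :: "'b \<Rightarrow> bool" and xs
    by (induction xs) auto
  then have "filter (f x) (l x) = concat (map (\<lambda>y. if f x y then [y] else []) (l x))" for x by blast
  then show ?thesis by (simp only:) (intro computable_intros f l)
qed

lemma computable_length [computable_intros]:
  assumes "computable l"
  shows "computable (\<lambda>x. length (l x))"
proof -
  have "foldl (\<lambda>n y. Suc n) m xs = m + length xs" for m and xs :: "'b list" by (induction xs arbitrary: m) auto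
  then have "length (l x) = foldl (\<lambda>n y. Suc n) 0 (l x)" for x by simp
  then show ?thesis by (simp only:) (intro computable_intros assms)
qed

lemma computable_drop [computable_intros]:
  assumes "computable n" "computable l"
  shows "computable (\<lambda>x. drop (n x) (l x))"
proof -
  have "(tl ^^ m) xs = drop m xs" for m and xs :: "'b list" by (induction m) (auto simp: tl_drop drop_Suc)
  then have "drop (n x) (l x) = ((\<lambda>xs. tl xs) ^^ n x) (l x)" for x by simp
  then show ?thesis by (simp only:) (intro computable_intros assms)
qed

lemma computable_list_all [computable_intros]:
  assumes f: "computable (\<lambda>p. f (fst p) (snd p))" and l: "computable l"
  shows "computable (\<lambda>x. list_all (f x) (l x))"
proof -
  have "list_all g xs \<longleftrightarrow> filter (\<lambda>y. \<not> g y) xs = []" for g :: "'b \<Rightarrow> bool" and xs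
    by (auto simp: list_all_iff filter_empty_conv)
  then have "list_all (f x) (l x) \<longleftrightarrow> filter (\<lambda>y. \<not> f x y) (l x) = []" for x by blast
  then show ?thesis by (simp only:) (intro computable_intros f l)
qed

text \<open>Here \<open>ds\<close> is a constant and its elements need no coding. In this way the
  transitions, registers and output words of the transducer are written into the program.\<close>

lemma computable_const_concat_map:
  assumes "\<And>d. d \<in> set ds \<Longrightarrow> computable (f d)"
  shows "computable (\<lambda>x. concat (map (\<lambda>d. f d x) ds))"
  using assms by (induction ds) (auto intro!: computable_intros)

lemma computable_const_map:
  assumes "\<And>d. d \<in> set ds \<Longrightarrow> computable (f d)"
  shows "computable (\<lambda>x. map (\<lambda>d. f d x) ds)"
  using assms by (induction ds) (auto intro!: computable_intros)

text \<open>\<open>F\<close> is arbitrary, so this is the place where information that is not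
  effectively obtained enters the machine.\<close>

lemma computable_table:
  fixes F :: "'a::coding \<Rightarrow> 'b::coding"
  assumes "finite D"
  shows "\<exists>g. computable g \<and> (\<forall>x\<in>D. g x = F x)"
  using assms
proof induction
  case empty
  show ?case using computable_const by blast
next
  case (insert a D)
  then obtain g where g: "computable g" "\<forall>x\<in>D. g x = F x" by blast
  have "computable (\<lambda>x. if x = a then F a else g x)" by (intro computable_intros g)
  then show ?case using g(2) by (intro exI[of _ "\<lambda>x. if x = a then F a else g x"]) auto
qed

text \<open>A sequence in a finite set in which each member determines its successor is ultimately
  periodic; here only its members up to a renaming are computed.\<close>

lemma computable_finite_sequence:
  fixes s :: "nat \<Rightarrow> 'a"
  assumes fin: "finite (range s)" and det: "\<And>m n. s m = s n \<Longrightarrow> s (Suc m) = s (Suc n)"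
  shows "\<exists>c :: nat \<Rightarrow> nat. computable c \<and> finite (range c) \<and> (\<forall>m n. c m = c n \<longleftrightarrow> s m = s n)"
proof -
  define c where "c n = to_nat_on (range s) (s n)" for n
  have c: "c m = c n \<longleftrightarrow> s m = s n" for m n
    unfolding c_def using fin by (simp add: countable_finite)
  have fin_c: "finite (range c)"
    unfolding c_def using finite_imageI[OF fin, of "to_nat_on (range s)"] by (simp add: image_image)
  \<comment> \<open>Any index with class \<open>k\<close> may be chosen; by \<open>det\<close> the
    class of its successor is the same.\<close>
  define next_c where "next_c k = c (Suc (SOME n. c n = k))" for k
  have next_c: "next_c (c n) = c (Suc n)" for n
  proof -
    have "c (SOME m. c m = c n) = c n" by (rule someI) simp
    then show ?thesis unfolding next_c_def using c det by blast
  qed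
  obtain g where g: "computable g" "\<forall>k\<in>range c. g k = next_c k"
    using computable_table[OF fin_c] by blast
  have "c n = (g ^^ n) (c 0)" for n
  proof (induction n)
    case (Suc n)
    then show ?case using g(2) next_c by (metis funpow.simps(2) o_apply rangeI)
  qed simp
  moreover have "computable (\<lambda>n. (g ^^ n) (c 0))"
    by (intro computable_intros computable_comp[OF g(1)])
  ultimately have "computable c" by (metis (no_types, lifting) ext)
  then show ?thesis using c fin_c by blast
qed


section \<open>Turing machines for computable stream processors\<close>

fun emitted :: "('a \<Rightarrow> 'x \<Rightarrow> 'x) \<Rightarrow> ('x \<Rightarrow> 'y option) \<Rightarrow> 'x \<Rightarrow> 'a list \<Rightarrow> 'y list" where
  "emitted h out X [] = []"
| "emitted h out X (a # as) =
     (case out (h a X) of None \<Rightarrow> [] | Some y \<Rightarrow> [y]) @ emitted h out (h a X) as"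

lemma emitted_append:
  "emitted h out X (as @ bs) = emitted h out X as @ emitted h out (fold h as X) bs"
  by (induction as arbitrary: X) auto

text \<open>The finite control cannot inspect an encoded state, but it sees which counters are
  nonzero. So the program computes, for each of the finitely many output symbols, a flag telling
  whether it is due.\<close>

theorem stream_processor_machine:
  fixes h :: "'a tape_sym \<Rightarrow> 'x::coding \<Rightarrow> 'x" and out :: "'x \<Rightarrow> 'b tape_sym option"
  assumes fin: "finite (UNIV :: 'a tape_sym set)" "finite (UNIV :: 'b tape_sym set)"
    and h: "\<And>a. computable (h a)" and out: "\<And>y. computable (\<lambda>X. out X = Some y)"
    and X0: "out X0 = None"
  shows "\<exists>M :: ('a, 'b) tm. wf_tm M \<and> (\<forall>inp k. \<exists>n. c_inpos (tm_run M inp n) = k \<and>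
    c_out (tm_run M inp n) = emitted h out X0 (stake k inp))"
proof -
  obtain ys :: "'b tape_sym list" where ys: "set ys = UNIV" "distinct ys"
    using fin(2) finite_distinct_list by blast
  have "\<forall>y. \<exists>g. prim g \<and> (\<forall>X. of_bool (out X = Some y) = g (encode X))"
    using out unfolding computable_def encode_bool_def by blast
  then obtain flag where flag: "\<And>y. prim (flag y)" "\<And>y X. of_bool (out X = Some y) = flag y (encode X)"
    by metis
  have prog: "\<exists>c. \<forall>s. \<exists>s'. exec c s s' \<and> s' 0 = g (s 0) \<and> (\<forall>j<length ys. s' (Suc j) = flag (ys ! j) (g (s 0)))"
    if "prim g" for g
  proof -
    obtain c where c: "implements 0 c g" using implements_prim[OF \<open>prim g\<close>] by blast
    obtain d where d: "\<forall>s. \<exists>s'. exec d s s' \<and> (\<forall>m<1. s' m = s m) \<and>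
        (\<forall>j<length (map flag ys). s' (1 + j) = (map flag ys ! j) (s 0))"
      using exec_prims[of "map flag ys" 1] flag(1) by auto
    have "\<exists>s'. exec (Seq c d) s s' \<and> s' 0 = g (s 0) \<and> (\<forall>j<length ys. s' (Suc j) = flag (ys ! j) (g (s 0)))" for s
    proof -
      obtain s1 where s1: "exec c s s1" "s1 0 = g (s 0)" using c unfolding implements_def by blast
      obtain s2 where s2: "exec d s1 s2" "s2 0 = s1 0" "\<forall>j<length ys. s2 (Suc j) = flag (ys ! j) (s1 0)"
        using d[THEN spec, of s1] by auto
      show ?thesis
        by (intro exI[of _ s2] conjI exec_Seq[OF s1(1) s2(1)]) (use s1(2) s2(2,3) in auto)
    qed
    then show ?thesis by blast
  qed
  obtain c0 where c0: "\<forall>s. \<exists>s'. exec c0 s s' \<and> s' 0 = encode X0 \<and>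
      (\<forall>j<length ys. s' (Suc j) = flag (ys ! j) (encode X0))"
    using prog[OF prim_const[of "encode X0"]] by blast
  have "\<forall>a. \<exists>g. prim g \<and> (\<forall>X. encode (h a X) = g (encode X))"
    using h unfolding computable_def by blast
  then obtain H where H: "\<And>a. prim (H a)" "\<And>a X. encode (h a X) = H a (encode X)" by metis
  obtain pr where pr: "\<And>a s. \<exists>s'. exec (pr a) s s' \<and> s' 0 = H a (s 0) \<and>
      (\<forall>j<length ys. s' (Suc j) = flag (ys ! j) (H a (s 0)))"
    using prog[OF H(1)] by metis
  \<comment> \<open>Counter \<open>Suc j\<close> is the flag of \<open>ys ! j\<close>. In a store
    that represents a state all raised flags name the same symbol, so the choice is
    harmless.\<close>
  define emit where "emit A = (if \<exists>j<length ys. Suc j \<in> A then Some (ys ! (SOME j. j < length ys \<and> Suc j \<in> A)) else None)"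
    for A :: "nat set"
  have emit: "emit {v. s v > 0} = out X" if "\<forall>j<length ys. s (Suc j) = flag (ys ! j) (encode X)" for s X
  proof -
    have pos: "s (Suc j) > 0 \<longleftrightarrow> out X = Some (ys ! j)" if "j < length ys" for j
      using \<open>\<forall>j<length ys. _ j\<close> that by (simp flip: flag(2))
    show ?thesis
    proof (cases "out X")
      case None
      then show ?thesis using pos by (auto simp: emit_def)
    next
      case (Some y)
      then obtain j where j: "j < length ys" "ys ! j = y" using ys(1) by (metis UNIV_I in_set_conv_nth)
      let ?j = "SOME j. j < length ys \<and> Suc j \<in> {v. s v > 0}"
      have "?j < length ys \<and> Suc ?j \<in> {v. s v > 0}"
        by (rule someI[of _ j]) (use j Some pos in auto)
      then show ?thesis using pos[of ?j] pos[of j] j Some by (auto simp: emit_def)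
    qed
  qed
  interpret stream_machine c0 pr emit by standard (rule fin(1))
  have "\<exists>n. c_inpos (tm_run machine inp n) = k \<and>
    c_out (tm_run machine inp n) = emitted h out X0 (stake k inp)" for inp k
  proof -
    let ?X = "\<lambda>k. fold h (stake k inp) X0"
    let ?P = "\<lambda>k s. (k = 0 \<longrightarrow> exec c0 (\<lambda>_. 0) s) \<and> s 0 = encode (?X k) \<and>
      (\<forall>j<length ys. s (Suc j) = flag (ys ! j) (encode (?X k)))"
    \<comment> \<open>The scratch counters are not determined by the specification of the programs,
      so the stores are chosen one after another along the execution.\<close>
    have "\<exists>S. \<forall>k. ?P k (S k) \<and> exec (pr (inp !! k)) (S k) (S (Suc k))"
    proof (rule dependent_nat_choice)
      show "\<exists>s. ?P 0 s" using c0 by auto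
      fix s k assume "?P k s"
      moreover obtain s' where "exec (pr (inp !! k)) s s'" "s' 0 = H (inp !! k) (s 0)"
        "\<forall>j<length ys. s' (Suc j) = flag (ys ! j) (H (inp !! k) (s 0))" using pr by blast
      ultimately show "\<exists>s'. ?P (Suc k) s' \<and> exec (pr (inp !! k)) s s'"
        by (intro exI[of _ s']) (simp add: stake_Suc H(2) del: stake.simps(2))
    qed
    then obtain S where S: "\<And>k. ?P k (S k)" "\<And>k. exec (pr (inp !! k)) (S k) (S (Suc k))" by blast
    have out_S: "emit {v. S k v > 0} = out (?X k)" for k using S(1) by (intro emit) blast
    have "output_upto S k = emitted h out X0 (stake k inp)" for k
    proof (induction k)
      case (Suc k)
      have "output_upto S (Suc k) = emitted h out X0 (stake k inp) @
          (case out (?X (Suc k)) of None \<Rightarrow> [] | Some y \<Rightarrow> [y])"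
        by (simp only: output_upto.simps Suc.IH out_S)
      then show ?case
        by (simp add: stake_Suc emitted_append del: stake.simps(2) output_upto.simps)
    qed simp
    moreover have "\<exists>n. tm_run machine inp n = conf Ready (S k) 0 k (output_upto S k)"
    proof (rule tm_run_stores)
      show "exec c0 (\<lambda>_. 0) (S 0)" using S(1) by blast
      show "emit {v. S 0 v > 0} = None" using X0 out_S[of 0] by simp
    qed (rule S(2))
    ultimately obtain n where "tm_run machine inp n = conf Ready (S k) 0 k (emitted h out X0 (stake k inp))"
      by auto
    then show ?thesis by (intro exI[of _ n]) (simp add: conf_def)
  qed
  then show ?thesis using wf_machine by blast
qed


section \<open>Convergence of words\<close>

lemma le_lcp_len_iff: "enat n \<le> lcp_len x y \<longleftrightarrow> stake n x = stake n y"
proof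
  assume le: "enat n \<le> lcp_len x y"
  show "stake n x = stake n y"
  proof (rule ccontr)
    assume neq: "stake n x \<noteq> stake n y"
    have "k < n" if "stake k x = stake k y" for k
      using neq that by (metis min.absorb1 not_le take_stake)
    then have "lcp_len x y \<le> enat (n - 1)"
      unfolding lcp_len_def by (intro Sup_least) force
    with le have "n \<le> n - 1" by (metis enat_ord_simps(1) order_trans)
    then have "n = 0" by simp
    with neq show False by simp
  qed
qed (auto simp: lcp_len_def intro: Sup_upper)

lemma le_lcp_len_fin_iff: "n \<le> lcp_len_fin u y \<longleftrightarrow> n \<le> length u \<and> take n u = stake n y"
proof
  let ?p = "longest_common_prefix u (stake (length u) y)"
  assume "n \<le> lcp_len_fin u y"
  then have n: "n \<le> length ?p" by (simp add: lcp_len_fin_def)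
  have pre: "prefix ?p u" "prefix ?p (stake (length u) y)"
    by (simp_all add: longest_common_prefix_prefix1 longest_common_prefix_prefix2)
  then have "take n ?p = take n u" "take n ?p = take n (stake (length u) y)"
    using n by (metis prefixE take_append append_Nil2 diff_is_0_eq' take0)+
  moreover have "n \<le> length u" using n prefix_length_le[OF pre(1)] by simp
  ultimately show "n \<le> length u \<and> take n u = stake n y" by (simp add: take_stake min_def)
next
  assume *: "n \<le> length u \<and> take n u = stake n y"
  then have "take n (stake (length u) y) = take n u" by (simp add: take_stake min_def)
  then have "prefix (take n u) u" "prefix (take n u) (stake (length u) y)"
    by (metis take_is_prefix)+
  then have "prefix (take n u) (longest_common_prefix u (stake (length u) y))"
    by (rule longest_common_prefix_max_prefix)
  then show "n \<le> lcp_len_fin u y"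
    using * unfolding lcp_len_fin_def by (metis length_take min.absorb2 prefix_length_le)
qed

lemma word_converges_iff:
  "word_converges w y \<longleftrightarrow> (\<forall>n. \<exists>k0. \<forall>k\<ge>k0. n \<le> length (w k) \<and> take n (w k) = stake n y)"
  by (simp add: word_converges_def filterlim_at_top eventually_sequentially le_lcp_len_fin_iff)

lemma word_converges_prefixes:
  assumes "\<And>k. w k = stake (length (w k)) y" "\<And>n. \<exists>k0. \<forall>k\<ge>k0. n \<le> length (w k)"
  shows "word_converges w y"
  unfolding word_converges_iff
proof
  fix n
  obtain k0 where k0: "\<forall>k\<ge>k0. n \<le> length (w k)" using assms(2) by blast
  then have "take n (w k) = stake n y" if "k \<ge> k0" for k
    using assms(1)[of k] that by (metis min.absorb1 take_stake)
  with k0 show "\<exists>k0. \<forall>k\<ge>k0. n \<le> length (w k) \<and> take n (w k) = stake n y" by blast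
qed

lemma out_upto_Suc: "out_upto w (Suc n) = out_upto w n @ w n"
  by (simp add: out_upto_def)

lemma out_upto_0 [simp]: "out_upto w 0 = []"
  by (simp add: out_upto_def)

lemma out_upto_add: "out_upto w (k + m) = out_upto w k @ out_upto (\<lambda>i. w (k + i)) m"
  by (induction m) (auto simp: out_upto_Suc)

lemma prefix_out_upto: "k \<le> m \<Longrightarrow> prefix (out_upto w k) (out_upto w m)"
  by (metis le_Suc_ex out_upto_add prefixI)

lemma out_upto_converges:
  assumes "\<And>m. \<exists>n. length (out_upto w n) \<ge> m"
  shows "\<exists>y. (\<forall>n. out_upto w n = stake (length (out_upto w n)) y) \<and> word_converges (out_upto w) y"
proof -
  define N where "N i = (LEAST n. i < length (out_upto w n))" for i
  define y where "y = smap (\<lambda>i. out_upto w (N i) ! i) (fromN 0)"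
  have N: "i < length (out_upto w (N i))" for i
    unfolding N_def using assms[of "Suc i"] by (metis LeastI Suc_le_eq)
  have pre: "out_upto w n = stake (length (out_upto w n)) y" for n
  proof (rule nth_equalityI)
    fix i assume i: "i < length (out_upto w n)"
    have "N i \<le> n" unfolding N_def using i by (rule Least_le)
    then have "out_upto w n ! i = out_upto w (N i) ! i"
      using N[of i] prefix_out_upto by (metis prefixE nth_append)
    then show "out_upto w n ! i = stake (length (out_upto w n)) y ! i"
      using i by (simp add: y_def)
  qed simp
  moreover have "word_converges (out_upto w) y"
  proof (rule word_converges_prefixes[OF pre])
    fix n
    obtain k where "n \<le> length (out_upto w k)" using assms by blast
    then show "\<exists>k0. \<forall>k\<ge>k0. n \<le> length (out_upto w k)"
      by (meson order_trans prefix_length_le prefix_out_upto)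
  qed
  ultimately show ?thesis by blast
qed

section \<open>Runs of register transducers\<close>

text \<open>Accepting runs from any configuration. Visiting final states infinitely often is a
  property of the tail, so these runs can be extended in front and cut; see
  \<open>run_from_append\<close> and \<open>run_from_sdrop\<close>.\<close>

definition run_from ::
  "('q, 'r, 's, 'g) nrt \<Rightarrow> ('q, 'r, 'd) nrt_conf \<Rightarrow> ('s \<times> 'd) stream \<Rightarrow>
   (nat \<Rightarrow> ('q, 'r, 'd) nrt_conf) \<Rightarrow> (nat \<Rightarrow> ('g \<times> 'd) list) \<Rightarrow> bool" where
  "run_from T c x cs ws \<longleftrightarrow> cs 0 = c \<and> (\<forall>i. nrt_step T (cs i) (x !! i) (ws i) (cs (Suc i))) \<and>
     (\<exists>\<^sub>\<infinity>i. fst (cs i) \<in> nrt_final T)"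

lemma accepting_run_iff: "accepting_run T d0 x cs ws \<longleftrightarrow> run_from T (nrt_init T, \<lambda>_. d0) x cs ws"
  by (simp add: accepting_run_def run_from_def)

text \<open>Paths grow at the end, as the algorithm extends its runs letter by letter.\<close>

inductive path ::
  "('q, 'r, 's, 'g) nrt \<Rightarrow> ('q, 'r, 'd) nrt_conf \<Rightarrow> ('s \<times> 'd) list \<Rightarrow> ('g \<times> 'd) list \<Rightarrow>
   ('q, 'r, 'd) nrt_conf \<Rightarrow> bool" for T where
  path_Nil: "path T c [] [] c"
| path_snoc: "path T c u v c1 \<Longrightarrow> nrt_step T c1 a w c2 \<Longrightarrow> path T c (u @ [a]) (v @ w) c2"

lemma run_from_Cons:
  assumes "nrt_step T c a w c'" "run_from T c' z cs ws"
  shows "run_from T c (a ## z) (case_nat c cs) (case_nat w ws)"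
    "out_upto (case_nat w ws) (Suc m) = w @ out_upto ws m"
proof -
  have "\<exists>\<^sub>\<infinity>i. fst (case_nat c cs (Suc i)) \<in> nrt_final T"
    using assms(2) by (simp add: run_from_def)
  then have "\<exists>\<^sub>\<infinity>i. fst (case_nat c cs i) \<in> nrt_final T"
    unfolding INFM_nat by (meson less_SucI)
  then show "run_from T c (a ## z) (case_nat c cs) (case_nat w ws)"
    using assms by (auto simp: run_from_def split: nat.split)
  show "out_upto (case_nat w ws) (Suc m) = w @ out_upto ws m"
    using out_upto_add[of "case_nat w ws" 1 m] by (simp add: out_upto_Suc)
qed

lemma run_from_append:
  assumes "path T c u v c'" "run_from T c' z cs ws"
  shows "\<exists>cs' ws'. run_from T c (u @- z) cs' ws' \<and>
    (\<forall>m. out_upto ws' (length u + m) = v @ out_upto ws m)"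
  using assms
proof (induction arbitrary: z cs ws rule: path.induct)
  case (path_Nil c)
  then show ?case by auto
next
  case (path_snoc c u v c1 a w c2)
  from path_snoc.IH[OF run_from_Cons(1)[OF path_snoc.hyps(2) path_snoc.prems]]
  obtain cs' ws' where "run_from T c (u @- a ## z) cs' ws'"
    "\<And>m. out_upto ws' (length u + m) = v @ out_upto (case_nat w ws) m" by blast
  moreover have "out_upto ws' (length u + Suc m) = v @ w @ out_upto ws m" for m
    using calculation(2)[of "Suc m"] run_from_Cons(2)[OF path_snoc.hyps(2) path_snoc.prems] by simp
  ultimately show ?case by (intro exI[of _ cs'] exI[of _ ws']) auto
qed

lemma run_from_path: "run_from T c x cs ws \<Longrightarrow> path T c (stake k x) (out_upto ws k) (cs k)"
proof (induction k)
  case 0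
  then show ?case by (auto simp: run_from_def intro: path_Nil)
next
  case (Suc k)
  then show ?case unfolding out_upto_Suc stake_Suc
    by (intro path_snoc) (auto simp: run_from_def)
qed

lemma run_from_sdrop:
  assumes "run_from T c x cs ws"
  shows "run_from T (cs k) (sdrop k x) (\<lambda>i. cs (k + i)) (\<lambda>i. ws (k + i))"
proof -
  have "\<exists>\<^sub>\<infinity>i. fst (cs (i + k)) \<in> nrt_final T"
    unfolding INFM_nat
  proof
    fix m
    have "\<exists>i>m + k. fst (cs i) \<in> nrt_final T"
      using assms unfolding run_from_def INFM_nat by blast
    then obtain i where "i > m + k" "fst (cs i) \<in> nrt_final T" by blast
    then show "\<exists>i>m. fst (cs (i + k)) \<in> nrt_final T"
      by (intro exI[of _ "i - k"]) auto
  qed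
  then show ?thesis
    using assms by (simp add: run_from_def sdrop_snth add.commute)
qed

section \<open>Renaming of data values\<close>

lemma sat_test_rename:
  assumes "inj \<pi>" "\<And>r. r \<in> set_reg_test \<phi> \<Longrightarrow> \<tau>' r = \<pi> (\<tau> r)"
  shows "sat_test \<tau>' (\<pi> d) \<phi> \<longleftrightarrow> sat_test \<tau> d \<phi>"
  using assms by (induction \<phi>) (auto dest: injD)

text \<open>Tests only compare values for equality, and outputs copy register contents; so an
  injective renaming of the whole input maps runs to runs.\<close>

lemma run_from_rename:
  assumes wf: "wf_nrt T" and inj: "inj \<pi>" and run: "run_from T c x cs ws"
    and c': "fst c' = fst c" "\<And>r. r \<in> nrt_regs T \<Longrightarrow> snd c' r = \<pi> (snd c r)"
  shows "\<exists>x' cs' ws'. run_from T c' x' cs' ws' \<and> (\<forall>m. out_upto ws' m = map (apsnd \<pi>) (out_upto ws m))"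
proof -
  \<comment> \<open>Outside \<open>nrt_regs T\<close> nothing is ever assigned, so there the values
    of \<open>c'\<close> are kept throughout.\<close>
  define cs' where "cs' i = (fst (cs i), \<lambda>r. if r \<in> nrt_regs T then \<pi> (snd (cs i) r) else snd c' r)" for i
  define ws' where "ws' i = map (apsnd \<pi>) (ws i)" for i
  have "nrt_step T (cs' i) (apsnd \<pi> (x !! i)) (ws' i) (cs' (Suc i))" for i
  proof -
    have "nrt_step T (cs i) (x !! i) (ws i) (cs (Suc i))" using run by (simp add: run_from_def)
    then obtain \<phi> asgn out where t: "(fst (cs i), fst (x !! i), \<phi>, asgn, out, fst (cs (Suc i))) \<in> nrt_delta T"
      and sat: "sat_test (snd (cs i)) (snd (x !! i)) \<phi>"
      and upd: "snd (cs (Suc i)) = reg_update (snd (cs i)) asgn (snd (x !! i))"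
      and w: "ws i = map (\<lambda>(\<gamma>, r). (\<gamma>, snd (cs (Suc i)) r)) out"
      unfolding nrt_step_def by blast
    have sub: "set_reg_test \<phi> \<subseteq> nrt_regs T" "asgn \<subseteq> nrt_regs T" "snd ` set out \<subseteq> nrt_regs T"
      using wf t unfolding wf_nrt_def by fastforce+
    have "snd (cs' i) r = \<pi> (snd (cs i) r)" if "r \<in> set_reg_test \<phi>" for r
      using sub(1) that by (auto simp: cs'_def)
    then have "sat_test (snd (cs' i)) (\<pi> (snd (x !! i))) \<phi>"
      using sat sat_test_rename[OF inj] by blast
    moreover have "snd (cs' (Suc i)) = reg_update (snd (cs' i)) asgn (\<pi> (snd (x !! i)))"
      using upd sub(2) by (intro ext) (auto simp: cs'_def reg_update_def)
    moreover have "ws' i = map (\<lambda>(\<gamma>, r). (\<gamma>, snd (cs' (Suc i)) r)) out"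
      using w sub(3) by (auto simp: ws'_def cs'_def)
    ultimately show ?thesis
      using t unfolding nrt_step_def by (auto simp: cs'_def)
  qed
  moreover have "cs' 0 = c'"
    using run c' by (auto simp: cs'_def run_from_def prod_eq_iff fun_eq_iff)
  ultimately have "run_from T c' (smap (apsnd \<pi>) x) cs' ws'"
    using run by (auto simp: run_from_def cs'_def)
  moreover have "out_upto ws' m = map (apsnd \<pi>) (out_upto ws m)" for m
    by (induction m) (auto simp: out_upto_Suc ws'_def)
  ultimately show ?thesis by blast
qed

text \<open>The image of \<open>A\<close> has as many points outside \<open>A\<close> as
  \<open>A\<close> has outside the image. Sending the former onto the latter and fixing all other
  points completes \<open>g\<close> to a permutation.\<close>

lemma inj_extension:
  fixes g :: "'a \<Rightarrow> 'a"
  assumes "finite A" "inj_on g A"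
  shows "\<exists>\<pi>. inj \<pi> \<and> (\<forall>a\<in>A. \<pi> a = g a)"
proof -
  have "card (g ` A) = card A" using assms by (simp add: card_image)
  moreover have "card (g ` A - A) = card (g ` A) - card (g ` A \<inter> A)"
    by (rule card_Diff_subset_Int) (use assms(1) in simp)
  moreover have "card (A - g ` A) = card A - card (A \<inter> g ` A)"
    by (rule card_Diff_subset_Int) (use assms(1) in simp)
  ultimately have "card (g ` A - A) = card (A - g ` A)"
    by (metis Int_commute)
  then obtain h where h: "bij_betw h (g ` A - A) (A - g ` A)"
    using finite_same_card_bij[of "g ` A - A" "A - g ` A"] assms(1) by auto
  define \<pi> where "\<pi> a = (if a \<in> A then g a else if a \<in> g ` A then h a else a)" for a
  have h': "h a \<in> A" "h a \<notin> g ` A" if "a \<in> g ` A" "a \<notin> A" for a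
    using h that unfolding bij_betw_def by auto
  have "inj \<pi>"
  proof (rule injI)
    fix a b assume eq: "\<pi> a = \<pi> b"
    have h_inj: "a = b" if "h a = h b" "a \<in> g ` A - A" "b \<in> g ` A - A"
      using h that by (meson bij_betw_def inj_onD)
    have g_inj: "a = b" if "g a = g b" "a \<in> A" "b \<in> A"
      using assms(2) that by (meson inj_onD)
    have "g a \<in> g ` A" if "a \<in> A" for a using that by simp
    then show "a = b"
      using eq h_inj g_inj h' unfolding \<pi>_def by (metis DiffI)
  qed
  then show ?thesis by (auto simp: \<pi>_def)
qed

text \<open>The equality pattern of the values, given by Boolean lists: these have a coding and, for
  a fixed length, finitely many values.\<close>

definition eqtype :: "'v list \<Rightarrow> 'v \<Rightarrow> bool list list \<times> bool list" where
  "eqtype vs v = (map (\<lambda>y. map (\<lambda>z. y = z) vs) vs, map (\<lambda>y. y = v) vs)"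

lemma eqtype_map: "inj f \<Longrightarrow> eqtype (map f vs) (f v) = eqtype vs v"
  by (simp add: eqtype_def o_def inj_eq)

text \<open>Equal patterns make the correspondence between the register contents a finite injection,
  which extends to all values.\<close>

lemma eqtype_rename:
  fixes d d' :: 'd
  assumes "eqtype (map \<tau> rs) d = eqtype (map \<tau>' rs) d'"
  shows "\<exists>\<pi>. inj \<pi> \<and> (\<forall>r\<in>set rs. \<tau>' r = \<pi> (\<tau> r)) \<and> \<pi> d = d'"
proof -
  have eq: "\<tau> r = \<tau> r' \<longleftrightarrow> \<tau>' r = \<tau>' r'" "\<tau> r = d \<longleftrightarrow> \<tau>' r = d'"
    if "r \<in> set rs" "r' \<in> set rs" for r r'
    using assms that by (auto simp: eqtype_def)
  define g where "g a = (if a = d then d' else \<tau>' (SOME r. r \<in> set rs \<and> \<tau> r = a))" for a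
  have g: "g (\<tau> r) = \<tau>' r" if "r \<in> set rs" for r
  proof (cases "\<tau> r = d")
    case True
    then show ?thesis using eq(2)[OF that that] by (simp add: g_def)
  next
    case False
    let ?r = "SOME r'. r' \<in> set rs \<and> \<tau> r' = \<tau> r"
    have "?r \<in> set rs \<and> \<tau> ?r = \<tau> r" by (rule someI[of _ r]) (simp add: that)
    then show ?thesis using False eq(1)[of ?r r] that by (simp add: g_def)
  qed
  have gd: "g d = d'" by (simp add: g_def)
  have "inj_on g (insert d (\<tau> ` set rs))"
    unfolding inj_on_def using g gd eq by (auto; metis)
  then obtain \<pi> where "inj \<pi>" "\<forall>a\<in>insert d (\<tau> ` set rs). \<pi> a = g a"
    using inj_extension[of "insert d (\<tau> ` set rs)" g] by auto
  then show ?thesis using g gd by (intro exI[of _ \<pi>]) auto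
qed

lemma finite_range_eqtype: "finite {eqtype vs v |vs v. length vs = n}"
proof -
  let ?L = "\<lambda>S. {l. set l \<subseteq> S \<and> length l = n}"
  have "{eqtype vs v |vs v. length vs = n} \<subseteq> ?L (?L UNIV) \<times> ?L UNIV"
    by (auto simp: eqtype_def)
  moreover have "finite (?L (?L (UNIV :: bool set)) \<times> ?L (UNIV :: bool set))"
    by (intro finite_cartesian_product finite_lists_length_eq) auto
  ultimately show ?thesis by (rule finite_subset)
qed

section \<open>Accepting continuations and their periodic dependence on the position\<close>

definition alive :: "('q, 'r, 's, 'g) nrt \<Rightarrow> ('q, 'r, 'd) nrt_conf \<Rightarrow> bool" where
  "alive T c \<longleftrightarrow> (\<exists>x cs ws. run_from T c x cs ws)"

text \<open>The failure of agreement is chosen because, as an existential statement about runs, it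
  is carried along by renamings and by paths put in front. Position \<open>n\<close> counts from the
  start of the continuation.\<close>

definition may_differ ::
  "('q, 'r, 's, 'g) nrt \<Rightarrow> nat \<Rightarrow> ('q, 'r, 'd) nrt_conf \<Rightarrow> 'g \<times> 'd \<Rightarrow> bool" where
  "may_differ T n c l \<longleftrightarrow> (\<exists>x cs ws m. run_from T c x cs ws \<and>
     n < length (out_upto ws m) \<and> out_upto ws m ! n \<noteq> l)"

lemma alive_rename:
  fixes \<tau> \<tau>' :: "'r \<Rightarrow> 'd"
  assumes "wf_nrt T" "set rs = nrt_regs T" "eqtype (map \<tau> rs) d = eqtype (map \<tau>' rs) d'" "alive T (q, \<tau>)"
  shows "alive T (q, \<tau>')"
proof -
  obtain \<pi> where "inj \<pi>" "\<forall>r\<in>set rs. \<tau>' r = \<pi> (\<tau> r)" using eqtype_rename[OF assms(3)] by blast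
  then show ?thesis
    using run_from_rename[OF assms(1), of \<pi> "(q, \<tau>)" _ _ _ "(q, \<tau>')"] assms(2,4) unfolding alive_def
    by fastforce
qed

lemma may_differ_rename:
  fixes \<tau> \<tau>' :: "'r \<Rightarrow> 'd"
  assumes "wf_nrt T" "set rs = nrt_regs T" "eqtype (map \<tau> rs) d = eqtype (map \<tau>' rs) d'"
    "may_differ T n (q, \<tau>) (\<gamma>, d)"
  shows "may_differ T n (q, \<tau>') (\<gamma>, d')"
proof -
  obtain \<pi> where \<pi>: "inj \<pi>" "\<forall>r\<in>set rs. \<tau>' r = \<pi> (\<tau> r)" "\<pi> d = d'" using eqtype_rename[OF assms(3)] by blast
  obtain x cs ws m where run: "run_from T (q, \<tau>) x cs ws" "n < length (out_upto ws m)"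
    "out_upto ws m ! n \<noteq> (\<gamma>, d)"
    using assms(4) unfolding may_differ_def by blast
  obtain x' cs' ws' where run': "run_from T (q, \<tau>') x' cs' ws'"
    "\<And>m. out_upto ws' m = map (apsnd \<pi>) (out_upto ws m)"
    using run_from_rename[OF assms(1) \<pi>(1) run(1), of "(q, \<tau>')"] \<pi>(2) assms(2) by auto
  have "out_upto ws' m ! n \<noteq> (\<gamma>, d')"
    using run(2,3) \<pi>(1,3) by (cases "out_upto ws m ! n") (auto simp: run'(2) dest: injD)
  then show ?thesis
    using run' run(2) unfolding may_differ_def by (metis length_map)
qed

lemma may_differ_path:
  assumes "path T c u v c'" "may_differ T n c' l"
  shows "may_differ T (length v + n) c l"
proof -
  obtain x cs ws m where run: "run_from T c' x cs ws" "n < length (out_upto ws m)"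
    "out_upto ws m ! n \<noteq> l"
    using assms(2) unfolding may_differ_def by blast
  then obtain cs' ws' where "run_from T c (u @- x) cs' ws'"
    "out_upto ws' (length u + m) = v @ out_upto ws m"
    using run_from_append[OF assms(1)] by blast
  then show ?thesis
    using run(2,3) unfolding may_differ_def
    by (intro exI[of _ "u @- x"] exI[of _ cs'] exI[of _ ws'] exI[of _ "length u + m"]) (auto simp: nth_append)
qed

lemma run_from_state:
  assumes "wf_nrt T" "run_from T c x cs ws"
  shows "fst c \<in> nrt_states T"
proof -
  have "cs 0 = c" "nrt_step T (cs 0) (x !! 0) (ws 0) (cs (Suc 0))"
    using assms(2) unfolding run_from_def by blast+
  then obtain \<sigma> \<phi> asgn out q' where "(fst c, \<sigma>, \<phi>, asgn, out, q') \<in> nrt_delta T"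
    unfolding nrt_step_def by blast
  then show ?thesis using assms(1) unfolding wf_nrt_def by blast
qed

text \<open>Later positions are determined by the \<open>K\<close> preceding ones, where \<open>K\<close> bounds the
  output of a transition: look at the first nonempty output.\<close>

lemma may_differ_shift:
  fixes T :: "('q, 'r, 's, 'g) nrt" and c :: "('q, 'r, 'd) nrt_conf"
  assumes K: "\<And>(c :: ('q, 'r, 'd) nrt_conf) a w c'. nrt_step T c a w c' \<Longrightarrow> length w \<le> K"
    and eq: "\<And>j. j < K \<Longrightarrow> (may_differ T (m + j) :: ('q, 'r, 'd) nrt_conf \<Rightarrow> _) = may_differ T (n + j)"
    and differ: "may_differ T (m + K) c l"
  shows "may_differ T (n + K) c l"
proof -
  obtain x cs ws M where run: "run_from T c x cs ws" "m + K < length (out_upto ws M)"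
    "out_upto ws M ! (m + K) \<noteq> l"
    using differ unfolding may_differ_def by blast
  define k where "k = (LEAST k. out_upto ws k \<noteq> [])"
  have M: "out_upto ws M \<noteq> []" using run(2) by auto
  then have k: "out_upto ws k \<noteq> []" "k \<le> M"
    unfolding k_def by (rule LeastI, rule Least_le)
  then obtain k' where k': "k = Suc k'" by (cases k) auto
  then have "out_upto ws k' = []" unfolding k_def by (metis k' k_def lessI not_less_Least)
  then have out_k: "out_upto ws k = ws k'" by (simp add: k' out_upto_Suc)
  let ?L = "length (ws k')"
  have "0 < ?L" using out_k k(1) by simp
  moreover have "nrt_step T (cs k') (x !! k') (ws k') (cs (Suc k'))" using run(1) by (simp add: run_from_def)
  ultimately have L: "0 < ?L" "?L \<le> K" using K by blast+
  obtain M' where M': "M = k + M'" using k(2) le_Suc_ex by blast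
  let ?ws = "\<lambda>i. ws (k + i)"
  have out_M: "out_upto ws M = ws k' @ out_upto ?ws M'"
    by (simp add: M' out_upto_add out_k)
  \<comment> \<open>The first nonempty output lowers the position by at least one, so
    \<open>eq\<close> applies, and by at most \<open>K\<close>, so the position does not fall below
    \<open>m\<close>.\<close>
  have lt: "K - ?L < K" using L by linarith
  have "may_differ T (m + (K - ?L)) (cs k) l"
    unfolding may_differ_def
    using run_from_sdrop[OF run(1), of k] run(2,3) L
    by (intro exI[of _ "sdrop k x"] exI[of _ "\<lambda>i. cs (k + i)"] exI[of _ ?ws] exI[of _ M'])
      (auto simp: out_M nth_append)
  then have "may_differ T (n + (K - ?L)) (cs k) l"
    using eq[OF lt] by (simp only:)
  from may_differ_path[OF run_from_path[OF run(1)] this] show ?thesis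
    using L by (simp add: out_k add.commute)
qed

text \<open>By \<open>may_differ_rename\<close>, each predicate is determined by a subset of a
  finite set that does not depend on \<open>n\<close>: the triples of a state, an output label and
  an equality pattern.\<close>

lemma finite_range_may_differ:
  fixes T :: "('q, 'r, 's, 'g::finite) nrt"
  assumes wf: "wf_nrt T"
  shows "finite (range (may_differ T :: nat \<Rightarrow> ('q, 'r, 'd) nrt_conf \<Rightarrow> _))"
proof -
  obtain rs where rs: "set rs = nrt_regs T"
    using finite_list[of "nrt_regs T"] wf by (auto simp: wf_nrt_def)
  let ?U = "nrt_states T \<times> (UNIV :: 'g set) \<times> {eqtype vs v |vs v :: 'd. length vs = length rs}"
  let ?t = "\<lambda>c l. (fst c, fst l, eqtype (map (snd c) rs) (snd l))"
  let ?B = "\<lambda>n. {?t c l |c l. may_differ T n (c :: ('q, 'r, 'd) nrt_conf) l}"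
  have sub: "?B n \<subseteq> ?U" for n
  proof
    fix t assume "t \<in> ?B n"
    then obtain c l where t: "t = ?t c l" and "may_differ T n (c :: ('q, 'r, 'd) nrt_conf) l" by blast
    then have "fst c \<in> nrt_states T" unfolding may_differ_def using run_from_state[OF wf] by blast
    moreover have "eqtype (map (snd c) rs) (snd l) \<in> {eqtype vs v |vs v :: 'd. length vs = length rs}"
      using length_map by blast
    ultimately show "t \<in> ?U" unfolding t by simp
  qed
  have eq: "(may_differ T n :: ('q, 'r, 'd) nrt_conf \<Rightarrow> _) = (\<lambda>c l. ?t c l \<in> ?B n)" for n
  proof (rule ext, rule ext)
    fix c :: "('q, 'r, 'd) nrt_conf" and l
    have "may_differ T n c l" if *: "?t c l = ?t c' l'" "may_differ T n c' l'"
      for c' :: "('q, 'r, 'd) nrt_conf" and l'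
      using may_differ_rename[OF wf rs, of "snd c'" "snd l'" "snd c" "snd l" n "fst c'" "fst l'"] *
      by (metis prod.collapse prod.inject)
    then show "may_differ T n c l = (?t c l \<in> ?B n)" by blast
  qed
  have "range (may_differ T :: nat \<Rightarrow> ('q, 'r, 'd) nrt_conf \<Rightarrow> _) \<subseteq> (\<lambda>B (c :: ('q, 'r, 'd) nrt_conf) l. ?t c l \<in> B) ` Pow ?U"
  proof (rule image_subsetI)
    fix n
    show "(may_differ T n :: ('q, 'r, 'd) nrt_conf \<Rightarrow> _)
        \<in> (\<lambda>B (c :: ('q, 'r, 'd) nrt_conf) l. ?t c l \<in> B) ` Pow ?U"
      by (rule image_eqI[where x = "?B n"], rule eq, rule PowI, rule sub)
  qed
  moreover have "finite (nrt_states T)" using wf by (simp add: wf_nrt_def)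
  then have "finite ?U" by (intro finite_cartesian_product finite_range_eqtype) simp_all
  ultimately show ?thesis by (meson finite_Pow_iff finite_imageI finite_subset)
qed

lemma may_differ_classes:
  fixes T :: "('q, 'r, 's, 'g::finite) nrt"
  assumes wf: "wf_nrt T"
  shows "\<exists>c :: nat \<Rightarrow> nat. computable c \<and> finite (range c) \<and>
    (\<forall>m n. c m = c n \<longrightarrow> (may_differ T m :: ('q, 'r, 'd) nrt_conf \<Rightarrow> _) = may_differ T n)"
proof -
  let ?B = "may_differ T :: nat \<Rightarrow> ('q, 'r, 'd) nrt_conf \<Rightarrow> _"
  have "finite ((\<lambda>(q, \<sigma>, \<phi>, asgn, out, q'). length out) ` nrt_delta T)" using wf by (simp add: wf_nrt_def)
  then obtain K0 where K0: "\<forall>k\<in>(\<lambda>(q, \<sigma>, \<phi>, asgn, out, q'). length out) ` nrt_delta T. k \<le> K0"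
    using finite_nat_set_iff_bounded_le by blast
  \<comment> \<open>The successor keeps the windows below nonempty, so that equal windows have equal
    first entries.\<close>
  define K where "K = Suc K0"
  have K: "length w \<le> K" if "nrt_step T c a w c'" for c c' :: "('q, 'r, 'd) nrt_conf" and a w
    using that K0 unfolding nrt_step_def K_def by fastforce
  \<comment> \<open>A window of \<open>K\<close> consecutive predicates determines the next
    predicate, hence the next window; so \<open>computable_finite_sequence\<close> applies to
    windows.\<close>
  define s where "s n = map (\<lambda>j. ?B (n + j)) [0..<K]" for n
  have "finite {l. set l \<subseteq> range ?B \<and> length l = K}"
    by (intro finite_lists_length_eq finite_range_may_differ wf)
  moreover have "range s \<subseteq> {l. set l \<subseteq> range ?B \<and> length l = K}"
    by (auto simp: s_def)
  ultimately have fin: "finite (range s)" by (rule finite_subset[rotated])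
  have det: "s (Suc m) = s (Suc n)" if "s m = s n" for m n
  proof -
    have eq: "?B (m + j) = ?B (n + j)" if "j < K" for j
      using \<open>s m = s n\<close> that unfolding s_def by (auto simp: map_eq_conv)
    have "?B (m + K) = ?B (n + K)"
    proof (intro ext iffI)
      fix c l
      show "?B (n + K) c l" if "?B (m + K) c l" by (rule may_differ_shift[OF K eq that])
      show "?B (m + K) c l" if "?B (n + K) c l" by (rule may_differ_shift[OF K eq[symmetric] that])
    qed
    then have "?B (m + j) = ?B (n + j)" if "j \<le> K" for j
      using eq that by (cases "j = K") auto
    then show ?thesis unfolding s_def by (auto simp flip: add_Suc_right)
  qed
  obtain c :: "nat \<Rightarrow> nat" where c: "computable c" "finite (range c)" "\<forall>m n. c m = c n \<longleftrightarrow> s m = s n"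
    using computable_finite_sequence[of s, OF fin det] by blast
  have "?B m = ?B n" if "c m = c n" for m n
  proof -
    have "s m ! 0 = s n ! 0" using that c(3) by simp
    then show ?thesis by (simp add: s_def K_def del: upt_Suc)
  qed
  then show ?thesis using c by blast
qed


section \<open>Coding of data words\<close>

lemma enc_word_Nil [simp]: "enc_word rep [] = []"
  by (simp add: enc_word_def)

lemma enc_word_Cons [simp]: "enc_word rep (a # u) = enc_letter rep a @ enc_word rep u"
  by (simp add: enc_word_def)

lemma enc_word_append: "enc_word rep (u @ v) = enc_word rep u @ enc_word rep v"
  by (simp add: enc_word_def)

lemma length_le_enc_word: "length u \<le> length (enc_word rep u)"
  by (induction u) (auto simp: enc_letter_def)

lemma enc_stream_Stream: "enc_stream rep (a ## x) = enc_letter rep a @- enc_stream rep x"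
  by (simp add: enc_stream_def enc_letter_def)

lemma enc_stream_shift: "enc_stream rep (u @- x) = enc_word rep u @- enc_stream rep x"
  by (induction u) (simp_all add: enc_stream_Stream)

lemma enc_stream_split: "enc_stream rep x = enc_word rep (stake k x) @- enc_stream rep (sdrop k x)"
  by (simp add: stake_sdrop flip: enc_stream_shift)

lemma stake_enc_stream:
  "stake (length (enc_word rep (stake k x))) (enc_stream rep x) = enc_word rep (stake k x)"
  by (subst enc_stream_split[of rep x k]) (simp add: stake_shift)

text \<open>The end marker makes the codes of letters prefix-free, so that an encoded stream can be
  decoded from the left.\<close>

lemma bits_unique:
  "map Bit u @- End_Marker ## s = map Bit v @- End_Marker ## t \<Longrightarrow> u = v \<and> s = t"
proof (induction u arbitrary: v)
  case Nil
  then show ?case by (cases v) auto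
next
  case (Cons b u)
  then show ?case by (cases v) auto
qed

lemma enc_letter_unique:
  assumes "inj rep" "enc_letter rep a @- s = enc_letter rep b @- t"
  shows "a = b \<and> s = t"
  using assms(2) bits_unique[of "rep (snd a)" s "rep (snd b)" t]
  by (auto simp: enc_letter_def prod_eq_iff dest: injD[OF assms(1)])

lemma enc_word_unique:
  assumes "inj rep" "enc_word rep u @- s = enc_stream rep y"
  shows "stake (length u) y = u"
  using assms(2)
proof (induction u arbitrary: y)
  case (Cons a u)
  obtain b z where y: "y = b ## z" by (metis stream.collapse)
  have "enc_letter rep a @- (enc_word rep u @- s) = enc_letter rep b @- enc_stream rep z"
    using Cons.prems by (simp add: y enc_stream_Stream)
  from enc_letter_unique[OF assms(1) this] Cons.IH show ?case by (simp add: y)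
qed simp


section \<open>Computable functions are continuous\<close>

lemma tm_run_mono:
  "n \<le> m \<Longrightarrow> c_inpos (tm_run M inp n) \<le> c_inpos (tm_run M inp m) \<and>
    prefix (c_out (tm_run M inp n)) (c_out (tm_run M inp m))"
proof (induction m rule: dec_induct)
  case (step m)
  have "c_inpos (tm_run M inp m) \<le> c_inpos (tm_run M inp (Suc m)) \<and>
    prefix (c_out (tm_run M inp m)) (c_out (tm_run M inp (Suc m)))"
    by (auto simp: tm_step_def split: option.splits)
  with step.IH show ?case by (meson order_trans prefix_order.order_trans)
qed simp

text \<open>A step sees the input only under the head. The bound concerns the steps before
  \<open>n\<close>; at step \<open>n\<close> the head may already have passed
  \<open>L\<close>.\<close>

lemma tm_run_cong:
  assumes "stake L inp = stake L inp'" "\<And>m. m < n \<Longrightarrow> c_inpos (tm_run M inp m) < L"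
  shows "tm_run M inp n = tm_run M inp' n"
  using assms(2)
proof (induction n)
  case (Suc n)
  then have eq: "tm_run M inp n = tm_run M inp' n" by simp
  have "c_inpos (tm_run M inp' n) < L" using Suc.prems[of n] eq by simp
  then have "inp !! c_inpos (tm_run M inp' n) = inp' !! c_inpos (tm_run M inp' n)"
    using assms(1) by (metis stake_nth)
  then have "tm_step M inp (tm_run M inp' n) = tm_step M inp' (tm_run M inp' n)"
    by (simp add: tm_step_def)
  then show ?case by (simp only: tm_run.simps eq)
qed simp

lemma tm_output_cong:
  assumes "stake k x = stake k y" "\<exists>n. tm_has_read rep M x k n"
  shows "tm_output rep M x k = tm_output rep M y k"
proof -
  let ?n = "LEAST n. tm_has_read rep M x k n"
  let ?L = "length (enc_word rep (stake k x))"
  have read: "tm_has_read rep M x k ?n" using assms(2) by (rule LeastI_ex)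
  have "stake ?L (enc_stream rep x) = stake ?L (enc_stream rep y)"
    using stake_enc_stream[of rep k x] stake_enc_stream[of rep k y] assms(1) by simp
  moreover have before: "c_inpos (tm_run M (enc_stream rep x) m) < ?L" if "m < ?n" for m
    using not_less_Least[OF that] by (simp add: tm_has_read_def)
  ultimately have eq: "tm_run M (enc_stream rep x) m = tm_run M (enc_stream rep y) m" if "m \<le> ?n" for m
    using that by (intro tm_run_cong[of ?L]) auto
  have "(LEAST n. tm_has_read rep M y k n) = ?n"
  proof (rule Least_equality)
    show "tm_has_read rep M y k ?n"
      using read eq[of ?n] assms(1) by (simp add: tm_has_read_def)
    fix m assume "tm_has_read rep M y k m"
    then show "?n \<le> m"
      using before[of m] eq[of m] assms(1) by (force simp: tm_has_read_def)
  qed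
  then show ?thesis using eq[of ?n] by (simp add: tm_output_def)
qed

lemma prefix_tm_output:
  assumes "k \<le> k'" "\<exists>n. tm_has_read rep M x k' n"
  shows "prefix (tm_output rep M x k) (tm_output rep M x k')"
proof -
  have "tm_has_read rep M x k' (LEAST n. tm_has_read rep M x k' n)" using assms(2) by (rule LeastI_ex)
  moreover have "length (enc_word rep (stake k x)) \<le> length (enc_word rep (stake k' x))"
  proof -
    obtain j where "k' = k + j" using assms(1) le_Suc_ex by blast
    then have "stake k' x = stake k x @ stake j (sdrop k x)" by (simp only: stake_add)
    then show ?thesis by (simp only: enc_word_append length_append le_add1)
  qed
  ultimately have "tm_has_read rep M x k (LEAST n. tm_has_read rep M x k' n)"
    by (simp add: tm_has_read_def)
  then have "(LEAST n. tm_has_read rep M x k n) \<le> (LEAST n. tm_has_read rep M x k' n)"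
    by (rule Least_le)
  then show ?thesis unfolding tm_output_def using tm_run_mono by blast
qed

theorem word_computable_imp_continuous:
  assumes inj: "inj rep" and "word_computable rep f"
  shows "word_continuous f"
proof -
  obtain M where read: "\<And>x k. x \<in> dom f \<Longrightarrow> \<exists>n. tm_has_read rep M x k n"
    and conv: "\<And>x. x \<in> dom f \<Longrightarrow> word_converges (tm_output rep M x) (enc_stream rep (the (f x)))"
    using assms(2) unfolding word_computable_def by blast
  have "\<exists>j. \<forall>y\<in>dom f. stake j x = stake j y \<longrightarrow> stake i (the (f x)) = stake i (the (f y))"
    if x: "x \<in> dom f" for x i
  proof -
    let ?e = "enc_word rep (stake i (the (f x)))"
    obtain k where k: "length ?e \<le> length (tm_output rep M x k)" "take (length ?e) (tm_output rep M x k) = ?e"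
      using conv[OF x] unfolding word_converges_iff by (metis order_refl stake_enc_stream)
    have "stake i (the (f x)) = stake i (the (f y))" if y: "y \<in> dom f" "stake k x = stake k y" for y
    proof -
      \<comment> \<open>On \<open>y\<close> the output may become correct only after
        \<open>k0\<close> letters. As the output tape is only appended to, what it holds after
        \<open>k\<close> letters is still there.\<close>
      obtain k0 where k0: "\<forall>k'\<ge>k0. take (length ?e) (tm_output rep M y k') = stake (length ?e) (enc_stream rep (the (f y)))"
        using conv[OF y(1)] unfolding word_converges_iff by meson
      have "prefix (tm_output rep M x k) (tm_output rep M y (max k k0))"
        using tm_output_cong[OF y(2) read[OF x]] prefix_tm_output[OF _ read[OF y(1)], of k "max k k0"] by simp
      then have "take (length ?e) (tm_output rep M y (max k k0)) = ?e"
        using k by (metis prefixE take_append diff_is_0_eq' take0 append_Nil2)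
      then have "stake (length ?e) (enc_stream rep (the (f y))) = ?e"
        using k0 by (metis max.cobounded2)
      then have "?e @- sdrop (length ?e) (enc_stream rep (the (f y))) = enc_stream rep (the (f y))"
        by (metis stake_sdrop)
      from enc_word_unique[OF inj this] show ?thesis by simp
    qed
    then show ?thesis by blast
  qed
  then show ?thesis
    unfolding word_continuous_def word_continuous_at_def le_lcp_len_iff by blast
qed


section \<open>Functions defined by register transducers\<close>

text \<open>The output of an accepting run is infinite, so it has a limit, which is
  \<open>f x\<close> because \<open>nrt_rel\<close> is the graph of \<open>f\<close>. Hence each
  single run on \<open>x\<close> writes a prefix of \<open>f x\<close> at every moment.\<close>

lemma defined_run:
  assumes "infinite_outputs T d0" "nrt_defines T d0 f" "run_from T (nrt_init T, \<lambda>_. d0) x cs ws"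
  shows "\<exists>y. f x = Some y \<and> (\<forall>m i. i < length (out_upto ws m) \<longrightarrow> out_upto ws m ! i = y !! i)"
proof -
  have acc: "accepting_run T d0 x cs ws" using assms(3) by (simp add: accepting_run_iff)
  then have "\<exists>n. length (out_upto ws n) \<ge> m" for m
    using assms(1) unfolding infinite_outputs_def by blast
  then obtain y where y: "\<And>n. out_upto ws n = stake (length (out_upto ws n)) y" "word_converges (out_upto ws) y"
    using out_upto_converges by blast
  then have "(x, y) \<in> nrt_rel T d0" using acc unfolding nrt_rel_def by blast
  then have "f x = Some y" using assms(2) unfolding nrt_defines_def by auto
  moreover have "out_upto ws m ! i = y !! i" if "i < length (out_upto ws m)" for m i
    using y(1)[of m] stake_nth[OF that, of y] by simp
  ultimately show ?thesis by blast
qed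

lemma run_of_defined:
  assumes "nrt_defines T d0 f" "x \<in> dom f"
  shows "\<exists>cs ws. run_from T (nrt_init T, \<lambda>_. d0) x cs ws"
proof -
  obtain y where "f x = Some y" using assms(2) by auto
  then have "(x, y) \<in> nrt_rel T d0" using assms(1) unfolding nrt_defines_def by auto
  then show ?thesis unfolding nrt_rel_def accepting_run_iff by blast
qed


section \<open>The algorithm\<close>

type_synonym run_code = "nat \<times> bool list list \<times> (nat \<times> bool list) list"

text \<open>Label and bits of the letter being read, the runs so far, the number of output letters
  found, and the queue of symbols to be written. A run consists of its state, its registers in the
  order of \<open>rs\<close>, and its complete output.\<close>

type_synonym algorithm_state = "nat \<times> bool list \<times> run_code list \<times> nat \<times> nat list"

fun sym_code :: "'g::finite tape_sym \<Rightarrow> nat" where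
  "sym_code (Bit b) = of_bool b"
| "sym_code End_Marker = 2"
| "sym_code (Label \<gamma>) = to_nat \<gamma> + 3"

lemma inj_sym_code: "inj sym_code"
proof (rule injI)
  fix y z :: "'g::finite tape_sym"
  show "sym_code y = sym_code z \<Longrightarrow> y = z"
    by (cases y; cases z) (auto simp: of_bool_def split: if_splits)
qed

lemma finite_tape_sym: "finite (UNIV :: 'g::finite tape_sym set)"
proof -
  have "(UNIV :: 'g tape_sym set) = range Label \<union> range Bit \<union> {End_Marker}"
    by (auto, metis tape_sym.exhaust rangeI)
  then show ?thesis by (metis finite.emptyI finite.insertI finite_Un finite_imageI finite_code)
qed

abbreviation queue :: "algorithm_state \<Rightarrow> nat list" where
  "queue X \<equiv> snd (snd (snd (snd X)))"

abbreviation runs :: "algorithm_state \<Rightarrow> run_code list" where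
  "runs X \<equiv> fst (snd (snd X))"

abbreviation index :: "algorithm_state \<Rightarrow> nat" where
  "index X \<equiv> fst (snd (snd (snd X)))"

text \<open>Emission is a function of the state, so the emitted head stays in the queue until the
  next call of \<open>process\<close> removes it.\<close>

definition queue_head :: "algorithm_state \<Rightarrow> 'g::finite tape_sym option" where
  "queue_head X = (if queue X \<noteq> [] \<and> hd (queue X) \<in> range (sym_code :: 'g tape_sym \<Rightarrow> _)
     then Some (inv sym_code (hd (queue X))) else None)"

lemma queue_head_Some: "queue_head X = Some y \<longleftrightarrow> queue X \<noteq> [] \<and> hd (queue X) = sym_code y"
  by (auto simp: queue_head_def inv_f_f[OF inj_sym_code] dest: injD[OF inj_sym_code])

lemma queue_head_map:
  "queue X = map sym_code ys \<Longrightarrow> queue_head X = (case ys of [] \<Rightarrow> None | y # _ \<Rightarrow> Some y)"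
  by (auto simp: queue_head_Some split: list.split) (simp add: queue_head_def)

definition letter_code :: "nat \<times> bool list \<Rightarrow> nat list" where
  "letter_code l = (fst l + 3) # map (\<lambda>b. of_bool b) (snd l) @ [2]"

primrec sat_code :: "('r \<Rightarrow> nat) \<Rightarrow> 'r reg_test \<Rightarrow> bool list list \<Rightarrow> bool list \<Rightarrow> bool" where
  "sat_code ix TTop regs b \<longleftrightarrow> True"
| "sat_code ix TBot regs b \<longleftrightarrow> False"
| "sat_code ix (TEq r) regs b \<longleftrightarrow> hd (drop (ix r) regs) = b"
| "sat_code ix (TNeq r) regs b \<longleftrightarrow> hd (drop (ix r) regs) \<noteq> b"
| "sat_code ix (TNot \<phi>) regs b \<longleftrightarrow> \<not> sat_code ix \<phi> regs b"
| "sat_code ix (TAnd \<phi> \<psi>) regs b \<longleftrightarrow> sat_code ix \<phi> regs b \<and> sat_code ix \<psi> regs b"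
| "sat_code ix (TOr \<phi> \<psi>) regs b \<longleftrightarrow> sat_code ix \<phi> regs b \<or> sat_code ix \<psi> regs b"

lemma computable_sat_code [computable_intros]:
  assumes "computable a" "computable b"
  shows "computable (\<lambda>x. sat_code ix \<phi> (a x) (b x))"
  by (induction \<phi>) (simp_all, (intro computable_intros assms; assumption)+)

lemma computable_eqtype [computable_intros]:
  assumes "computable a" "computable b"
  shows "computable (\<lambda>x. eqtype (a x) (b x))"
proof -
  have "computable (\<lambda>p. eqtype (fst p) (snd p))"
    unfolding eqtype_def by (intro computable_intros)
  from computable_comp[OF this computable_Pair[OF assms]] show ?thesis by simp
qed

locale transducer =
  fixes T :: "('q, 'r, 's::finite, 'g::finite) nrt" and d0 :: 'd and rep :: "'d \<Rightarrow> bool list"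
    and f :: "('s \<times> 'd) stream \<rightharpoonup> ('g \<times> 'd) stream"
    and rs :: "'r list" and ts :: "('q, 'r, 's, 'g) nrt_trans list"
  assumes inj_rep: "inj rep" and wf: "wf_nrt T"
    and inf_out: "infinite_outputs T d0" and defines_f: "nrt_defines T d0 f"
    and set_rs: "set rs = nrt_regs T" and set_ts: "set ts = nrt_delta T"
begin

section \<open>Codes of configurations and of transitions\<close>

definition state_code :: "'q \<Rightarrow> nat" where
  "state_code = to_nat_on (nrt_states T)"

lemma finite_states: "finite (nrt_states T)"
  using wf by (simp add: wf_nrt_def)

lemma state_code_eq: "p \<in> nrt_states T \<Longrightarrow> q \<in> nrt_states T \<Longrightarrow> state_code p = state_code q \<longleftrightarrow> p = q"
  using finite_states by (simp add: state_code_def countable_finite)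

definition ix :: "'r \<Rightarrow> nat" where
  "ix r = (SOME k. k < length rs \<and> rs ! k = r)"

lemma hd_drop_ix:
  assumes "r \<in> nrt_regs T"
  shows "hd (drop (ix r) (map g rs)) = g r"
proof -
  have "\<exists>k. k < length rs \<and> rs ! k = r" using assms set_rs by (metis in_set_conv_nth)
  then have "ix r < length rs \<and> rs ! ix r = r" unfolding ix_def by (rule someI_ex)
  then show ?thesis by (simp add: hd_drop_conv_nth)
qed

lemma sat_code_rep:
  "set_reg_test \<phi> \<subseteq> nrt_regs T \<Longrightarrow>
    sat_code ix \<phi> (map (\<lambda>r. rep (\<tau> r)) rs) (rep d) \<longleftrightarrow> sat_test \<tau> d \<phi>"
  by (induction \<phi>) (auto simp: hd_drop_ix inj_eq[OF inj_rep])

definition letter :: "'a::finite \<times> 'd \<Rightarrow> nat \<times> bool list" where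
  "letter l = (to_nat (fst l), rep (snd l))"

lemma letter_eq: "letter l = letter l' \<longleftrightarrow> l = l'"
  by (auto simp: letter_def prod_eq_iff inj_eq[OF inj_rep])

lemma letter_code_letter: "letter_code (letter l) = map sym_code (enc_letter rep l)"
  by (simp add: letter_code_def letter_def enc_letter_def)

definition regs_code :: "('r \<Rightarrow> 'd) \<Rightarrow> bool list list" where
  "regs_code \<tau> = map (\<lambda>r. rep (\<tau> r)) rs"

definition run_code :: "('q, 'r, 'd) nrt_conf \<times> ('g \<times> 'd) list \<Rightarrow> run_code" where
  "run_code e = (state_code (fst (fst e)), regs_code (snd (fst e)), map letter (snd e))"

lemma eqtype_regs_code: "eqtype (regs_code \<tau>) (rep d) = eqtype (map \<tau> rs) d"
  using eqtype_map[OF inj_rep, of "map \<tau> rs" d] by (simp add: regs_code_def o_def)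

definition update_code :: "'r set \<Rightarrow> bool list list \<Rightarrow> bool list \<Rightarrow> bool list list" where
  "update_code asgn regs b = map (\<lambda>r. if r \<in> asgn then b else hd (drop (ix r) regs)) rs"

lemma update_code_rep: "update_code asgn (regs_code \<tau>) (rep d) = regs_code (reg_update \<tau> asgn d)"
  by (simp add: update_code_def regs_code_def reg_update_def hd_drop_ix flip: set_rs)

definition trans_code :: "('q, 'r, 's, 'g) nrt_trans \<Rightarrow> run_code \<Rightarrow> nat \<times> bool list \<Rightarrow> run_code list" where
  "trans_code t s l = (case t of (q, \<sigma>, \<phi>, asgn, out, q') \<Rightarrow>
     if fst s = state_code q \<and> fst l = to_nat \<sigma> \<and> sat_code ix \<phi> (fst (snd s)) (snd l)
     then [(state_code q', update_code asgn (fst (snd s)) (snd l), snd (snd s) @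
       map (\<lambda>o'. (to_nat (fst o'), hd (drop (ix (snd o')) (update_code asgn (fst (snd s)) (snd l))))) out)]
     else [])"

definition step_code :: "nat \<times> bool list \<Rightarrow> run_code list \<Rightarrow> run_code list" where
  "step_code l R = concat (map (\<lambda>s. concat (map (\<lambda>t. trans_code t s l) ts)) R)"

lemma computable_update_code:
  assumes "computable a" "computable b"
  shows "computable (\<lambda>x. update_code asgn (a x) (b x))"
  unfolding update_code_def by (intro computable_const_map) (intro computable_intros assms)

lemma computable_trans_code:
  assumes "computable s" "computable l"
  shows "computable (\<lambda>x. trans_code t (s x) (l x))"
proof (cases t)
  case (fields q \<sigma> \<phi> asgn out q')
  show ?thesis
    unfolding fields trans_code_def prod.case
    by (intro computable_intros computable_const_map computable_update_code assms)
qed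

lemma computable_step_code: "computable (\<lambda>p. step_code (fst p) (snd p))"
  unfolding step_code_def
  by (intro computable_intros computable_const_concat_map computable_trans_code)

lemma trans_code_iff:
  assumes t: "t = (q, \<sigma>, \<phi>, asgn, out, q')" "t \<in> nrt_delta T" and c: "fst c \<in> nrt_states T"
  shows "s \<in> set (trans_code t (run_code (c, v)) (letter a)) \<longleftrightarrow>
    fst c = q \<and> fst a = \<sigma> \<and> sat_test (snd c) (snd a) \<phi> \<and>
    s = run_code ((q', reg_update (snd c) asgn (snd a)),
      v @ map (\<lambda>(\<gamma>, r). (\<gamma>, reg_update (snd c) asgn (snd a) r)) out)"
proof -
  have sub: "q \<in> nrt_states T" "set_reg_test \<phi> \<subseteq> nrt_regs T" "snd ` set out \<subseteq> nrt_regs T"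
    using wf t unfolding wf_nrt_def by fastforce+
  let ?\<tau> = "reg_update (snd c) asgn (snd a)"
  have "map (\<lambda>o'. (to_nat (fst o'), hd (drop (ix (snd o')) (regs_code ?\<tau>)))) out
      = map letter (map (\<lambda>(\<gamma>, r). (\<gamma>, ?\<tau> r)) out)"
    using sub(3) by (auto simp: letter_def regs_code_def hd_drop_ix)
  then show ?thesis
    using state_code_eq[OF c sub(1)] sat_code_rep[OF sub(2), of "snd c" "snd a"]
    by (auto simp: trans_code_def t(1) run_code_def letter_def update_code_rep simp flip: regs_code_def)
qed

abbreviation init :: "('q, 'r, 'd) nrt_conf" where
  "init \<equiv> (nrt_init T, \<lambda>_. d0)"

lemma path_state: "path T c u v c' \<Longrightarrow> fst c \<in> nrt_states T \<Longrightarrow> fst c' \<in> nrt_states T"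
proof (induction rule: path.induct)
  case (path_snoc c u v c1 a w c2)
  then show ?case using wf unfolding nrt_step_def wf_nrt_def by fastforce
qed

lemma path_init_state: "path T init u v c \<Longrightarrow> fst c \<in> nrt_states T"
  using path_state[of init u v c] wf by (simp add: wf_nrt_def)

text \<open>Only the set of codes matters; different paths may put the same code into the
  list.\<close>

lemma set_step_code:
  assumes "set R = run_code ` {(c, v). path T init u v c}"
  shows "set (step_code (letter a) R) = run_code ` {(c, v). path T init (u @ [a]) v c}"
proof (intro set_eqI iffI)
  fix s assume "s \<in> set (step_code (letter a) R)"
  then obtain c v t where c: "path T init u v c" and t: "t \<in> nrt_delta T"
    and s: "s \<in> set (trans_code t (run_code (c, v)) (letter a))"
    using assms set_ts by (auto simp: step_code_def)
  obtain q \<sigma> \<phi> asgn out q' where t': "t = (q, \<sigma>, \<phi>, asgn, out, q')" by (cases t)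
  let ?\<tau> = "reg_update (snd c) asgn (snd a)"
  have *: "fst c = q" "fst a = \<sigma>" "sat_test (snd c) (snd a) \<phi>"
    "s = run_code ((q', ?\<tau>), v @ map (\<lambda>(\<gamma>, r). (\<gamma>, ?\<tau> r)) out)"
    using s trans_code_iff[OF t' t path_init_state[OF c]] by blast+
  have "nrt_step T c a (map (\<lambda>(\<gamma>, r). (\<gamma>, ?\<tau> r)) out) (q', ?\<tau>)"
    unfolding nrt_step_def using * t t' by auto
  with path_snoc[OF c] *(4) show "s \<in> run_code ` {(c, v). path T init (u @ [a]) v c}" by blast
next
  fix s assume "s \<in> run_code ` {(c, v). path T init (u @ [a]) v c}"
  then obtain c' v' where s: "s = run_code (c', v')" and "path T init (u @ [a]) v' c'" by blast
  then obtain c v w where c: "path T init u v c" "nrt_step T c a w c'" "v' = v @ w"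
    by (auto elim: path.cases)
  then obtain \<phi> asgn out where t: "(fst c, fst a, \<phi>, asgn, out, fst c') \<in> nrt_delta T"
    "sat_test (snd c) (snd a) \<phi>" "snd c' = reg_update (snd c) asgn (snd a)"
    "w = map (\<lambda>(\<gamma>, r). (\<gamma>, snd c' r)) out"
    unfolding nrt_step_def by blast
  have "s \<in> set (trans_code (fst c, fst a, \<phi>, asgn, out, fst c') (run_code (c, v)) (letter a))"
    unfolding trans_code_iff[OF refl t(1) path_init_state[OF c(1)]]
    using t s c(3) by (simp flip: t(3))
  moreover have "run_code (c, v) \<in> set R" using assms c(1) by blast
  ultimately show "s \<in> set (step_code (letter a) R)"
    using t(1) set_ts unfolding step_code_def by fastforce
qed

section \<open>Tables for \<open>alive\<close> and \<open>may_differ\<close>\<close>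

lemma finite_eqtypes: "finite {eqtype (map \<tau> rs) d |\<tau> (d :: 'x). True}"
proof (rule finite_subset[OF _ finite_range_eqtype[of "length rs"]], rule subsetI)
  fix t assume "t \<in> {eqtype (map \<tau> rs) d |\<tau> (d :: 'x). True}"
  then obtain \<tau> and d :: 'x where "t = eqtype (map \<tau> rs) d" by blast
  then show "t \<in> {eqtype vs v |vs (v :: 'x). length vs = length rs}"
    by (intro CollectI exI[of _ "map \<tau> rs"] exI[of _ d]) simp
qed

text \<open>\<open>alive\<close> involves no letter, so \<open>d0\<close> serves as a fixed second
  argument of \<open>eqtype\<close>.\<close>

lemma alive_table:
  "\<exists>A. computable A \<and> (\<forall>q\<in>nrt_states T. \<forall>\<tau>. A (state_code q, eqtype (map \<tau> rs) d0) = alive T (q, \<tau>))"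
proof -
  let ?D = "state_code ` nrt_states T \<times> {eqtype (map \<tau> rs) d |\<tau> (d :: 'd). True}"
  let ?F = "\<lambda>(k, t). \<exists>q \<tau>. q \<in> nrt_states T \<and> state_code q = k \<and> eqtype (map \<tau> rs) d0 = t \<and> alive T (q, \<tau>)"
  have "finite ?D" by (intro finite_cartesian_product finite_imageI finite_states finite_eqtypes)
  from computable_table[OF this, of ?F] obtain A where A: "computable A" "\<forall>x\<in>?D. A x = ?F x" by blast
  have "A (state_code q, eqtype (map \<tau> rs) d0) = alive T (q, \<tau>)" if q: "q \<in> nrt_states T" for q \<tau>
  proof -
    have "(state_code q, eqtype (map \<tau> rs) d0) \<in> ?D"
      using q by (intro SigmaI imageI CollectI exI[of _ \<tau>] exI[of _ d0]) simp_all
    from A(2)[THEN bspec, OF this]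
    have "A (state_code q, eqtype (map \<tau> rs) d0) \<longleftrightarrow> (\<exists>q' \<tau>'. q' \<in> nrt_states T \<and>
        state_code q' = state_code q \<and> eqtype (map \<tau>' rs) d0 = eqtype (map \<tau> rs) d0 \<and> alive T (q', \<tau>'))"
      by simp
    also have "\<dots> \<longleftrightarrow> alive T (q, \<tau>)"
    proof (intro iffI)
      assume "\<exists>q' \<tau>'. q' \<in> nrt_states T \<and> state_code q' = state_code q \<and>
        eqtype (map \<tau>' rs) d0 = eqtype (map \<tau> rs) d0 \<and> alive T (q', \<tau>')"
      then obtain q' \<tau>' where *: "q' \<in> nrt_states T" "state_code q' = state_code q"
        "eqtype (map \<tau>' rs) d0 = eqtype (map \<tau> rs) d0" "alive T (q', \<tau>')" by auto
      then have "q' = q" using state_code_eq q by simp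
      with alive_rename[OF wf set_rs *(3), of q'] *(4) show "alive T (q, \<tau>)" by simp
    qed (use q in auto)
    finally show ?thesis .
  qed
  with A(1) show ?thesis by blast
qed

lemma differ_table:
  "\<exists>D. computable D \<and> (\<forall>n. \<forall>q\<in>nrt_states T. \<forall>\<tau> \<gamma> d.
     D (n, state_code q, to_nat \<gamma>, eqtype (map \<tau> rs) d) = may_differ T n (q, \<tau>) (\<gamma>, d :: 'd))"
proof -
  obtain c :: "nat \<Rightarrow> nat" where c: "computable c" "finite (range c)"
    "\<And>m n. c m = c n \<Longrightarrow> (may_differ T m :: ('q, 'r, 'd) nrt_conf \<Rightarrow> _) = may_differ T n"
    using may_differ_classes[OF wf] by blast
  \<comment> \<open>Positions are unbounded, so the table is indexed by their classes
    \<open>c n\<close>, which can be computed.\<close>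
  let ?D = "range c \<times> state_code ` nrt_states T \<times> range (to_nat :: 'g \<Rightarrow> nat) \<times>
    {eqtype (map \<tau> rs) d |\<tau> (d :: 'd). True}"
  \<comment> \<open>An entry is defined by some representative of its key; by
    \<open>may_differ_rename\<close> and the choice of \<open>c\<close> all representatives
    agree.\<close>
  let ?F = "\<lambda>(k, p, g, t). \<exists>n q \<tau> \<gamma> d. c n = k \<and> q \<in> nrt_states T \<and> state_code q = p \<and>
    to_nat \<gamma> = g \<and> eqtype (map \<tau> rs) d = t \<and> may_differ T n (q, \<tau>) (\<gamma>, d :: 'd)"
  have "finite ?D" by (intro finite_cartesian_product finite_imageI c(2) finite_states finite_eqtypes finite)
  from computable_table[OF this, of ?F] obtain D where D: "computable D" "\<forall>x\<in>?D. D x = ?F x" by blast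
  have "D (c n, state_code q, to_nat \<gamma>, eqtype (map \<tau> rs) d) = may_differ T n (q, \<tau>) (\<gamma>, d)"
    if q: "q \<in> nrt_states T" for n q \<tau> \<gamma> and d :: 'd
  proof -
    have "(c n, state_code q, to_nat \<gamma>, eqtype (map \<tau> rs) d) \<in> ?D"
      using q by (intro SigmaI imageI rangeI CollectI exI[of _ \<tau>] exI[of _ d]) simp_all
    from D(2)[THEN bspec, OF this]
    have "D (c n, state_code q, to_nat \<gamma>, eqtype (map \<tau> rs) d) \<longleftrightarrow> (\<exists>n' q' \<tau>' \<gamma>' d'. c n' = c n \<and>
        q' \<in> nrt_states T \<and> state_code q' = state_code q \<and> to_nat \<gamma>' = to_nat \<gamma> \<and>
        eqtype (map \<tau>' rs) d' = eqtype (map \<tau> rs) d \<and> may_differ T n' (q', \<tau>') (\<gamma>', d' :: 'd))"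
      by simp
    also have "\<dots> \<longleftrightarrow> may_differ T n (q, \<tau>) (\<gamma>, d)"
    proof (intro iffI)
      assume "\<exists>n' q' \<tau>' \<gamma>' d'. c n' = c n \<and>
        q' \<in> nrt_states T \<and> state_code q' = state_code q \<and> to_nat \<gamma>' = to_nat \<gamma> \<and>
        eqtype (map \<tau>' rs) d' = eqtype (map \<tau> rs) d \<and> may_differ T n' (q', \<tau>') (\<gamma>', d' :: 'd)"
      then obtain n' q' \<tau>' \<gamma>' d' where *: "c n' = c n" "q' \<in> nrt_states T" "state_code q' = state_code q"
        "to_nat \<gamma>' = to_nat \<gamma>" "eqtype (map \<tau>' rs) d' = eqtype (map \<tau> rs) d"
        "may_differ T n' (q', \<tau>') (\<gamma>', d' :: 'd)" by auto
      then have "q' = q" "\<gamma>' = \<gamma>" using state_code_eq q by auto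
      then show "may_differ T n (q, \<tau>) (\<gamma>, d)"
        using may_differ_rename[OF wf set_rs *(5), of n q \<gamma>] *(6) c(3)[OF *(1)] by simp
    qed (use q in auto)
    finally show ?thesis .
  qed
  moreover have "computable (\<lambda>p. D (c (fst p), snd p))"
    by (intro computable_comp[OF D(1)] computable_intros computable_comp[OF c(1)])
  ultimately show ?thesis by (intro exI[of _ "\<lambda>p. D (c (fst p), snd p)"]) auto
qed

definition alive_code :: "nat \<times> bool list list \<times> bool list \<Rightarrow> bool" where
  "alive_code = (SOME A. computable A \<and>
     (\<forall>q\<in>nrt_states T. \<forall>\<tau>. A (state_code q, eqtype (regs_code \<tau>) (rep d0)) = alive T (q, \<tau>)))"

definition differ_code :: "nat \<times> nat \<times> nat \<times> bool list list \<times> bool list \<Rightarrow> bool" where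
  "differ_code = (SOME D. computable D \<and> (\<forall>n. \<forall>q\<in>nrt_states T. \<forall>\<tau> \<gamma> d.
     D (n, state_code q, to_nat \<gamma>, eqtype (regs_code \<tau>) (rep d)) = may_differ T n (q, \<tau>) (\<gamma>, d)))"

lemma alive_code:
  "computable alive_code"
  "q \<in> nrt_states T \<Longrightarrow> alive_code (state_code q, eqtype (regs_code \<tau>) (rep d0)) = alive T (q, \<tau>)"
  using someI_ex[OF alive_table, folded eqtype_regs_code] by (simp_all add: alive_code_def)

lemma differ_code:
  "computable differ_code"
  "q \<in> nrt_states T \<Longrightarrow>
    differ_code (n, state_code q, to_nat \<gamma>, eqtype (regs_code \<tau>) (rep d)) = may_differ T n (q, \<tau>) (\<gamma>, d)"
  using someI_ex[OF differ_table, folded eqtype_regs_code] by (simp_all add: differ_code_def)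

text \<open>Whether every accepting continuation of the run \<open>s\<close> has the letter \<open>l\<close> at position \<open>i\<close>.\<close>

definition forces :: "nat \<Rightarrow> nat \<times> bool list \<Rightarrow> run_code \<Rightarrow> bool" where
  "forces i l s \<longleftrightarrow> (if i < length (snd (snd s))
     then alive_code (fst s, eqtype (fst (snd s)) (rep d0)) \<longrightarrow> hd (drop i (snd (snd s))) = l
     else \<not> differ_code (i - length (snd (snd s)), fst s, fst l, eqtype (fst (snd s)) (snd l)))"

text \<open>Only letters already written by some run are tried. After a long enough prefix, an
  accepting run on the input supplies the right one.\<close>

definition candidates :: "nat \<Rightarrow> run_code list \<Rightarrow> (nat \<times> bool list) list" where
  "candidates i R = concat (map (\<lambda>s. if i < length (snd (snd s)) then [hd (drop i (snd (snd s)))] else []) R)"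

definition forced :: "nat \<Rightarrow> run_code list \<Rightarrow> (nat \<times> bool list) list" where
  "forced i R = filter (\<lambda>l. list_all (\<lambda>s. forces i l s) R) (candidates i R)"

lemma computable_forced: "computable (\<lambda>p. forced (fst p) (snd p))"
  unfolding forced_def candidates_def forces_def
  by (intro computable_intros computable_comp[OF alive_code(1)] computable_comp[OF differ_code(1)])

text \<open>Every symbol drops the head of the queue, which has just been emitted. At most one
  output letter is queued per input letter, so the index never skips a position.\<close>

fun process :: "'s tape_sym \<Rightarrow> algorithm_state \<Rightarrow> algorithm_state" where
  "process (Label \<sigma>) X = (to_nat \<sigma>, [], runs X, index X, tl (queue X))"
| "process (Bit b) X = (fst X, fst (snd X) @ [b], runs X, index X, tl (queue X))"
| "process End_Marker X =
    (let R = step_code (fst X, fst (snd X)) (runs X); F = forced (index X) R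
     in (fst X, fst (snd X), R, if F = [] then index X else Suc (index X),
         tl (queue X) @ (if F = [] then [] else letter_code (hd F))))"

definition start :: algorithm_state where
  "start = (0, [], [run_code (init, [])], 0, [])"

lemma computable_process: "computable (process a)"
proof (cases a)
  case (Label \<sigma>)
  have "process (Label \<sigma>) = (\<lambda>X. (to_nat \<sigma>, [], runs X, index X, tl (queue X)))" by auto
  then show ?thesis unfolding Label by (simp only:) (intro computable_intros)
next
  case (Bit b)
  have "process (Bit b) = (\<lambda>X. (fst X, fst (snd X) @ [b], runs X, index X, tl (queue X)))" by auto
  then show ?thesis unfolding Bit by (simp only:) (intro computable_intros)
next
  case End_Marker
  let ?R = "\<lambda>X :: algorithm_state. step_code (fst X, fst (snd X)) (runs X)"
  let ?F = "\<lambda>X. forced (index X) (?R X)"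
  have R: "computable ?R"
    using computable_comp[OF computable_step_code, of "\<lambda>X :: algorithm_state. ((fst X, fst (snd X)), runs X)"]
    by (simp add: computable_intros)
  have F: "computable ?F"
    using computable_comp[OF computable_forced, of "\<lambda>X. (index X, ?R X)"] R
    by (simp add: computable_intros)
  have "process End_Marker = (\<lambda>X. (fst X, fst (snd X), ?R X, if ?F X = [] then index X else Suc (index X),
      tl (queue X) @ (if ?F X = [] then [] else letter_code (hd (?F X)))))"
    by (auto simp: Let_def)
  then show ?thesis unfolding End_Marker letter_code_def by (simp only:) (intro computable_intros R F)
qed

lemma computable_queue_head: "computable (\<lambda>X. queue_head X = Some y)"
  unfolding queue_head_Some by (intro computable_intros)

end


section \<open>Correctness of the algorithm\<close>

context transducer
begin

lemma run_output:
  assumes "run_from T init x cs ws" "i < length (out_upto ws m)"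
  shows "out_upto ws m ! i = the (f x) !! i"
  using defined_run[OF inf_out defines_f assms(1)] assms(2) by fastforce

lemma run_in_dom: "run_from T init x cs ws \<Longrightarrow> x \<in> dom f"
  using defined_run[OF inf_out defines_f] by blast

lemma run_length:
  assumes "run_from T init x cs ws"
  shows "\<exists>k0. \<forall>k\<ge>k0. i < length (out_upto ws k)"
proof -
  obtain k0 where "Suc i \<le> length (out_upto ws k0)"
    using inf_out assms unfolding infinite_outputs_def accepting_run_iff by blast
  then have "i < length (out_upto ws k)" if "k \<ge> k0" for k
    using prefix_length_le[OF prefix_out_upto[OF that, of ws]] by simp
  then show ?thesis by blast
qed

lemma forces_run_code:
  assumes "path T init u v c"
  shows "forces i (letter l) (run_code (c, v)) \<longleftrightarrow>
    (if i < length v then alive T c \<longrightarrow> v ! i = l else \<not> may_differ T (i - length v) c l)"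
proof -
  obtain q \<tau> where c: "c = (q, \<tau>)" by fastforce
  have q: "q \<in> nrt_states T" using path_init_state[OF assms] by (simp add: c)
  have "i < length v \<Longrightarrow> hd (drop i (map letter v)) = letter l \<longleftrightarrow> v ! i = l"
    by (simp add: hd_drop_conv_nth letter_eq)
  then show ?thesis
    using alive_code(2)[OF q, of \<tau>] differ_code(2)[OF q, of "i - length v" "fst l" \<tau> "snd l"]
    by (simp add: forces_def run_code_def c) (simp add: letter_def)
qed

text \<open>It suffices to look at one accepting run on \<open>x\<close>: its initial part is among
  the runs in \<open>R\<close>, and its own continuation has to obey the forced letter.\<close>

lemma forced_sound:
  assumes R: "set R = run_code ` {(c, v). path T init (stake k x) v c}" and x: "x \<in> dom f"
    and l: "l' \<in> set (forced i R)"
  shows "l' = letter (the (f x) !! i)"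
proof -
  have cand: "l' \<in> set (candidates i R)" and all: "\<And>s. s \<in> set R \<Longrightarrow> forces i l' s"
    using l by (auto simp: forced_def list_all_iff)
  then obtain v :: "('g \<times> 'd) list" where "i < length (map letter v)" "l' = hd (drop i (map letter v))"
    using R by (auto simp: candidates_def run_code_def split: if_splits)
  then have "l' = letter (v ! i)" by (simp add: hd_drop_conv_nth)
  then obtain l :: "'g \<times> 'd" where l: "l' = letter l" by blast
  obtain cs ws where run: "run_from T init x cs ws"
    using run_of_defined[OF defines_f x] by blast
  let ?v = "out_upto ws k"
  have path: "path T init (stake k x) ?v (cs k)" by (rule run_from_path[OF run])
  then have "run_code (cs k, ?v) \<in> set R" unfolding R by blast
  from all[OF this] have force: "if i < length ?v then alive T (cs k) \<longrightarrow> ?v ! i = l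
      else \<not> may_differ T (i - length ?v) (cs k) l"
    unfolding l forces_run_code[OF path] .
  have suffix: "run_from T (cs k) (sdrop k x) (\<lambda>i. cs (k + i)) (\<lambda>i. ws (k + i))"
    by (rule run_from_sdrop[OF run])
  have "the (f x) !! i = l"
  proof (cases "i < length ?v")
    case True
    then show ?thesis using force suffix run_output[OF run True] unfolding alive_def by auto
  next
    case False
    obtain m where m: "i < length (out_upto ws (k + m))"
      using run_length[OF run, of i] by (metis le_add2)
    then have "out_upto (\<lambda>i. ws (k + i)) m ! (i - length ?v) = l"
      using force suffix False unfolding may_differ_def by (auto simp: out_upto_add)
    then have "out_upto ws (k + m) ! i = l"
      using False by (simp add: out_upto_add nth_append)
    then show ?thesis using run_output[OF run m] by simp
  qed
  then show ?thesis by (simp add: l)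
qed

lemma forced_complete:
  assumes cont: "word_continuous f" and x: "x \<in> dom f"
  shows "\<exists>k0. \<forall>k\<ge>k0. \<forall>R. set R = run_code ` {(c, v). path T init (stake k x) v c} \<longrightarrow> forced i R \<noteq> []"
proof -
  obtain j where j: "\<And>y. y \<in> dom f \<Longrightarrow> stake j x = stake j y \<Longrightarrow>
      stake (Suc i) (the (f x)) = stake (Suc i) (the (f y))"
    using cont x unfolding word_continuous_def word_continuous_at_def le_lcp_len_iff by meson
  have agree: "the (f y) !! i = the (f x) !! i" if "y \<in> dom f" "stake j x = stake j y" for y
    using j[OF that] by (metis lessI stake_nth)
  obtain cs ws where run: "run_from T init x cs ws"
    using run_of_defined[OF defines_f x] by blast
  obtain k1 where k1: "\<forall>k\<ge>k1. i < length (out_upto ws k)" using run_length[OF run] by blast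
  let ?l = "the (f x) !! i"
  have "letter ?l \<in> set (forced i R)"
    \<comment> \<open>From \<open>j\<close> on, continuity fixes the output at position
      \<open>i\<close>; from \<open>k1\<close> on, the accepting run on \<open>x\<close> has written
      this position, which makes its letter a candidate.\<close>
    if k: "k \<ge> max j k1" and R: "set R = run_code ` {(c, v). path T init (stake k x) v c}" for k R
  proof -
    have "run_code (cs k, out_upto ws k) \<in> set R" unfolding R using run_from_path[OF run] by blast
    moreover have "hd (drop i (map letter (out_upto ws k))) = letter ?l"
      using k1 k run_output[OF run] by (simp add: hd_drop_conv_nth)
    ultimately have "letter ?l \<in> set (candidates i R)"
      using k1 k unfolding candidates_def
      by (auto simp: run_code_def intro!: bexI[of _ "run_code (cs k, out_upto ws k)"])
    moreover have "forces i (letter ?l) s" if "s \<in> set R" for s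
    proof -
      obtain c v where s: "s = run_code (c, v)" and path: "path T init (stake k x) v c"
        using \<open>s \<in> set R\<close> unfolding R by blast
      have ext: "the (f y) !! i = ?l" if "y = stake k x @- z" "y \<in> dom f" for y z
      proof (rule agree[OF that(2)])
        show "stake j x = stake j y"
          using k by (simp add: that(1) stake_shift min_def) (metis min.absorb1 take_stake)
      qed
      show ?thesis unfolding s forces_run_code[OF path]
      proof (split if_split, intro conjI impI notI)
        assume i: "i < length v" and "alive T c"
        then obtain z cs0 ws0 where "run_from T c z cs0 ws0" unfolding alive_def by blast
        from run_from_append[OF path this] obtain cs' ws' where
          run': "run_from T init (stake k x @- z) cs' ws'" "out_upto ws' (length (stake k x) + 0) = v"
          by (metis append_Nil2 out_upto_0)
        then show "v ! i = ?l"
          using run_output[OF run'(1), of i] i ext[OF refl run_in_dom[OF run'(1)]] by metis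
      next
        assume i: "\<not> i < length v" and "may_differ T (i - length v) c ?l"
        then obtain z cs0 ws0 m where run0: "run_from T c z cs0 ws0" "i - length v < length (out_upto ws0 m)"
          "out_upto ws0 m ! (i - length v) \<noteq> ?l" unfolding may_differ_def by blast
        from run_from_append[OF path run0(1)] obtain cs' ws' where
          run': "run_from T init (stake k x @- z) cs' ws'"
          "out_upto ws' (length (stake k x) + m) = v @ out_upto ws0 m" by blast
        have "i < length (out_upto ws' (length (stake k x) + m))" using run'(2) run0(2) i by simp
        from run_output[OF run'(1) this] have "out_upto ws' (length (stake k x) + m) ! i = ?l"
          using ext[OF refl run_in_dom[OF run'(1)]] by simp
        then show False using run'(2) run0(3) i by (simp add: nth_append)
      qed
    qed
    ultimately show ?thesis by (simp add: forced_def list_all_iff)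
  qed
  then show ?thesis by (metis empty_iff empty_set)
qed

section \<open>The output queue\<close>

lemma process_queue:
  assumes "queue (process a X) = tl (queue X) @ map sym_code p"
    and "queue X = map sym_code pend" "O1 @ tl pend = z"
  shows "\<exists>pend'. queue (process a X) = map sym_code pend' \<and>
    (O1 @ (case queue_head (process a X) of None \<Rightarrow> [] | Some y \<Rightarrow> [y :: 'g tape_sym])) @ tl pend' = z @ p"
proof -
  let ?p = "tl pend @ p"
  have q: "queue (process a X) = map sym_code ?p"
    using assms(1,2) by (simp add: map_tl)
  then have "queue_head (process a X) = (case ?p of [] \<Rightarrow> None | y # _ \<Rightarrow> Some y)"
    by (rule queue_head_map)
  then have "(O1 @ (case queue_head (process a X) of None \<Rightarrow> [] | Some y \<Rightarrow> [y])) @ tl ?p = O1 @ ?p"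
    by (cases ?p) auto
  with q assms(3) show ?thesis by (intro exI[of _ ?p]) auto
qed

abbreviation emit :: "'s tape_sym list \<Rightarrow> 'g tape_sym list" where
  "emit as \<equiv> emitted process queue_head start as"

abbreviation state :: "'s tape_sym list \<Rightarrow> algorithm_state" where
  "state as \<equiv> fold process as start"

text \<open>The emitted symbols and the tail of the queue (its head has just been emitted) together
  form \<open>z\<close>.\<close>

definition pushed :: "'s tape_sym list \<Rightarrow> 'g tape_sym list \<Rightarrow> bool" where
  "pushed as z \<longleftrightarrow> (\<exists>pend. queue (state as) = map sym_code pend \<and> emit as @ tl pend = z)"

lemma emit_snoc: "emit (as @ [a]) = emit as @
    (case queue_head (process a (state as)) of None \<Rightarrow> [] | Some y \<Rightarrow> [y])"
  by (simp add: emitted_append)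

lemma pushed_snoc:
  assumes "pushed as z" "queue (process a (state as)) = tl (queue (state as)) @ map sym_code p"
  shows "pushed (as @ [a]) (z @ p)"
  using assms(1) process_queue[OF assms(2)] unfolding pushed_def emit_snoc by fastforce

lemma pushed_letter:
  assumes "pushed as z"
  shows "pushed (as @ Label \<sigma> # map Bit bs) z \<and>
    state (as @ Label \<sigma> # map Bit bs) = (to_nat \<sigma>, bs, runs (state as), index (state as),
      queue (state (as @ Label \<sigma> # map Bit bs)))"
proof (induction bs rule: rev_induct)
  case Nil
  have "pushed (as @ [Label \<sigma>]) (z @ [])"
    by (rule pushed_snoc[OF assms]) simp
  then show ?case by simp
next
  case (snoc b bs)
  let ?as = "as @ Label \<sigma> # map Bit bs"
  have "pushed (?as @ [Bit b]) (z @ [])"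
    by (rule pushed_snoc) (use snoc in auto)
  moreover have "state (?as @ [Bit b]) = process (Bit b) (state ?as)" by simp
  ultimately show ?case using snoc by (simp add: prod_eq_iff)
qed

text \<open>For unbounded output one emission per input letter is enough. The one at the label is
  counted, unless all of \<open>z\<close> is already written.\<close>

lemma emit_length_Label:
  assumes "pushed as z"
  shows "min (Suc (length (emit as))) (length z) \<le> length (emit (as @ Label \<sigma> # bs))"
proof -
  obtain pend where pend: "queue (state as) = map sym_code pend" "emit as @ tl pend = z"
    using assms unfolding pushed_def by blast
  have "queue (process (Label \<sigma>) (state as)) = map sym_code (tl pend)"
    by (simp add: pend(1) map_tl)
  then have head: "queue_head (process (Label \<sigma>) (state as)) =
      (case tl pend of [] \<Rightarrow> None | y # _ \<Rightarrow> Some (y :: 'g tape_sym))" by (rule queue_head_map)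
  have "min (Suc (length (emit as))) (length z) \<le> length (emit (as @ [Label \<sigma>]))"
    unfolding emit_snoc head using pend(2) by (cases "tl pend") auto
  also have "\<dots> \<le> length (emit ((as @ [Label \<sigma>]) @ bs))"
    by (simp only: emitted_append length_append le_add1)
  finally show ?thesis by simp
qed

abbreviation read :: "('s \<times> 'd) stream \<Rightarrow> nat \<Rightarrow> 's tape_sym list" where
  "read x k \<equiv> enc_word rep (stake k x)"

lemma read_Suc: "read x (Suc k) =
    (read x k @ Label (fst (x !! k)) # map Bit (rep (snd (x !! k)))) @ [End_Marker]"
  by (simp add: stake_Suc enc_word_append enc_letter_def del: stake.simps(2))

lemma state_read_Suc:
  fixes x k
  defines "X \<equiv> state (read x k)" and "X' \<equiv> state (read x (Suc k))"
  defines "F \<equiv> forced (index X) (step_code (letter (x !! k)) (runs X))"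
  assumes "pushed (read x k) z"
  shows "runs X' = step_code (letter (x !! k)) (runs X)"
    and "index X' = (if F = [] then index X else Suc (index X))"
    and "F = [] \<Longrightarrow> pushed (read x (Suc k)) z"
    and "F \<noteq> [] \<Longrightarrow> hd F = letter l \<Longrightarrow> pushed (read x (Suc k)) (z @ enc_letter rep l)"
proof -
  let ?as = "read x k @ Label (fst (x !! k)) # map Bit (rep (snd (x !! k)))"
  have *: "pushed ?as z" "state ?as = (to_nat (fst (x !! k)), rep (snd (x !! k)), runs X, index X, queue (state ?as))"
    using pushed_letter[OF assms(4)] unfolding X_def by blast+
  have X': "X' = process End_Marker (state ?as)" unfolding X'_def read_Suc by simp
  have proc: "process End_Marker (state ?as) = (to_nat (fst (x !! k)), rep (snd (x !! k)),
      step_code (letter (x !! k)) (runs X), if F = [] then index X else Suc (index X),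
      tl (queue (state ?as)) @ (if F = [] then [] else letter_code (hd F)))"
    by (subst *(2)) (simp add: F_def Let_def letter_def)
  show "runs X' = step_code (letter (x !! k)) (runs X)"
    "index X' = (if F = [] then index X else Suc (index X))"
    unfolding X' proc by simp_all
  show "pushed (read x (Suc k)) z" if "F = []"
    using pushed_snoc[OF *(1), of End_Marker "[]"] that unfolding read_Suc proc by simp
  show "pushed (read x (Suc k)) (z @ enc_letter rep l)" if "F \<noteq> []" "hd F = letter l"
    unfolding read_Suc by (rule pushed_snoc[OF *(1)]) (simp only: proc that if_False snd_conv letter_code_letter)
qed

text \<open>The index is both the number of letters pushed and the position under examination; so
  what has been pushed is always the code of a prefix of \<open>f x\<close>.\<close>

lemma algorithm_invariant:
  assumes x: "x \<in> dom f"
  shows "set (runs (state (read x k))) = run_code ` {(c, v). path T init (stake k x) v c} \<and>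
    pushed (read x k) (enc_word rep (stake (index (state (read x k))) (the (f x))))"
proof (induction k)
  case 0
  have "path T init [] v c \<longleftrightarrow> v = [] \<and> c = init" for v c
    by (auto intro: path_Nil elim: path.cases)
  then show ?case by (auto simp: start_def pushed_def)
next
  case (Suc k)
  let ?X = "state (read x k)"
  let ?R = "step_code (letter (x !! k)) (runs ?X)"
  let ?F = "forced (index ?X) ?R"
  note step = state_read_Suc[OF conjunct2[OF Suc.IH]]
  have R: "set ?R = run_code ` {(c, v). path T init (stake (Suc k) x) v c}"
    using set_step_code[OF conjunct1[OF Suc.IH]] by (simp add: stake_Suc del: stake.simps(2))
  moreover have "pushed (read x (Suc k)) (enc_word rep (stake (index (state (read x (Suc k)))) (the (f x))))"
  proof (cases "?F = []")
    case True
    then show ?thesis using step(2,3) by simp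
  next
    case False
    then have "hd ?F = letter (the (f x) !! index ?X)" using forced_sound[OF R x] by simp
    from step(4)[OF False this] step(2) False show ?thesis
      by (simp add: stake_Suc enc_word_append del: stake.simps(2))
  qed
  ultimately show ?case using step(1) by simp
qed

text \<open>Once the index is at least \<open>n\<close> and position \<open>n\<close> is forced
  after every further letter, one more letter takes the index beyond \<open>n\<close>.\<close>

lemma index_unbounded:
  assumes "word_continuous f" "x \<in> dom f"
  shows "\<exists>k0. \<forall>k\<ge>k0. n \<le> index (state (read x k))"
proof (induction n)
  case (Suc n)
  let ?i = "\<lambda>k. index (state (read x k))"
  have step: "?i (Suc k) = (if forced (?i k) (runs (state (read x (Suc k)))) = [] then ?i k else Suc (?i k))" for k
    using state_read_Suc(1,2)[OF conjunct2[OF algorithm_invariant[OF assms(2)]], of k] by simp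
  have mono: "?i k \<le> ?i k'" if "k \<le> k'" for k k'
    using that by (induction k' rule: dec_induct) (simp_all add: step del: stake.simps(2))
  obtain k0 where k0: "\<forall>k\<ge>k0. n \<le> ?i k" using Suc.IH by blast
  obtain k1 where k1: "\<forall>k\<ge>k1. \<forall>R. set R = run_code ` {(c, v). path T init (stake k x) v c} \<longrightarrow> forced n R \<noteq> []"
    using forced_complete[OF assms] by blast
  let ?k = "max k0 k1"
  have "Suc n \<le> ?i (Suc ?k)"
  proof (cases "?i ?k = n")
    case True
    have "forced n (runs (state (read x (Suc ?k)))) \<noteq> []"
      using k1 conjunct1[OF algorithm_invariant[OF assms(2), of "Suc ?k"]] by (meson le_SucI max.cobounded2)
    then show ?thesis using step[of ?k] True by simp
  next
    case False
    then have "Suc n \<le> ?i ?k" using k0[rule_format, of ?k] by simp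
    then show ?thesis using mono[of ?k "Suc ?k"] by linarith
  qed
  then have "\<forall>k\<ge>Suc ?k. Suc n \<le> ?i k" using order_trans[OF _ mono] by blast
  then show ?case by (rule exI)
qed simp

text \<open>Codes of letters are nonempty, so the pushed word outgrows \<open>n\<close> together
  with the index. From then on the next input letter lengthens an output of length
  \<open>n\<close>.\<close>

lemma emit_unbounded:
  assumes "word_continuous f" "x \<in> dom f"
  shows "\<exists>k0. \<forall>k\<ge>k0. n \<le> length (emit (read x k))"
proof (induction n)
  case (Suc n)
  let ?z = "\<lambda>k. enc_word rep (stake (index (state (read x k))) (the (f x)))"
  obtain k0 where k0: "\<forall>k\<ge>k0. n \<le> length (emit (read x k))" using Suc.IH by blast
  obtain k1 where k1: "\<forall>k\<ge>k1. Suc n \<le> index (state (read x k))" using index_unbounded[OF assms] by blast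
  have "Suc n \<le> length (emit (read x (Suc k)))" if k: "k \<ge> max k0 k1" for k
  proof -
    have "min (Suc (length (emit (read x k)))) (length (?z k)) \<le> length (emit (read x (Suc k)))"
      using emit_length_Label[OF conjunct2[OF algorithm_invariant[OF assms(2)]],
        of k "fst (x !! k)" "map Bit (rep (snd (x !! k))) @ [End_Marker]"]
      by (simp add: read_Suc del: stake.simps(2))
    moreover have "Suc n \<le> index (state (read x k))"
      by (rule k1[rule_format]) (use k in simp)
    then have "Suc n \<le> length (?z k)"
      using length_le_enc_word[of "stake (index (state (read x k))) (the (f x))" rep]
      unfolding length_stake by (rule order_trans)
    moreover have "n \<le> length (emit (read x k))"
      by (rule k0[rule_format]) (use k in simp)
    ultimately show ?thesis by linarith
  qed
  then have "\<forall>k\<ge>Suc (max k0 k1). Suc n \<le> length (emit (read x k))"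
    by (metis Suc_le_D Suc_le_mono)
  then show ?case by blast
qed simp

theorem word_continuous_imp_computable:
  assumes "word_continuous f"
  shows "word_computable rep f"
proof -
  have "queue_head start = (None :: 'g tape_sym option)" by (simp add: queue_head_def start_def)
  from stream_processor_machine[where h = process and out = queue_head and ?X0.0 = start,
      OF finite_tape_sym finite_tape_sym computable_process computable_queue_head this]
  obtain M :: "('s, 'g) tm" where wf_M: "wf_tm M"
    and M: "\<And>inp k. \<exists>n. c_inpos (tm_run M inp n) = k \<and> c_out (tm_run M inp n) = emit (stake k inp)"
    by blast
  have "(\<forall>k. \<exists>n. tm_has_read rep M x k n) \<and> word_converges (tm_output rep M x) (enc_stream rep (the (f x)))"
    if x: "x \<in> dom f" for x
  proof -
    let ?run = "tm_run M (enc_stream rep x)"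
    have at: "\<exists>n. c_inpos (?run n) = length (read x k) \<and> c_out (?run n) = emit (read x k)" for k
      using M[of "enc_stream rep x" "length (read x k)"] by (simp add: stake_enc_stream)
    have has_read: "\<exists>n. tm_has_read rep M x k n" for k
      using at[of k] unfolding tm_has_read_def by (metis order_refl)
    \<comment> \<open>The first moment past \<open>k\<close> letters may come before
      \<open>emit (read x k)\<close> is on the tape, so the output is only bounded from both sides,
      with a delay of one letter.\<close>
    have upper: "prefix (tm_output rep M x k) (emit (read x k))" for k
    proof -
      obtain n where n: "c_inpos (?run n) = length (read x k)" "c_out (?run n) = emit (read x k)"
        using at by blast
      then have "(LEAST n. tm_has_read rep M x k n) \<le> n"
        by (intro Least_le) (simp add: tm_has_read_def)
      then show ?thesis
        unfolding tm_output_def n(2)[symmetric] using tm_run_mono by blast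
    qed
    have lower: "prefix (emit (read x k)) (tm_output rep M x (Suc k))" for k
    proof -
      obtain n where n: "c_inpos (?run n) = length (read x k)" "c_out (?run n) = emit (read x k)"
        using at by blast
      let ?m = "LEAST n. tm_has_read rep M x (Suc k) n"
      have "length (read x (Suc k)) \<le> c_inpos (?run ?m)"
        using LeastI_ex[OF has_read[of "Suc k"]] by (simp add: tm_has_read_def)
      \<comment> \<open>The code of a letter is nonempty, so the strictly smaller head position
        places moment \<open>n\<close> before \<open>?m\<close>.\<close>
      then have "c_inpos (?run n) < c_inpos (?run ?m)" using n(1) by (simp add: read_Suc del: stake.simps(2))
      then have "n \<le> ?m" by (meson leD nat_le_linear tm_run_mono)
      then show ?thesis
        unfolding tm_output_def n(2)[symmetric] using tm_run_mono by blast
    qed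
    have "tm_output rep M x k = stake (length (tm_output rep M x k)) (enc_stream rep (the (f x)))" for k
    proof -
      let ?z = "enc_word rep (stake (index (state (read x k))) (the (f x)))"
      have "prefix (emit (read x k)) ?z"
        using conjunct2[OF algorithm_invariant[OF x, of k]] unfolding pushed_def by (metis prefixI)
      with upper have "prefix (tm_output rep M x k) ?z" using prefix_order.order_trans by blast
      then have w: "tm_output rep M x k = take (length (tm_output rep M x k)) ?z"
        and le: "length (tm_output rep M x k) \<le> length ?z"
        by (auto simp: prefix_def)
      have "take (length (tm_output rep M x k)) ?z =
          take (length (tm_output rep M x k)) (stake (length ?z) (enc_stream rep (the (f x))))"
        by (simp only: stake_enc_stream)
      also have "\<dots> = stake (length (tm_output rep M x k)) (enc_stream rep (the (f x)))"
        using le by (simp only: take_stake min.absorb1)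
      finally show ?thesis using w by (rule trans[rotated])
    qed
    moreover have "\<exists>k0. \<forall>k\<ge>k0. n \<le> length (tm_output rep M x k)" for n
    proof -
      obtain k0 where k0: "\<forall>k\<ge>k0. n \<le> length (emit (read x k))" using emit_unbounded[OF assms x] by blast
      have "n \<le> length (tm_output rep M x (Suc k))" if "k \<ge> k0" for k
        using k0 that prefix_length_le[OF lower[of k]] by (meson order_trans)
      then have "\<forall>k\<ge>Suc k0. n \<le> length (tm_output rep M x k)" by (metis Suc_le_D Suc_le_mono)
      then show ?thesis by blast
    qed
    ultimately have "word_converges (tm_output rep M x) (enc_stream rep (the (f x)))"
      by (rule word_converges_prefixes)
    with has_read show ?thesis by blast
  qed
  with wf_M show ?thesis unfolding word_computable_def by blast
qed

end

theorem theorem5: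
  fixes T :: "('q, 'r, 's::finite, 'g::finite) nrt"
    and d0 :: 'd
    and rep :: "'d \<Rightarrow> bool list"
    and f :: "('s \<times> 'd) stream \<rightharpoonup> ('g \<times> 'd) stream"
  assumes "infinite (UNIV :: 'd set)"
    and "effective_rep rep"
    and "wf_nrt T"
    and "infinite_outputs T d0"
    and "nrt_defines T d0 f"
  shows "word_continuous f \<longleftrightarrow> word_computable rep f"
proof
  have inj: "inj rep" using assms(2) by (simp add: effective_rep_def)
  then show "word_continuous f" if "word_computable rep f"
    using that by (rule word_computable_imp_continuous)
  have "finite (nrt_regs T)" "finite (nrt_delta T)" using assms(3) by (simp_all add: wf_nrt_def)
  then obtain rs ts where "set rs = nrt_regs T" "set ts = nrt_delta T" by (meson finite_list)
  then interpret transducer T d0 rep f rs ts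
    using inj assms(3-5) by unfold_locales
  show "word_computable rep f" if "word_continuous f"
    using that by (rule word_continuous_imp_computable)
qed

end
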